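(* Let $\mathfrak{g}$ be a $Q$-good Lie algebra (with respect to $\pi: Q\to\mathbb{Z}$), let $\varphi:\mathfrak{n}\to\mathbb{C}$ be a homomorphism of Lie algebras, let $I$ be an ideal of $A=S(Z'')$, let $V=M_\varphi/IM_\varphi$, and let $w'\in V$ be the image of $w=1\otimes 1\in M_\varphi$. Suppose $(\mathfrak{g},\pi)$ is nonsingular with respect to $\varphi$. Then every Whittaker vector (of type $\varphi$) of $V$ is of the form $pw'$ with $p\in A=S(Z'')$.
   Context: Setting. $Q$ is a free abelian group with a total order $\leq$ compatible with its group structure, and $\pi:Q\to\mathbb{Z}$ is a homomorphism of abelian groups that preserves the ordering ($\alpha\le\beta$ implies $\pi(\alpha)\le\pi(\beta)$). $\mathfrak{g}=\bigoplus_{\alpha\in Q}\mathfrak{g}_\alpha$ is a $Q$-graded Lie algebra over $\mathbb{C}$, i.e. $[\mathfrak{g}_\alpha,\mathfrak{g}_\beta]\subseteq\mathfrak{g}_{\alpha+\beta}$. $Z$ is the center of $\mathfrak{g}$; it is a graded ideal. Put $Q'=\{\alpha\in Q:\pi(\alpha)>0\}$, $Q''=\{\alpha\in Q:\pi(\alpha)\le 0\}$, $\mathfrak{n}=\bigoplus_{\alpha\in Q'}\mathfrak{g}_\alpha$, $\mathfrak{b}_-=\bigoplus_{\alpha\in Q''}\mathfrak{g}_\alpha$, so $\mathfrak{g}=\mathfrak{b}_-\oplus\mathfrak{n}$; write $\mathfrak{n}_\alpha=\mathfrak{g}_\alpha$ for $\alpha\in Q'$. $\mathfrak{g}$ is called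 $Q$-good if $\dim\mathfrak{g}_\alpha\le 1$ for all $\alpha\in Q'$ and $\dim(\mathfrak{g}/Z)_\alpha\le 1$ for all $\alpha\in Q''$. Notation. $K=\{\alpha\in Q:\mathfrak{g}_\alpha\ne 0\}$, $K'=K\cap Q'$, $K''=K\cap Q''$, $R''=\{\alpha\in K'' : Z\cap\mathfrak{g}_\alpha=\mathfrak{g}_\alpha\}$, $Z''=Z\cap\mathfrak{b}_-$. For each $\alpha\in K\setminus R''$ fix a nonzero $x_\alpha\in\mathfrak{g}_\alpha$ with $x_\alpha\notin Z''$. $U(\cdot)$ is the universal enveloping algebra, and $S(Z'')$ is the symmetric algebra of $Z''$, viewed as the (central) subalgebra $U(Z'')$ of $U(\mathfrak{g})$. Whittaker modules. A vector $v$ in a $\mathfrak{g}$-module $V$ is a Whittaker vector of type $\varphi$ if $xv=\varphi(x)v$ for all $x\in\mathfrak{n}$. $\mathbb{C}_\varphi$ is the one-dimensional $\mathfrak{n}$-module with $xa=\varphi(x)a$, and $M_\varphi=U(\mathfrak{g})\otimes_{U(\mathfrak{n})}\mathbb{C}_\varphi$. Nonsingularity. $(\mathfrak{g},\pi)$ is nonsingular with respect to $\varphi$ if (1) the set $\{\alpha\in K':\varphi(x_\alpha)\ne 0\}$ admits a unique maximal element, denoted $\alpha_\varphi$; and (2) for every $\beta\in K''\setminus R''$ there exists $y\in\mathfrak{n}_{\alpha_\varphi-\beta}$ such that $\varphi([y,x_\beta])\ne 0$. *)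

theory Defs
  imports
    Complex_Main
    "HOL-Library.Poly_Mapping"
    "HOL-Algebra.Free_Abelian_Groups"
    "HOL-Algebra.Generated_Groups"
    "HOL-Algebra.QuotRing"
    "HOL-Algebra.Module"
begin

section \<open>Complex Lie algebras\<close>

class lie_algebra = ab_group_add +
  fixes scale_complex :: "complex \<Rightarrow> 'a \<Rightarrow> 'a"  (infixr \<open>*\<^sub>C\<close> 75)
    and bracket :: "'a \<Rightarrow> 'a \<Rightarrow> 'a"
  assumes scale_add_right: "c *\<^sub>C (x + y) = c *\<^sub>C x + c *\<^sub>C y"
    and scale_add_left: "(c + d) *\<^sub>C x = c *\<^sub>C x + d *\<^sub>C x"
    and scale_scale: "c *\<^sub>C d *\<^sub>C x = (c * d) *\<^sub>C x"
    and scale_one: "1 *\<^sub>C x = x"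
    and bracket_add_left: "bracket (x + y) z = bracket x z + bracket y z"
    and bracket_add_right: "bracket x (y + z) = bracket x y + bracket x z"
    and bracket_scale_left: "bracket (c *\<^sub>C x) y = c *\<^sub>C bracket x y"
    and bracket_scale_right: "bracket x (c *\<^sub>C y) = c *\<^sub>C bracket x y"
    and bracket_self: "bracket x x = 0"
    and jacobi: "bracket x (bracket y z) + bracket y (bracket z x) + bracket z (bracket x y) = 0"

global_interpretation lie: vector_space "scale_complex :: complex \<Rightarrow> 'a \<Rightarrow> 'a::lie_algebra"
  by unfold_locales (rule scale_add_right scale_add_left scale_scale scale_one)+

definition lie_center :: "'g::lie_algebra set" where
  "lie_center = {z. \<forall>x. bracket z x = 0}"

text \<open>A Lie algebra homomorphism from the subalgebra \<open>H\<close> to the (abelian) Lie algebra of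
  complex numbers. Only the values of \<open>\<phi>\<close> on \<open>H\<close> are relevant.\<close>

definition lie_character :: "'g::lie_algebra set \<Rightarrow> ('g \<Rightarrow> complex) \<Rightarrow> bool" where
  "lie_character H \<phi> \<longleftrightarrow>
     (\<forall>x\<in>H. \<forall>y\<in>H. \<phi> (x + y) = \<phi> x + \<phi> y) \<and>
     (\<forall>c. \<forall>x\<in>H. \<phi> (c *\<^sub>C x) = c * \<phi> x) \<and>
     (\<forall>x\<in>H. \<forall>y\<in>H. \<phi> (bracket x y) = 0)"

text \<open>\<open>B\<close> is a finite subset of \<open>S\<close> whose classes form a basis of the image of the subspace
  \<open>S\<close> in the quotient by the subspace \<open>T\<close>. Dimension bounds are stated with finite bases,
  since the library function \<open>dim\<close> takes the value 0 on infinite-dimensional spaces.\<close>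

definition finite_basis_mod :: "'g::lie_algebra set \<Rightarrow> 'g set \<Rightarrow> 'g set \<Rightarrow> bool" where
  "finite_basis_mod T S B \<longleftrightarrow>
     finite B \<and> B \<subseteq> S \<and>
     (\<forall>x\<in>S. \<exists>c. x - (\<Sum>b\<in>B. c b *\<^sub>C b) \<in> T) \<and>
     (\<forall>c. (\<Sum>b\<in>B. c b *\<^sub>C b) \<in> T \<longrightarrow> (\<forall>b\<in>B. c b = 0))"

definition dim_mod_le :: "'g::lie_algebra set \<Rightarrow> 'g set \<Rightarrow> nat \<Rightarrow> bool" where
  "dim_mod_le T S n \<longleftrightarrow> (\<exists>B. finite_basis_mod T S B \<and> card B \<le> n)"


section \<open>Graded Lie algebras\<close>

definition free_abelian :: "'q::ab_group_add itself \<Rightarrow> bool" where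
  "free_abelian _ \<longleftrightarrow>
     (\<exists>S :: 'q set. free_Abelian_group S \<cong> \<lparr>carrier = (UNIV :: 'q set), monoid.mult = (+), one = 0\<rparr>)"

definition lie_grading :: "('q::ab_group_add \<Rightarrow> 'g::lie_algebra set) \<Rightarrow> bool" where
  "lie_grading gr \<longleftrightarrow>
     (\<forall>\<alpha>. lie.subspace (gr \<alpha>)) \<and>
     (\<forall>x. \<exists>!f. (\<forall>\<alpha>. f \<alpha> \<in> gr \<alpha>) \<and> finite {\<alpha>. f \<alpha> \<noteq> 0} \<and> x = (\<Sum>\<alpha> | f \<alpha> \<noteq> 0. f \<alpha>)) \<and>
     (\<forall>\<alpha> \<beta>. \<forall>x\<in>gr \<alpha>. \<forall>y\<in>gr \<beta>. bracket x y \<in> gr (\<alpha> + \<beta>))"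

definition pos_part :: "('q \<Rightarrow> 'g::lie_algebra set) \<Rightarrow> ('q \<Rightarrow> int) \<Rightarrow> 'g set" where
  "pos_part gr \<pi> = lie.span (\<Union>\<alpha>\<in>{\<alpha>. \<pi> \<alpha> > 0}. gr \<alpha>)"

definition nonpos_part :: "('q \<Rightarrow> 'g::lie_algebra set) \<Rightarrow> ('q \<Rightarrow> int) \<Rightarrow> 'g set" where
  "nonpos_part gr \<pi> = lie.span (\<Union>\<alpha>\<in>{\<alpha>. \<pi> \<alpha> \<le> 0}. gr \<alpha>)"

definition center_nonpos :: "('q \<Rightarrow> 'g::lie_algebra set) \<Rightarrow> ('q \<Rightarrow> int) \<Rightarrow> 'g set" where
  "center_nonpos gr \<pi> = lie_center \<inter> nonpos_part gr \<pi>"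

definition supp :: "('q \<Rightarrow> 'g::lie_algebra set) \<Rightarrow> 'q set" where
  "supp gr = {\<alpha>. gr \<alpha> \<noteq> {0}}"

definition supp_pos :: "('q \<Rightarrow> 'g::lie_algebra set) \<Rightarrow> ('q \<Rightarrow> int) \<Rightarrow> 'q set" where
  "supp_pos gr \<pi> = supp gr \<inter> {\<alpha>. \<pi> \<alpha> > 0}"

definition supp_nonpos :: "('q \<Rightarrow> 'g::lie_algebra set) \<Rightarrow> ('q \<Rightarrow> int) \<Rightarrow> 'q set" where
  "supp_nonpos gr \<pi> = supp gr \<inter> {\<alpha>. \<pi> \<alpha> \<le> 0}"

definition central_nonpos :: "('q \<Rightarrow> 'g::lie_algebra set) \<Rightarrow> ('q \<Rightarrow> int) \<Rightarrow> 'q set" where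
  "central_nonpos gr \<pi> = {\<alpha> \<in> supp_nonpos gr \<pi>. lie_center \<inter> gr \<alpha> = gr \<alpha>}"

text \<open>The \<open>\<alpha>\<close>-component of the quotient by the center is the image of \<open>gr \<alpha>\<close>.\<close>

definition Q_good :: "('q \<Rightarrow> 'g::lie_algebra set) \<Rightarrow> ('q \<Rightarrow> int) \<Rightarrow> bool" where
  "Q_good gr \<pi> \<longleftrightarrow>
     (\<forall>\<alpha>. \<pi> \<alpha> > 0 \<longrightarrow> dim_mod_le {0} (gr \<alpha>) 1) \<and>
     (\<forall>\<alpha>. \<pi> \<alpha> \<le> 0 \<longrightarrow> dim_mod_le lie_center (gr \<alpha>) 1)"

definition maximal_in :: "'q::order set \<Rightarrow> 'q \<Rightarrow> bool" where
  "maximal_in S a \<longleftrightarrow> a \<in> S \<and> (\<forall>b\<in>S. \<not> a < b)"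

text \<open>In the second condition \<open>\<pi> (a - \<beta>) > 0\<close> holds automatically (\<open>\<pi> a > 0\<close> and
  \<open>\<pi> \<beta> \<le> 0\<close>), so \<open>gr (a - \<beta>)\<close> is a component of \<open>pos_part gr \<pi>\<close>.\<close>

definition nonsingular ::
  "('q::linordered_ab_group_add \<Rightarrow> 'g::lie_algebra set) \<Rightarrow> ('q \<Rightarrow> int) \<Rightarrow> ('q \<Rightarrow> 'g) \<Rightarrow> ('g \<Rightarrow> complex) \<Rightarrow> bool" where
  "nonsingular gr \<pi> x \<phi> \<longleftrightarrow>
     (\<exists>a. (\<forall>a'. maximal_in {\<alpha> \<in> supp_pos gr \<pi>. \<phi> (x \<alpha>) \<noteq> 0} a' \<longleftrightarrow> a' = a) \<and>
          (\<forall>\<beta> \<in> supp_nonpos gr \<pi> - central_nonpos gr \<pi>.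
             \<exists>y\<in>gr (a - \<beta>). \<phi> (bracket y (x \<beta>)) \<noteq> 0))"


section \<open>Enveloping and symmetric algebras\<close>

text \<open>Words with concatenation, written additively because the product of finitely supported
  functions in \<^theory>\<open>HOL-Library.Poly_Mapping\<close> is the convolution over an additive monoid.
  Thus \<open>'g word_monoid \<Rightarrow>\<^sub>0 complex\<close> is the free associative unital algebra on the set of all
  elements of \<open>'g\<close>.\<close>

datatype 'a word_monoid = Word (letters: "'a list")

instantiation word_monoid :: (type) monoid_add
begin

definition zero_word_monoid :: "'a word_monoid" where
  "0 = Word []"

definition plus_word_monoid :: "'a word_monoid \<Rightarrow> 'a word_monoid \<Rightarrow> 'a word_monoid" where
  "u + v = Word (letters u @ letters v)"

instance
  by standard (simp_all add: zero_word_monoid_def plus_word_monoid_def)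

end

type_synonym 'g nc_poly = "'g word_monoid \<Rightarrow>\<^sub>0 complex"

definition mono_word :: "complex \<Rightarrow> 'g list \<Rightarrow> 'g nc_poly" where
  "mono_word c w = Poly_Mapping.single (Word w) c"

definition free_algebra :: "'g set \<Rightarrow> 'g nc_poly ring" where
  "free_algebra H =
     \<lparr>carrier = {p. \<forall>w \<in> Poly_Mapping.keys p. set (letters w) \<subseteq> H},
      monoid.mult = (*), one = 1, zero = 0, add = (+)\<rparr>"

text \<open>Dividing the free algebra on the set \<open>H\<close> by the linearity relators gives the tensor
  algebra of the vector space \<open>H\<close>.\<close>

definition linear_relators :: "'g::lie_algebra set \<Rightarrow> 'g nc_poly set" where
  "linear_relators H =
     {mono_word 1 [x + y] - mono_word 1 [x] - mono_word 1 [y] | x y. x \<in> H \<and> y \<in> H} \<union>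
     {mono_word 1 [c *\<^sub>C x] - mono_word c [x] | c x. x \<in> H}"

definition lie_relators :: "'g::lie_algebra set \<Rightarrow> 'g nc_poly set" where
  "lie_relators H =
     {mono_word 1 [x, y] - mono_word 1 [y, x] - mono_word 1 [bracket x y] | x y. x \<in> H \<and> y \<in> H}"

definition comm_relators :: "'g::lie_algebra set \<Rightarrow> 'g nc_poly set" where
  "comm_relators H = {mono_word 1 [x, y] - mono_word 1 [y, x] | x y. x \<in> H \<and> y \<in> H}"

definition env_ideal :: "'g::lie_algebra set \<Rightarrow> 'g nc_poly set" where
  "env_ideal H = Idl\<^bsub>free_algebra H\<^esub> (linear_relators H \<union> lie_relators H)"

text \<open>The universal enveloping algebra of a subalgebra \<open>H\<close> and the symmetric algebra of a
  subspace \<open>H\<close>; their elements are cosets.\<close>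

definition env_algebra :: "'g::lie_algebra set \<Rightarrow> 'g nc_poly set ring" where
  "env_algebra H = free_algebra H Quot env_ideal H"

definition sym_algebra :: "'g::lie_algebra set \<Rightarrow> 'g nc_poly set ring" where
  "sym_algebra H = free_algebra H Quot (Idl\<^bsub>free_algebra H\<^esub> (linear_relators H \<union> comm_relators H))"

text \<open>The homomorphism into the enveloping algebra of the whole Lie algebra induced by the
  inclusion of \<open>H\<close>: it enlarges a coset to a coset of the larger ideal. It is applied to the
  enveloping algebra of a subalgebra, and to the symmetric algebra of a subspace of the center
  (where the two kinds of relators coincide).\<close>

definition to_env :: "'g::lie_algebra nc_poly set \<Rightarrow> 'g nc_poly set" where
  "to_env X = env_ideal UNIV <+>\<^bsub>free_algebra UNIV\<^esub> X"

definition env_incl :: "'g::lie_algebra \<Rightarrow> 'g nc_poly set" where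
  "env_incl x = env_ideal UNIV +>\<^bsub>free_algebra UNIV\<^esub> mono_word 1 [x]"

definition env_const :: "complex \<Rightarrow> 'g::lie_algebra nc_poly set" where
  "env_const c = env_ideal UNIV +>\<^bsub>free_algebra UNIV\<^esub> mono_word c []"


section \<open>Modules over noncommutative rings\<close>

text \<open>The library record \<open>module\<close> is used for left modules; its fields \<open>mult\<close> and \<open>one\<close>
  play no role. The library locale \<open>module\<close> is not used, as it requires a commutative base
  ring.\<close>

definition quotient_module :: "('r, 'm, 'z) module_scheme \<Rightarrow> 'm set \<Rightarrow> ('r, 'm set) module" where
  "quotient_module M N =
     \<lparr>carrier = a_rcosets\<^bsub>M\<^esub> N, monoid.mult = undefined, one = undefined,
      zero = N, add = set_add M,
      smult = (\<lambda>r X. \<Union>x\<in>X. N +>\<^bsub>M\<^esub> (r \<odot>\<^bsub>M\<^esub> x))\<rparr>"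

definition set_times_module :: "'r set \<Rightarrow> ('r, 'm, 'z) module_scheme \<Rightarrow> 'm set" where
  "set_times_module I M = generate (add_monoid M) {r \<odot>\<^bsub>M\<^esub> m | r m. r \<in> I \<and> m \<in> carrier M}"

text \<open>Extension of scalars: the tensor product over \<open>R\<close> of \<open>S\<close>, regarded as a right
  \<open>R\<close>-module via the ring homomorphism \<open>h\<close> from \<open>R\<close> to \<open>S\<close>, with the left \<open>R\<close>-module \<open>N\<close>. It is
  the free abelian group on the pairs modulo the relators below, and \<open>S\<close> acts by left
  multiplication on the first factor.\<close>

definition pairs_module ::
  "('s, 'k) ring_scheme \<Rightarrow> ('r, 'n, 'z) module_scheme \<Rightarrow> ('s, ('s \<times> 'n) \<Rightarrow>\<^sub>0 int) module" where
  "pairs_module S N =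
     \<lparr>carrier = {c. Poly_Mapping.keys c \<subseteq> carrier S \<times> carrier N},
      monoid.mult = undefined, one = undefined, zero = 0, add = (+),
      smult = (\<lambda>s. frag_extend (\<lambda>(t, n). frag_of (s \<otimes>\<^bsub>S\<^esub> t, n)))\<rparr>"

definition tensor_relators ::
  "('r, 'j) ring_scheme \<Rightarrow> ('s, 'k) ring_scheme \<Rightarrow> ('r \<Rightarrow> 's) \<Rightarrow> ('r, 'n, 'z) module_scheme \<Rightarrow>
   (('s \<times> 'n) \<Rightarrow>\<^sub>0 int) set" where
  "tensor_relators R S h N =
     {frag_of (s \<oplus>\<^bsub>S\<^esub> t, n) - frag_of (s, n) - frag_of (t, n) | s t n.
        s \<in> carrier S \<and> t \<in> carrier S \<and> n \<in> carrier N} \<union>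
     {frag_of (s, m \<oplus>\<^bsub>N\<^esub> n) - frag_of (s, m) - frag_of (s, n) | s m n.
        s \<in> carrier S \<and> m \<in> carrier N \<and> n \<in> carrier N} \<union>
     {frag_of (s \<otimes>\<^bsub>S\<^esub> h r, n) - frag_of (s, r \<odot>\<^bsub>N\<^esub> n) | s r n.
        s \<in> carrier S \<and> r \<in> carrier R \<and> n \<in> carrier N}"

definition tensor_kernel ::
  "('r, 'j) ring_scheme \<Rightarrow> ('s, 'k) ring_scheme \<Rightarrow> ('r \<Rightarrow> 's) \<Rightarrow> ('r, 'n, 'z) module_scheme \<Rightarrow>
   (('s \<times> 'n) \<Rightarrow>\<^sub>0 int) set" where
  "tensor_kernel R S h N = generate (add_monoid (pairs_module S N)) (tensor_relators R S h N)"

definition tensor_module ::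
  "('r, 'j) ring_scheme \<Rightarrow> ('s, 'k) ring_scheme \<Rightarrow> ('r \<Rightarrow> 's) \<Rightarrow> ('r, 'n, 'z) module_scheme \<Rightarrow>
   ('s, (('s \<times> 'n) \<Rightarrow>\<^sub>0 int) set) module" where
  "tensor_module R S h N = quotient_module (pairs_module S N) (tensor_kernel R S h N)"

definition pure_tensor ::
  "('r, 'j) ring_scheme \<Rightarrow> ('s, 'k) ring_scheme \<Rightarrow> ('r \<Rightarrow> 's) \<Rightarrow> ('r, 'n, 'z) module_scheme \<Rightarrow>
   's \<Rightarrow> 'n \<Rightarrow> (('s \<times> 'n) \<Rightarrow>\<^sub>0 int) set" where
  "pure_tensor R S h N s n = tensor_kernel R S h N +>\<^bsub>pairs_module S N\<^esub> frag_of (s, n)"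


section \<open>Whittaker modules\<close>

text \<open>The module over an enveloping algebra attached to a one-dimensional module on which \<open>x\<close>
  acts as multiplication by \<open>\<phi> x\<close>: a word acts by applying its letters successively. If \<open>\<phi>\<close> is
  a character of \<open>H\<close>, the action is the same for all representatives of a coset, so the image
  under \<open>the_elem\<close> is a singleton.\<close>

definition word_act :: "('g \<Rightarrow> complex) \<Rightarrow> 'g nc_poly \<Rightarrow> complex \<Rightarrow> complex" where
  "word_act \<phi> p a =
     (\<Sum>w \<in> Poly_Mapping.keys p. Poly_Mapping.lookup p w * foldr (\<lambda>x b. \<phi> x * b) (letters w) a)"

definition char_module :: "('g \<Rightarrow> complex) \<Rightarrow> ('g nc_poly set, complex) module" where
  "char_module \<phi> =
     \<lparr>carrier = UNIV, monoid.mult = (*), one = 1, zero = 0, add = (+),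
      smult = (\<lambda>X a. the_elem ((\<lambda>p. word_act \<phi> p a) ` X))\<rparr>"

type_synonym 'g whittaker_elem = "(('g nc_poly set \<times> complex) \<Rightarrow>\<^sub>0 int) set"

definition whittaker_module ::
  "'g::lie_algebra set \<Rightarrow> ('g \<Rightarrow> complex) \<Rightarrow> ('g nc_poly set, 'g whittaker_elem) module" where
  "whittaker_module H \<phi> = tensor_module (env_algebra H) (env_algebra UNIV) to_env (char_module \<phi>)"

definition whittaker_generator :: "'g::lie_algebra set \<Rightarrow> ('g \<Rightarrow> complex) \<Rightarrow> 'g whittaker_elem" where
  "whittaker_generator H \<phi> =
     pure_tensor (env_algebra H) (env_algebra UNIV) to_env (char_module \<phi>) \<one>\<^bsub>env_algebra UNIV\<^esub> 1"

definition whittaker_vector ::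
  "'g::lie_algebra set \<Rightarrow> ('g \<Rightarrow> complex) \<Rightarrow> ('g nc_poly set, 'm, 'z) module_scheme \<Rightarrow> 'm \<Rightarrow> bool" where
  "whittaker_vector H \<phi> V v \<longleftrightarrow>
     v \<in> carrier V \<and> (\<forall>x\<in>H. env_incl x \<odot>\<^bsub>V\<^esub> v = env_const (\<phi> x) \<odot>\<^bsub>V\<^esub> v)"

end

(* Modulo the central subspace Z'', the Lie algebra has the basis x_a, indexed by J = K \ R''.
   The Poincare-Birkhoff-Witt theorem relative to this basis provides, for every linear functional
   on A that vanishes on I and every ordered monomial x^k in the letters of degree at most 0, a
   functional on V that sends p x^j w' to the value of p if j = k, and to 0 for the other ordered
   monomials x^j. Hence the coefficients of v = sum_k p_k x^k w' are determined modulo I.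

   Put h = pi(a_phi) and give x_b the weight h - pi(b). Rewriting a bracket lowers weights by h, and
   replacing x_b with pi(b) > 0 by the scalar phi(x_b) does not raise them. Let n be the largest
   weight of a nonconstant monomial of v, let b be the least letter of the monomials of weight n,
   and let x^k = x_b x^j be one of these monomials. For y in the component of degree a_phi - b, the
   coefficient of x^j in (y - phi(y)) v is p_k phi([y, x_b]) times the multiplicity of x_b in x^k.
   For a Whittaker vector v it lies in I, so p_k lies in I and the term p_k x^k w' can be dropped. *)

theory Submission
  imports Defs "HOL-Library.Multiset"
begin

section \<open>The free algebra and the enveloping ideal\<close>

text \<open>Components of degree at most 0 are at most one-dimensional only modulo the center, and
  no basis of Z'' is chosen: letters give coordinates modulo Z'', and a product of central elements
  is kept as a multiset. The functionals are therefore built by a recursion with a multiset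
  argument, and independence of its choices is a diamond-lemma argument.

  Membership in I is tested by duality: if a coefficient is outside the preimage of I, some linear
  functional kills that preimage but not the coefficient. The layers of cosets in V are collapsed to
  one left ideal \<open>ann\<close> of the free algebra, and the functional has only to vanish on
  it.

  Weights cannot isolate a monomial, since pi may agree on many degrees. Bracketing with y replaces
  a letter a by a_phi - b + a and lowers the weight by h - pi(b) for every a. The minimality of b
  breaks the tie: if a > b, the new degree exceeds a_phi in the total order, so phi vanishes on
  it.\<close>

lemma bracket_zero_left [simp]: "bracket 0 (y :: 'g::lie_algebra) = 0"
  using bracket_add_left[of 0 0 y] by simp

lemma bracket_zero_right [simp]: "bracket (x :: 'g::lie_algebra) 0 = 0"
  using bracket_add_right[of x 0 0] by simp

lemma bracket_anti: "bracket (y :: 'g::lie_algebra) x = - bracket x y"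
proof -
  have "bracket (x + y) (x + y) = 0" by (rule bracket_self)
  then have "bracket x y + bracket y x = 0"
    by (simp only: bracket_add_left bracket_add_right) (simp add: bracket_self ac_simps)
  then show ?thesis
    by (metis add.inverse_unique)
qed

lemma bracket_minus_right: "bracket (x :: 'g::lie_algebra) (- y) = - bracket x y"
  using bracket_add_right[of x y "- y"] by (simp add: eq_neg_iff_add_eq_0 add.commute)

lemma bracket_sum_right:
  "bracket (x :: 'g::lie_algebra) (\<Sum>i\<in>S. f i) = (\<Sum>i\<in>S. bracket x (f i))"
  by (induction S rule: infinite_finite_induct) (simp_all add: bracket_add_right)

lemma bracket_sum_left:
  "bracket (\<Sum>i\<in>S. f i) (x :: 'g::lie_algebra) = (\<Sum>i\<in>S. bracket (f i) x)"
  by (induction S rule: infinite_finite_induct) (simp_all add: bracket_add_left)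

lemma lie_center_bracket:
  assumes "z \<in> lie_center" shows "bracket z x = 0" "bracket x z = 0"
proof -
  show *: "bracket z x = 0" using assms by (simp add: lie_center_def)
  show "bracket x z = 0" using bracket_anti[of x z] * by simp
qed


section \<open>Words and polynomials in the free algebra\<close>

lemma mono_word_mult: "mono_word c u * mono_word d v = mono_word (c * d) (u @ v)"
  by (simp add: mono_word_def mult_single plus_word_monoid_def)

lemma mono_word_add: "mono_word (c + d) u = mono_word c u + mono_word d u"
  by (simp add: mono_word_def single_add)

lemma mono_word_zero [simp]: "mono_word 0 u = 0"
  by (simp add: mono_word_def)

lemma mono_word_one: "mono_word 1 [] = 1"
  by (simp add: mono_word_def zero_word_monoid_def flip: single_one)

lemma const_central: "mono_word c [] * p = p * mono_word c []"
proof -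
  have "mono_word c [] * Poly_Mapping.single w d = Poly_Mapping.single w d * mono_word c []" for w d
    by (simp add: mono_word_def mult_single mult.commute flip: zero_word_monoid_def)
  moreover have "p = (\<Sum>w\<in>Poly_Mapping.keys p. Poly_Mapping.single w (Poly_Mapping.lookup p w))"
    by (rule poly_mapping_eqI) (simp add: lookup_sum lookup_single when_def in_keys_iff)
  ultimately show ?thesis
    by (metis (no_types, lifting) sum.cong sum_distrib_left sum_distrib_right)
qed

abbreviation free_carrier :: "'g set \<Rightarrow> 'g nc_poly set" where
  "free_carrier H \<equiv> carrier (free_algebra H)"

lemma free_carrier_iff:
  "p \<in> free_carrier H \<longleftrightarrow> (\<forall>w \<in> Poly_Mapping.keys p. set (letters w) \<subseteq> H)"
  by (simp add: free_algebra_def)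

lemma free_carrier_UNIV [simp]: "free_carrier UNIV = UNIV"
  by (auto simp: free_carrier_iff)

lemma free_carrier_mono: "H \<subseteq> H' \<Longrightarrow> free_carrier H \<subseteq> free_carrier H'"
  by (fastforce simp: free_carrier_iff)

lemma free_algebra_simps [simp]:
  "monoid.mult (free_algebra H) = (*)" "one (free_algebra H) = 1"
  "zero (free_algebra H) = 0" "add (free_algebra H) = (+)"
  by (simp_all add: free_algebra_def)

lemma zero_in_free [simp]: "0 \<in> free_carrier H"
  by (simp add: free_carrier_iff)

lemma mono_word_in_free: "set u \<subseteq> H \<Longrightarrow> mono_word c u \<in> free_carrier H"
  by (simp add: free_carrier_iff mono_word_def)

lemma one_in_free [simp]: "1 \<in> free_carrier H"
  using mono_word_in_free[of "[]" H 1] by (simp add: mono_word_one)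

lemma add_in_free: "\<lbrakk>p \<in> free_carrier H; q \<in> free_carrier H\<rbrakk> \<Longrightarrow> p + q \<in> free_carrier H"
  using Poly_Mapping.keys_add[of p q] by (auto simp: free_carrier_iff)

lemma uminus_in_free: "p \<in> free_carrier H \<Longrightarrow> - p \<in> free_carrier H"
  by (simp add: free_carrier_iff)

lemma diff_in_free: "\<lbrakk>p \<in> free_carrier H; q \<in> free_carrier H\<rbrakk> \<Longrightarrow> p - q \<in> free_carrier H"
  using add_in_free[OF _ uminus_in_free, of p H q] by simp

lemma mult_in_free: "\<lbrakk>p \<in> free_carrier H; q \<in> free_carrier H\<rbrakk> \<Longrightarrow> p * q \<in> free_carrier H"
  using keys_mult[of p q] by (fastforce simp: free_carrier_iff plus_word_monoid_def)

lemma ring_free_algebra: "ring (free_algebra H)"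
proof (intro ringI abelian_groupI monoidI)
  fix p assume "p \<in> free_carrier H"
  then show "\<exists>q \<in> free_carrier H. q \<oplus>\<^bsub>free_algebra H\<^esub> p = \<zero>\<^bsub>free_algebra H\<^esub>"
    by (intro bexI[of _ "- p"]) (simp_all add: uminus_in_free)
qed (simp_all add: add_in_free mult_in_free algebra_simps)

lemma free_algebra_induct [consumes 1, case_names zero mono add]:
  assumes "p \<in> free_carrier H"
    and "P 0"
    and "\<And>c w. set w \<subseteq> H \<Longrightarrow> P (mono_word c w)"
    and "\<And>p q. \<lbrakk>p \<in> free_carrier H; q \<in> free_carrier H; P p; P q\<rbrakk> \<Longrightarrow> P (p + q)"
  shows "P p"
proof -
  let ?t = "\<lambda>w. mono_word (Poly_Mapping.lookup p w) (letters w)"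
  have p: "p = (\<Sum>w\<in>Poly_Mapping.keys p. ?t w)"
    by (rule poly_mapping_eqI)
      (simp add: mono_word_def lookup_sum lookup_single when_def in_keys_iff)
  have *: "(\<Sum>w\<in>S. ?t w) \<in> free_carrier H \<and> P (\<Sum>w\<in>S. ?t w)"
    if "finite S" "S \<subseteq> Poly_Mapping.keys p" for S
    using that
  proof (induction S rule: finite_induct)
    case (insert w S)
    then have "set (letters w) \<subseteq> H" using assms(1) by (auto simp: free_carrier_iff)
    then have "?t w \<in> free_carrier H" "P (?t w)" by (simp_all add: mono_word_in_free assms(3))
    then show ?case using insert assms(4) by (simp add: add_in_free)
  qed (simp add: assms(2))
  show ?thesis using *[OF finite_keys order_refl] by (subst p) simp
qed

lemma nc_poly_induct [case_names zero mono add]: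
  "\<lbrakk>P 0; \<And>c w. P (mono_word c w); \<And>p q. \<lbrakk>P p; P q\<rbrakk> \<Longrightarrow> P (p + q)\<rbrakk> \<Longrightarrow> P (p :: 'g nc_poly)"
  by (rule free_algebra_induct[of p UNIV P]) auto


section \<open>Linear functionals on the free algebra, given by their values on words\<close>

definition lin_ext :: "('g list \<Rightarrow> complex) \<Rightarrow> 'g nc_poly \<Rightarrow> complex" where
  "lin_ext f p = (\<Sum>w\<in>Poly_Mapping.keys p. Poly_Mapping.lookup p w * f (letters w))"

lemma lin_ext_superset:
  "\<lbrakk>finite S; Poly_Mapping.keys p \<subseteq> S\<rbrakk> \<Longrightarrow>
    lin_ext f p = (\<Sum>w\<in>S. Poly_Mapping.lookup p w * f (letters w))"
  unfolding lin_ext_def by (rule sum.mono_neutral_left) (auto simp: in_keys_iff)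

lemma lin_ext_add: "lin_ext f (p + q) = lin_ext f p + lin_ext f q"
proof -
  let ?S = "Poly_Mapping.keys p \<union> Poly_Mapping.keys q"
  have "Poly_Mapping.keys (p + q) \<subseteq> ?S" by (rule Poly_Mapping.keys_add)
  then show ?thesis
    by (simp add: lin_ext_superset[of ?S] lookup_add distrib_right sum.distrib)
qed

lemma lin_ext_zero [simp]: "lin_ext f 0 = 0"
  by (simp add: lin_ext_def)

lemma lin_ext_mono: "lin_ext f (mono_word c w) = c * f w"
  by (simp add: lin_ext_def mono_word_def)

lemma lin_ext_uminus: "lin_ext f (- p) = - lin_ext f p"
  using lin_ext_add[of f p "- p"] by (simp add: eq_neg_iff_add_eq_0 add.commute)

lemma lin_ext_diff: "lin_ext f (p - q) = lin_ext f p - lin_ext f q"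
  using lin_ext_add[of f p "- q"] by (simp add: lin_ext_uminus)

lemma lin_ext_sum: "lin_ext f (\<Sum>i\<in>S. g i) = (\<Sum>i\<in>S. lin_ext f (g i))"
  by (induction S rule: infinite_finite_induct) (simp_all add: lin_ext_add)

lemma lin_ext_mult: "lin_ext f (p * q) = lin_ext (\<lambda>u. lin_ext (\<lambda>v. f (u @ v)) q) p"
proof (induction p rule: nc_poly_induct)
  case (mono c u)
  show ?case
    by (induction q rule: nc_poly_induct)
      (simp_all add: lin_ext_mono mono_word_mult distrib_left lin_ext_add mult.assoc)
qed (simp_all add: distrib_right lin_ext_add)

lemma lin_ext_mult_mono_right:
  "lin_ext f (p * mono_word c v) = c * lin_ext (\<lambda>u. f (u @ v)) p"
  by (induction p rule: nc_poly_induct)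
    (simp_all add: lin_ext_mono mono_word_mult distrib_left distrib_right lin_ext_add)

lemma lin_ext_cong:
  assumes "p \<in> free_carrier H" "\<And>w. set w \<subseteq> H \<Longrightarrow> f w = g w"
  shows "lin_ext f p = lin_ext g p"
  using assms by (auto simp: lin_ext_def free_carrier_iff intro!: sum.cong)

lemma lin_ext_fun_add: "lin_ext (\<lambda>w. f w + g w) p = lin_ext f p + lin_ext g p"
  by (simp add: lin_ext_def distrib_left sum.distrib)

lemma lin_ext_fun_diff: "lin_ext (\<lambda>w. f w - g w) p = lin_ext f p - lin_ext g p"
  by (simp add: lin_ext_def right_diff_distrib sum_subtractf)

lemma lin_ext_fun_mult: "lin_ext (\<lambda>w. c * f w) p = c * lin_ext f p"
  by (simp add: lin_ext_def sum_distrib_left mult.left_commute)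


section \<open>Two-sided ideals in free algebras on different letter sets\<close>

lemma a_minus_free: 
  assumes "p \<in> free_carrier H" shows "\<ominus>\<^bsub>free_algebra H\<^esub> p = - p"
proof -
  interpret ring "free_algebra H" by (rule ring_free_algebra)
  show ?thesis using assms by (intro minus_equality) (auto simp: uminus_in_free)
qed

lemma free_idealD:
  assumes "ideal I (free_algebra H)"
  shows "0 \<in> I" "I \<subseteq> free_carrier H"
    and "\<lbrakk>p \<in> I; q \<in> I\<rbrakk> \<Longrightarrow> p + q \<in> I" "p \<in> I \<Longrightarrow> - p \<in> I" "\<lbrakk>p \<in> I; q \<in> I\<rbrakk> \<Longrightarrow> p - q \<in> I"
    and "\<lbrakk>r \<in> free_carrier H; p \<in> I\<rbrakk> \<Longrightarrow> r * p \<in> I" "\<lbrakk>r \<in> free_carrier H; p \<in> I\<rbrakk> \<Longrightarrow> p * r \<in> I"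
proof -
  interpret ideal I "free_algebra H" by fact
  show "0 \<in> I" using additive_subgroup.zero_closed[OF is_additive_subgroup] by simp
  show sub: "I \<subseteq> free_carrier H" by (rule a_subset)
  show add: "p + q \<in> I" if "p \<in> I" "q \<in> I" for p q using additive_subgroup.a_closed[OF is_additive_subgroup that] by simp
  show neg: "- p \<in> I" if "p \<in> I" for p
    using additive_subgroup.a_inv_closed[OF is_additive_subgroup that] a_minus_free[of p H] that sub by auto
  show "p - q \<in> I" if "p \<in> I" "q \<in> I" for p q
    using add[OF that(1) neg[OF that(2)]] by simp
  show "r * p \<in> I" if "r \<in> free_carrier H" "p \<in> I" using I_l_closed[OF that(2,1)] by simp
  show "p * r \<in> I" if "r \<in> free_carrier H" "p \<in> I" using I_r_closed[OF that(2,1)] by simp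
qed

lemma free_idealI:
  assumes "I \<subseteq> free_carrier H" "0 \<in> I"
    and "\<And>p q. \<lbrakk>p \<in> I; q \<in> I\<rbrakk> \<Longrightarrow> p + q \<in> I" "\<And>p. p \<in> I \<Longrightarrow> - p \<in> I"
    and "\<And>r p. \<lbrakk>r \<in> free_carrier H; p \<in> I\<rbrakk> \<Longrightarrow> r * p \<in> I"
    and "\<And>r p. \<lbrakk>r \<in> free_carrier H; p \<in> I\<rbrakk> \<Longrightarrow> p * r \<in> I"
  shows "ideal I (free_algebra H)"
proof (rule idealI)
  show "ring (free_algebra H)" by (rule ring_free_algebra)
  interpret ring "free_algebra H" by (rule ring_free_algebra)
  show "subgroup I (add_monoid (free_algebra H))"
  proof (rule add.subgroupI)
    show "\<ominus>\<^bsub>free_algebra H\<^esub> p \<in> I" if "p \<in> I" for p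
      using that assms(1,4) by (subst a_minus_free) auto
  qed (use assms in auto)
qed (use assms in auto)

lemma relators_in_free:
  assumes "lie.subspace H" "\<And>x y. \<lbrakk>x \<in> H; y \<in> H\<rbrakk> \<Longrightarrow> bracket x y \<in> H"
  shows "linear_relators H \<union> lie_relators H \<subseteq> free_carrier H"
  unfolding linear_relators_def lie_relators_def
  using assms(2) lie.subspace_add[OF assms(1)] lie.subspace_scale[OF assms(1)]
  by (auto intro!: diff_in_free mono_word_in_free)

lemma comm_relators_in_free:
  assumes "lie.subspace H"
  shows "linear_relators H \<union> comm_relators H \<subseteq> free_carrier H"
  unfolding linear_relators_def comm_relators_def
  using lie.subspace_add[OF assms(1)] lie.subspace_scale[OF assms(1)]
  by (auto intro!: diff_in_free mono_word_in_free)

lemma ideal_env_ideal: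
  assumes "lie.subspace H" "\<And>x y. \<lbrakk>x \<in> H; y \<in> H\<rbrakk> \<Longrightarrow> bracket x y \<in> H"
  shows "ideal (env_ideal H) (free_algebra H)"
  unfolding env_ideal_def
  by (rule ring.genideal_ideal[OF ring_free_algebra relators_in_free[OF assms]])

text \<open>The two ideals live in free algebras with different carriers, so minimality of the
  generated ideal is applied to \<open>I \<inter> free_carrier H\<close>.\<close>

lemma genideal_free_mono:
  assumes "S \<subseteq> free_carrier H" "H \<subseteq> H'" "ideal I (free_algebra H')" "S \<subseteq> I"
  shows "Idl\<^bsub>free_algebra H\<^esub> S \<subseteq> I"
proof -
  note I = free_idealD[OF assms(3)] and sub = free_carrier_mono[OF assms(2)]
  have "ideal (I \<inter> free_carrier H) (free_algebra H)"
    by (rule free_idealI) (use I sub in \<open>auto intro: add_in_free uminus_in_free mult_in_free\<close>)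
  then have "Idl\<^bsub>free_algebra H\<^esub> S \<subseteq> I \<inter> free_carrier H"
    by (rule ring.genideal_minimal[OF ring_free_algebra]) (use assms in auto)
  then show ?thesis by simp
qed

section \<open>Congruences modulo the defining ideal of U(g)\<close>

abbreviation env_ker :: "'g::lie_algebra nc_poly set" where
  "env_ker \<equiv> env_ideal UNIV"

lemma ideal_env_ker: "ideal env_ker (free_algebra UNIV)"
  by (rule ideal_env_ideal) auto

lemmas env_kerD = free_idealD[OF ideal_env_ker, unfolded free_carrier_UNIV, simplified]

lemma relators_in_env_ideal:
  assumes "lie.subspace H" "\<And>x y. \<lbrakk>x \<in> H; y \<in> H\<rbrakk> \<Longrightarrow> bracket x y \<in> H"
  shows "linear_relators H \<union> lie_relators H \<subseteq> env_ideal H"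
  unfolding env_ideal_def
  by (rule ring.genideal_self[OF ring_free_algebra relators_in_free[OF assms]])

lemma env_ideal_subset:
  assumes "lie.subspace H" "\<And>x y. \<lbrakk>x \<in> H; y \<in> H\<rbrakk> \<Longrightarrow> bracket x y \<in> H"
  shows "env_ideal H \<subseteq> env_ker"
  unfolding env_ideal_def[of H]
proof (rule genideal_free_mono[OF relators_in_free[OF assms] _ ideal_env_ker])
  have "linear_relators H \<union> lie_relators H \<subseteq> linear_relators UNIV \<union> lie_relators UNIV"
    by (auto simp: linear_relators_def lie_relators_def; blast)
  also have "\<dots> \<subseteq> env_ker" by (rule relators_in_env_ideal) auto
  finally show "linear_relators H \<union> lie_relators H \<subseteq> env_ker" .
qed auto

lemma env_ker_letter_add:
  "mono_word c (u @ (x + y) # v) - mono_word c (u @ x # v) - mono_word c (u @ y # v) \<in> env_ker"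
proof -
  have "mono_word 1 [x + y] - mono_word 1 [x] - mono_word 1 [y] \<in> env_ker"
    using relators_in_env_ideal[of UNIV] by (auto simp: linear_relators_def)
  then have "mono_word c u * (mono_word 1 [x + y] - mono_word 1 [x] - mono_word 1 [y]) * mono_word 1 v \<in> env_ker"
    by (rule env_kerD(7)[OF env_kerD(6)])
  then show ?thesis by (simp add: algebra_simps mono_word_mult)
qed

lemma env_ker_letter_scale:
  "mono_word c (u @ (r *\<^sub>C x) # v) - mono_word (c * r) (u @ x # v) \<in> env_ker"
proof -
  have "mono_word 1 [r *\<^sub>C x] - mono_word r [x] \<in> env_ker"
    using relators_in_env_ideal[of UNIV] by (auto simp: linear_relators_def)
  then have "mono_word c u * (mono_word 1 [r *\<^sub>C x] - mono_word r [x]) * mono_word 1 v \<in> env_ker"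
    by (rule env_kerD(7)[OF env_kerD(6)])
  then show ?thesis by (simp add: algebra_simps mono_word_mult)
qed

lemma env_ker_bracket:
  "mono_word c (u @ x # y # v) - mono_word c (u @ y # x # v) - mono_word c (u @ bracket x y # v) \<in> env_ker"
proof -
  have "mono_word 1 [x, y] - mono_word 1 [y, x] - mono_word 1 [bracket x y] \<in> env_ker"
    using relators_in_env_ideal[of UNIV] by (auto simp: lie_relators_def)
  then have "mono_word c u * (mono_word 1 [x, y] - mono_word 1 [y, x] - mono_word 1 [bracket x y]) * mono_word 1 v \<in> env_ker"
    by (rule env_kerD(7)[OF env_kerD(6)])
  then show ?thesis by (simp add: algebra_simps mono_word_mult)
qed

lemma env_ker_letter_zero: "mono_word c (u @ 0 # v) \<in> env_ker"
  using env_ker_letter_scale[of c u 0 0 v] by simp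

text \<open>A central letter has zero bracket with every letter, so it moves through a word one
  position at a time.\<close>

lemma env_ker_center:
  assumes "z \<in> lie_center"
  shows "p * mono_word c [z] - mono_word c [z] * p \<in> env_ker"
proof (induction p rule: nc_poly_induct)
  case (mono d w)
  have "mono_word d (w @ z # v) - mono_word d (z # w @ v) \<in> env_ker" for v d
  proof (induction w arbitrary: v rule: rev_induct)
    case (snoc y w)
    have "bracket y z = 0" using lie_center_bracket(2)[OF assms] .
    then have "mono_word d (w @ y # z # v) - mono_word d (w @ z # y # v) \<in> env_ker"
      using env_kerD(3)[OF env_ker_bracket[of d w y z v] env_ker_letter_zero[of d w v]] by simp
    from env_kerD(3)[OF this snoc[of "y # v"]] show ?case by simp
  qed (simp add: env_kerD(1))
  from this[of "c * d" "[]"] show ?case by (simp add: mono_word_mult mult.commute)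
next
  case (add p q)
  from env_kerD(3)[OF this] show ?case by (simp add: algebra_simps)
qed (simp add: env_kerD)

text \<open>Two later arguments rest on this: the generators of I M are stable under U(g), and a
  letter of n passes the coefficients in S(Z'').\<close>

lemma env_ker_central:
  assumes "q \<in> free_carrier Z" "Z \<subseteq> lie_center"
  shows "p * q - q * p \<in> env_ker"
  using assms(1)
proof (induction q rule: free_algebra_induct)
  case (mono c w)
  then show ?case
  proof (induction w arbitrary: c)
    case Nil
    then show ?case by (simp add: const_central env_kerD)
  next
    case (Cons z w)
    then have "z \<in> lie_center" "p * mono_word 1 w - mono_word 1 w * p \<in> env_ker"
      using assms(2) by auto
    from env_kerD(3)[OF env_kerD(7)[OF env_ker_center[OF this(1), of p c], of "mono_word 1 w"]
        env_kerD(6)[OF this(2), of "mono_word c [z]"]]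
    show ?case
      by (simp add: algebra_simps mono_word_mult) (simp add: mono_word_mult flip: mult.assoc)
  qed
next
  case (add q r)
  from env_kerD(3)[OF add.IH] show ?case by (simp add: algebra_simps)
qed (simp add: env_kerD)

text \<open>The \<open>p\<close> for which \<open>lin_ext f\<close> vanishes on every
  \<open>r * p * s\<close> form a two-sided ideal inside the kernel of the functional, and the three
  conditions on \<open>f\<close> put the relators into it. The functionals on U(g) and the character
  of U(n) are both obtained from this test.\<close>

lemma lin_ext_env_ideal:
  assumes H: "lie.subspace H" "\<And>x y. \<lbrakk>x \<in> H; y \<in> H\<rbrakk> \<Longrightarrow> bracket x y \<in> H"
    and add: "\<And>u v x y. \<lbrakk>set u \<subseteq> H; set v \<subseteq> H; x \<in> H; y \<in> H\<rbrakk> \<Longrightarrow>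
        f (u @ (x + y) # v) = f (u @ x # v) + f (u @ y # v)"
    and scale: "\<And>u v x c. \<lbrakk>set u \<subseteq> H; set v \<subseteq> H; x \<in> H\<rbrakk> \<Longrightarrow>
        f (u @ (c *\<^sub>C x) # v) = c * f (u @ x # v)"
    and lie: "\<And>u v x y. \<lbrakk>set u \<subseteq> H; set v \<subseteq> H; x \<in> H; y \<in> H\<rbrakk> \<Longrightarrow>
        f (u @ x # y # v) = f (u @ y # x # v) + f (u @ bracket x y # v)"
    and p: "p \<in> env_ideal H"
  shows "lin_ext f p = 0"
proof -
  let ?K = "{p \<in> free_carrier H. \<forall>r \<in> free_carrier H. \<forall>s \<in> free_carrier H. lin_ext f (r * p * s) = 0}"
  have "env_ideal H \<subseteq> ?K"
    unfolding env_ideal_def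
  proof (rule ring.genideal_minimal[OF ring_free_algebra])
    show "ideal ?K (free_algebra H)"
    proof (rule free_idealI)
      fix a p assume ap: "a \<in> free_carrier H" "p \<in> ?K"
      have "lin_ext f (r * (a * p) * s) = 0" "lin_ext f (r * (p * a) * s) = 0"
        if "r \<in> free_carrier H" "s \<in> free_carrier H" for r s
      proof -
        have "r * (a * p) * s = (r * a) * p * s" "r * (p * a) * s = r * p * (a * s)"
          by (simp_all only: mult.assoc)
        then show "lin_ext f (r * (a * p) * s) = 0" "lin_ext f (r * (p * a) * s) = 0"
          using ap that by (simp_all add: mult_in_free)
      qed
      then show "a * p \<in> ?K" "p * a \<in> ?K" using ap by (simp_all add: mult_in_free)
    next
    qed (auto simp: add_in_free uminus_in_free lin_ext_add lin_ext_uminus distrib_left distrib_right)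
    \<comment> \<open>Reduction to words with coefficient 1 on either side; scalars are pulled to
      the front, since constants commute with everything.\<close>
    have K: "p \<in> ?K" if "p \<in> free_carrier H"
      "\<And>u v. \<lbrakk>set u \<subseteq> H; set v \<subseteq> H\<rbrakk> \<Longrightarrow> lin_ext f (mono_word 1 u * p * mono_word 1 v) = 0" for p
    proof -
      have mono: "lin_ext f (mono_word c u * p * mono_word d v) = 0"
        if "set u \<subseteq> H" "set v \<subseteq> H" for c d u v
      proof -
        have "mono_word c u * p * mono_word d v =
            mono_word c [] * (mono_word 1 u * (p * (mono_word d [] * mono_word 1 v)))"
          by (simp add: mono_word_mult mult.assoc flip: mult.assoc[of "mono_word c []"])
        also have "p * (mono_word d [] * mono_word 1 v) = mono_word d [] * (p * mono_word 1 v)"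
          by (metis const_central mult.assoc)
        also have "mono_word c [] * (mono_word 1 u * (mono_word d [] * (p * mono_word 1 v))) =
            mono_word (c * d) [] * (mono_word 1 u * p * mono_word 1 v)"
          by (simp add: mono_word_mult flip: mult.assoc)
        finally have "mono_word c u * p * mono_word d v =
            mono_word (c * d) [] * (mono_word 1 u * p * mono_word 1 v)" .
        then show ?thesis
          using \<open>\<And>u v. \<lbrakk>set u \<subseteq> H; set v \<subseteq> H\<rbrakk> \<Longrightarrow> lin_ext f (mono_word 1 u * p * mono_word 1 v) = 0\<close> that
          by (simp add: lin_ext_mult[of f "mono_word (c * d) []"] lin_ext_mono)
      qed
      have right: "lin_ext f (r * p * mono_word d v) = 0" if "r \<in> free_carrier H" "set v \<subseteq> H" for r d v
        using that(1) by (induction r rule: free_algebra_induct)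
          (simp_all add: mono that(2) distrib_right lin_ext_add)
      have "lin_ext f (r * p * s) = 0" if "r \<in> free_carrier H" "s \<in> free_carrier H" for r s
        using that(2)
        by (induction s rule: free_algebra_induct)
          (simp_all add: right that(1)
            distrib_left lin_ext_add)
      then show ?thesis using that by blast
    qed
    show "linear_relators H \<union> lie_relators H \<subseteq> ?K"
    proof
      fix p assume p: "p \<in> linear_relators H \<union> lie_relators H"
      then have "p \<in> free_carrier H" using relators_in_free[OF H] by blast
      moreover have "lin_ext f (mono_word 1 u * p * mono_word 1 v) = 0"
        if "set u \<subseteq> H" "set v \<subseteq> H" for u v
      proof -
        note expand = left_diff_distrib right_diff_distrib mult.assoc lin_ext_diff lin_ext_mono
          mono_word_mult
        from p consider (add) x y where "x \<in> H" "y \<in> H"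
            "p = mono_word 1 [x + y] - mono_word 1 [x] - mono_word 1 [y]"
          | (scale) c x where "x \<in> H" "p = mono_word 1 [c *\<^sub>C x] - mono_word c [x]"
          | (lie) x y where "x \<in> H" "y \<in> H"
            "p = mono_word 1 [x, y] - mono_word 1 [y, x] - mono_word 1 [bracket x y]"
          by (auto simp: linear_relators_def lie_relators_def)
        then show ?thesis
        proof cases
          case add
          then show ?thesis using assms(3)[OF that, of x y] by (simp add: expand)
        next
          case scale
          then show ?thesis using assms(4)[OF that, of x c] by (simp add: expand)
        next
          case lie
          then show ?thesis using assms(5)[OF that, of x y] by (simp add: expand)
        qed
      qed
      ultimately show "p \<in> ?K" by (rule K)
    qed
  qed
  with p have "lin_ext f (1 * p * 1) = 0" by (fastforce simp del: mult_1_left mult_1_right)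
  then show ?thesis by simp
qed


section \<open>Straightening of words\<close>

fun inversions :: "'a::linorder list \<Rightarrow> nat" where
  "inversions [] = 0"
| "inversions (x # xs) = length (filter (\<lambda>y. y < x) xs) + inversions xs"

lemma inversions_swap:
  "b < a \<Longrightarrow> inversions (u @ a # b # v) = Suc (inversions (u @ b # a # v))"
  by (induction u) auto

lemma unsorted_descent:
  "\<not> sorted w \<Longrightarrow> \<exists>u a b v. w = u @ a # b # v \<and> b < (a :: 'a::linorder)"
proof (induction w)
  case (Cons x xs)
  show ?case
  proof (cases "sorted xs")
    case True
    with Cons.prems have "\<not> (\<forall>y\<in>set xs. x \<le> y)" by simp
    with True obtain y ys where "xs = y # ys" "y < x"
      by (cases xs) (auto intro: less_le_trans)
    then have "x # xs = [] @ x # y # ys \<and> y < x" by simp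
    then show ?thesis by blast
  next
    case False
    then obtain u a b v where "xs = u @ a # b # v \<and> b < a" using Cons.IH by blast
    then have "x # xs = (x # u) @ a # b # v \<and> b < a" by simp
    then show ?thesis by blast
  qed
qed simp

text \<open>The recursion for \<open>L\<close> rewrites at the one descent picked here; that the
  pick does not influence the values is the content of \<open>straight\<close>.\<close>

definition descent :: "'a::linorder list \<Rightarrow> 'a list \<times> 'a \<times> 'a \<times> 'a list" where
  "descent w = (SOME (u, a, b, v). w = u @ a # b # v \<and> b < a)"

lemma descentD:
  assumes "\<not> sorted w" "descent w = (u, a, b, v)"
  shows "w = u @ a # b # v" "b < a"
proof -
  have "\<exists>d. case d of (u, a, b, v) \<Rightarrow> w = u @ a # b # v \<and> b < a"
    using unsorted_descent[OF assms(1)] by auto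
  from someI_ex[OF this] show "w = u @ a # b # v" "b < a"
    using assms(2) by (auto simp: descent_def)
qed

lemma descentD':
  "\<lbrakk>\<not> sorted w; (u, a, b, v) = descent w\<rbrakk> \<Longrightarrow> w = u @ a # b # v \<and> b < a"
  using descentD[of w u a b v] by simp

text \<open>Swapping a descent keeps the length and lowers the number of inversions, while a bracket
  term shortens the word. Comparing lengths first gives termination although the letters, which are
  degrees in Q, need not be well-ordered.\<close>

definition word_less :: "('a::linorder list \<times> 'a list) set" where
  "word_less = measures [length, inversions]"

lemma wf_word_less: "wf word_less"
  by (simp add: word_less_def)

lemma word_less_iff:
  "(v, w) \<in> word_less \<longleftrightarrow> length v < length w \<or> length v = length w \<and> inversions v < inversions w"
  by (auto simp: word_less_def)

lemma word_induct [case_names less]: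
  "(\<And>w. (\<And>v. (v, w) \<in> word_less \<Longrightarrow> P v) \<Longrightarrow> P w) \<Longrightarrow> P w"
  using wf_induct_rule[OF wf_word_less] by metis


text \<open>Linear coordinates modulo a central subspace stand in for a basis: every
  \<open>x\<close> is the combination of the \<open>X c\<close> with coefficients
  \<open>\<xi> x c\<close>, plus a remainder in \<open>Zs\<close>. Letters with
  \<open>X c = 0\<close> are allowed, which later lets every degree serve as a letter.\<close>

locale central_frame =
  fixes X :: "'a::linorder \<Rightarrow> 'g::lie_algebra"
    and \<xi> :: "'g \<Rightarrow> 'a \<Rightarrow> complex"
    and Zs :: "'g set"
  assumes Z_subspace: "lie.subspace Zs"
    and Z_central: "Zs \<subseteq> lie_center"
    and coord_add: "\<xi> (x + y) c = \<xi> x c + \<xi> y c"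
    and coord_scale: "\<xi> (r *\<^sub>C x) c = r * \<xi> x c"
    and coord_finite: "finite {c. \<xi> x c \<noteq> 0}"
    and remainder_in: "x - (\<Sum>c | \<xi> x c \<noteq> 0. \<xi> x c *\<^sub>C X c) \<in> Zs"
begin

definition rem :: "'g \<Rightarrow> 'g" where
  "rem x = x - (\<Sum>c | \<xi> x c \<noteq> 0. \<xi> x c *\<^sub>C X c)"

definition lin_comb :: "'g \<Rightarrow> ('a \<Rightarrow> complex) \<Rightarrow> complex" where
  "lin_comb x g = (\<Sum>c | \<xi> x c \<noteq> 0. \<xi> x c * g c)"

lemma rem_in: "rem x \<in> Zs"
  using remainder_in by (simp add: rem_def)

lemma lin_comb_superset:
  assumes "finite S" "{c. \<xi> x c \<noteq> 0} \<subseteq> S"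
  shows "lin_comb x g = (\<Sum>c\<in>S. \<xi> x c * g c)"
  unfolding lin_comb_def using assms by (intro sum.mono_neutral_left) auto

lemma rem_superset:
  assumes "finite S" "{c. \<xi> x c \<noteq> 0} \<subseteq> S"
  shows "rem x = x - (\<Sum>c\<in>S. \<xi> x c *\<^sub>C X c)"
  unfolding rem_def using assms by (auto intro!: sum.mono_neutral_left)

lemma lin_comb_add: "lin_comb (x + y) g = lin_comb x g + lin_comb y g"
proof -
  let ?S = "{c. \<xi> x c \<noteq> 0} \<union> {c. \<xi> y c \<noteq> 0}"
  have S: "finite ?S" using coord_finite by simp
  have "{c. \<xi> (x + y) c \<noteq> 0} \<subseteq> ?S" by (auto simp: coord_add)
  then show ?thesis
    using S by (simp add: lin_comb_superset[of ?S] coord_add distrib_right sum.distrib)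
qed

lemma rem_add: "rem (x + y) = rem x + rem y"
proof -
  let ?S = "{c. \<xi> x c \<noteq> 0} \<union> {c. \<xi> y c \<noteq> 0}"
  have S: "finite ?S" using coord_finite by simp
  have "{c. \<xi> (x + y) c \<noteq> 0} \<subseteq> ?S" by (auto simp: coord_add)
  then show ?thesis
    using S by (simp add: rem_superset[of ?S] coord_add lie.scale_left_distrib sum.distrib)
qed

lemma lin_comb_scale: "lin_comb (r *\<^sub>C x) g = r * lin_comb x g"
proof -
  have "{c. \<xi> (r *\<^sub>C x) c \<noteq> 0} \<subseteq> {c. \<xi> x c \<noteq> 0}" by (auto simp: coord_scale)
  then show ?thesis
    using coord_finite
    by (simp add: lin_comb_superset[of "{c. \<xi> x c \<noteq> 0}"] coord_scale sum_distrib_left mult.assoc)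
qed

lemma rem_scale: "rem (r *\<^sub>C x) = r *\<^sub>C rem x"
proof -
  have "{c. \<xi> (r *\<^sub>C x) c \<noteq> 0} \<subseteq> {c. \<xi> x c \<noteq> 0}" by (auto simp: coord_scale)
  then show ?thesis
    using coord_finite
    by (simp add: rem_superset[of "{c. \<xi> x c \<noteq> 0}"] coord_scale lie.scale_right_diff_distrib
        lie.scale_sum_right)
qed

text \<open>The congruence rule exposes the recursive call of \<open>L\<close> under
  \<open>lin_comb\<close>. Termination is then shown for every letter \<open>c\<close>, which is
  harmless because a bracket term is shorter whatever its letter.\<close>

lemma lin_comb_cong [fundef_cong]:
  "x = y \<Longrightarrow> (\<And>c. g c = h c) \<Longrightarrow> lin_comb x g = lin_comb y h"
  by (simp add: lin_comb_def)

lemma lin_comb_fun_add: "lin_comb x (\<lambda>c. g c + h c) = lin_comb x g + lin_comb x h"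
  by (simp add: lin_comb_def distrib_left sum.distrib)

lemma lin_comb_fun_diff: "lin_comb x (\<lambda>c. g c - h c) = lin_comb x g - lin_comb x h"
  by (simp add: lin_comb_def right_diff_distrib sum_subtractf)

lemma lin_comb_fun_mult: "lin_comb x (\<lambda>c. r * g c) = r * lin_comb x g"
  by (simp add: lin_comb_def sum_distrib_left mult.left_commute)

lemma lin_comb_swap:
  "lin_comb x (\<lambda>c. lin_comb y (\<lambda>d. g c d)) = lin_comb y (\<lambda>d. lin_comb x (\<lambda>c. g c d))"
  unfolding lin_comb_def sum_distrib_left by (subst sum.swap) (simp add: mult.left_commute)

lemma bracket_expand:
  "bracket y x = (\<Sum>c | \<xi> x c \<noteq> 0. \<xi> x c *\<^sub>C bracket y (X c))"
proof -
  have "x = rem x + (\<Sum>c | \<xi> x c \<noteq> 0. \<xi> x c *\<^sub>C X c)" by (simp add: rem_def)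
  moreover have "bracket y (rem x) = 0"
    using rem_in Z_central by (auto intro: lie_center_bracket)
  ultimately show ?thesis
    by (metis (no_types, lifting) add_0 bracket_add_right bracket_scale_right bracket_sum_right sum.cong)
qed

end


text \<open>\<open>F M w\<close> prescribes the value on the product of the central elements in
  \<open>M\<close> and the ordered word \<open>w\<close>. A multiset is a monomial of S(Zs), and
  linearity in one entry is linearity in all of them, so for fixed \<open>w\<close> this is a
  functional on S(Zs).\<close>

locale straightening = central_frame X \<xi> Zs
  for X :: "'a::linorder \<Rightarrow> 'g::lie_algebra" and \<xi> :: "'g \<Rightarrow> 'a \<Rightarrow> complex" and Zs :: "'g set" +
  fixes F :: "'g multiset \<Rightarrow> 'a list \<Rightarrow> complex"
  assumes F_add: "\<lbrakk>set_mset M \<subseteq> Zs; z \<in> Zs; z' \<in> Zs\<rbrakk> \<Longrightarrow>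
      F (add_mset (z + z') M) w = F (add_mset z M) w + F (add_mset z' M) w"
    and F_scale: "\<lbrakk>set_mset M \<subseteq> Zs; z \<in> Zs\<rbrakk> \<Longrightarrow>
      F (add_mset (r *\<^sub>C z) M) w = r * F (add_mset z M) w"
begin

text \<open>\<open>L M w\<close> is the value, on the product of the central elements in \<open>M\<close> and the letters of \<open>w\<close>,
  of the linear functional whose values on ordered words are prescribed by \<open>F\<close>.\<close>

function L :: "'g multiset \<Rightarrow> 'a list \<Rightarrow> complex" where
  "L M w = (if sorted w then F M w
    else (case descent w of (u, a, b, v) \<Rightarrow>
      L M (u @ b # a # v) + lin_comb (bracket (X a) (X b)) (\<lambda>c. L M (u @ c # v)) +
      L (add_mset (rem (bracket (X a) (X b))) M) (u @ v)))"
  by pat_completeness auto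
termination
proof (relation "inv_image word_less snd")
  show "wf (inv_image (word_less :: ('a list \<times> 'a list) set) (snd :: 'g multiset \<times> 'a list \<Rightarrow> _))"
    by (simp add: wf_word_less)
qed (auto dest!: descentD'[rotated] simp: word_less_iff inversions_swap)

declare L.simps [simp del]

text \<open>The value of \<open>L\<close> with an arbitrary element \<open>x\<close> of the Lie
  algebra standing between \<open>u\<close> and \<open>v\<close>: its coordinates become letters and
  its remainder joins \<open>M\<close>.\<close>

definition L1 :: "'g multiset \<Rightarrow> 'a list \<Rightarrow> 'g \<Rightarrow> 'a list \<Rightarrow> complex" where
  "L1 M u x v = lin_comb x (\<lambda>c. L M (u @ c # v)) + L (add_mset (rem x) M) (u @ v)"

lemma L_sorted: "sorted w \<Longrightarrow> L M w = F M w"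
  by (simp add: L.simps)

lemma L_unsorted:
  assumes "\<not> sorted w"
  obtains u a b v where "w = u @ a # b # v" "b < a"
    "\<And>M. L M w = L M (u @ b # a # v) + L1 M u (bracket (X a) (X b)) v"
proof -
  obtain u a b v where d: "descent w = (u, a, b, v)" by (metis prod_cases4)
  show ?thesis
    by (rule that[OF descentD[OF assms d]]) (subst L.simps, simp add: assms d L1_def)
qed

text \<open>Multilinearity passes from \<open>F\<close> to \<open>L\<close> because rewriting only
  adds elements to \<open>M\<close>. It makes \<open>L1\<close> linear in \<open>x\<close>, whose
  remainder enters through \<open>M\<close>.\<close>

lemma L_add:
  "\<lbrakk>set_mset M \<subseteq> Zs; z \<in> Zs; z' \<in> Zs\<rbrakk> \<Longrightarrow>
    L (add_mset (z + z') M) w = L (add_mset z M) w + L (add_mset z' M) w"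
proof (induction w arbitrary: M rule: word_induct)
  case (less w)
  show ?case
  proof (cases "sorted w")
    case True
    then show ?thesis using less.prems by (simp add: L_sorted F_add)
  next
    case False
    then obtain u a b v where w: "w = u @ a # b # v" "b < a"
      "\<And>M. L M w = L M (u @ b # a # v) + L1 M u (bracket (X a) (X b)) v"
      using L_unsorted by metis
    let ?r = "rem (bracket (X a) (X b))"
    have "L (add_mset (z + z') M) (u @ b # a # v) =
        L (add_mset z M) (u @ b # a # v) + L (add_mset z' M) (u @ b # a # v)"
      by (rule less.IH) (use w less.prems in \<open>auto simp: word_less_iff inversions_swap\<close>)
    moreover have "L (add_mset (z + z') M) (u @ c # v) =
        L (add_mset z M) (u @ c # v) + L (add_mset z' M) (u @ c # v)" for c
      by (rule less.IH) (use w less.prems in \<open>auto simp: word_less_iff\<close>)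
    moreover have "L (add_mset (z + z') (add_mset ?r M)) (u @ v) =
        L (add_mset z (add_mset ?r M)) (u @ v) + L (add_mset z' (add_mset ?r M)) (u @ v)"
      by (rule less.IH) (use w less.prems rem_in in \<open>auto simp: word_less_iff\<close>)
    ultimately show ?thesis
      by (simp add: w(3) L1_def lin_comb_fun_add add_mset_commute[of ?r] )
  qed
qed

lemma L_scale:
  "\<lbrakk>set_mset M \<subseteq> Zs; z \<in> Zs\<rbrakk> \<Longrightarrow> L (add_mset (r *\<^sub>C z) M) w = r * L (add_mset z M) w"
proof (induction w arbitrary: M rule: word_induct)
  case (less w)
  show ?case
  proof (cases "sorted w")
    case True
    then show ?thesis using less.prems by (simp add: L_sorted F_scale)
  next
    case False
    then obtain u a b v where w: "w = u @ a # b # v" "b < a"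
      "\<And>M. L M w = L M (u @ b # a # v) + L1 M u (bracket (X a) (X b)) v"
      using L_unsorted by metis
    let ?r = "rem (bracket (X a) (X b))"
    have "L (add_mset (r *\<^sub>C z) M) (u @ b # a # v) = r * L (add_mset z M) (u @ b # a # v)"
      by (rule less.IH) (use w less.prems in \<open>auto simp: word_less_iff inversions_swap\<close>)
    moreover have "L (add_mset (r *\<^sub>C z) M) (u @ c # v) = r * L (add_mset z M) (u @ c # v)" for c
      by (rule less.IH) (use w less.prems in \<open>auto simp: word_less_iff\<close>)
    moreover have "L (add_mset (r *\<^sub>C z) (add_mset ?r M)) (u @ v) =
        r * L (add_mset z (add_mset ?r M)) (u @ v)"
      by (rule less.IH) (use w less.prems rem_in in \<open>auto simp: word_less_iff\<close>)
    ultimately show ?thesis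
      by (simp add: w(3) L1_def lin_comb_fun_mult add_mset_commute[of ?r] distrib_left)
  qed
qed

lemma L1_add: "set_mset M \<subseteq> Zs \<Longrightarrow> L1 M u (x + y) v = L1 M u x v + L1 M u y v"
  by (simp add: L1_def lin_comb_add rem_add L_add rem_in)

lemma L1_scale: "set_mset M \<subseteq> Zs \<Longrightarrow> L1 M u (r *\<^sub>C x) v = r * L1 M u x v"
  by (simp add: L1_def lin_comb_scale rem_scale L_scale rem_in distrib_left)

lemma L1_zero: "set_mset M \<subseteq> Zs \<Longrightarrow> L1 M u 0 v = 0"
  using L1_scale[of M u 0 0 v] by simp

lemma L1_minus: "set_mset M \<subseteq> Zs \<Longrightarrow> L1 M u (- x) v = - L1 M u x v"
  using L1_add[of M u x "- x" v] L1_zero[of M u v] by (simp add: eq_neg_iff_add_eq_0 add.commute)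

lemma L1_sum:
  "set_mset M \<subseteq> Zs \<Longrightarrow> L1 M u (\<Sum>i\<in>S. f i) v = (\<Sum>i\<in>S. L1 M u (f i) v)"
  by (induction S rule: infinite_finite_induct) (simp_all add: L1_zero L1_add)

text \<open>Independence of the choice made in \<open>descent\<close>, for one word: the rewriting
  rule holds at each of its descents.\<close>

definition straight_at :: "'a list \<Rightarrow> bool" where
  "straight_at w \<longleftrightarrow> (\<forall>M u a b v. set_mset M \<subseteq> Zs \<longrightarrow> w = u @ a # b # v \<longrightarrow> b < a \<longrightarrow>
     L M w = L M (u @ b # a # v) + L1 M u (bracket (X a) (X b)) v)"

text \<open>For \<open>a < b\<close> this is the rule for the descent of the swapped word, read
  backwards with the sign of the bracket reversed; for \<open>a = b\<close> the bracket
  vanishes.\<close>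

lemma swap_shorter:
  assumes "\<And>w'. length w' = n \<Longrightarrow> straight_at w'"
    and M: "set_mset M \<subseteq> Zs" and n: "length (u @ a # b # v) = n"
  shows "L M (u @ a # b # v) = L M (u @ b # a # v) + L1 M u (bracket (X a) (X b)) v"
proof (cases a b rule: linorder_cases)
  case less
  then show ?thesis
    using assms(1)[of "u @ b # a # v"] n M
    by (simp add: straight_at_def bracket_anti[of "X a" "X b"] L1_minus)
next
  case equal
  then show ?thesis using M by (simp add: bracket_self L1_zero)
next
  case greater
  then show ?thesis
    using assms(1)[of "u @ a # b # v"] n M by (simp add: straight_at_def)
qed

text \<open>The letter \<open>a\<close> is swapped with each coordinate of \<open>x\<close>, while
  the remainder of \<open>x\<close> enters both sides alike. Summing the resulting brackets over the
  coordinates gives the bracket with \<open>x\<close>.\<close>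

lemma L1_commute:
  assumes IH: "\<And>w'. length w' = n \<Longrightarrow> straight_at w'"
    and M: "set_mset M \<subseteq> Zs" and n: "length u + length v + 2 = n"
  shows "L1 M (u @ [a]) x v = L1 M u x (a # v) + L1 M u (bracket (X a) x) v"
proof -
  have "L M (u @ a # c # v) = L M (u @ c # a # v) + L1 M u (bracket (X a) (X c)) v" for c
    by (rule swap_shorter[OF IH M]) (use n in auto)
  then have "L1 M (u @ [a]) x v - L1 M u x (a # v) =
      lin_comb x (\<lambda>c. L1 M u (bracket (X a) (X c)) v)"
    by (simp add: L1_def lin_comb_fun_add)
  also have "\<dots> = L1 M u (bracket (X a) x) v"
    by (subst bracket_expand[of _ x]) (simp add: L1_sum[OF M] L1_scale[OF M] lin_comb_def)
  finally show ?thesis by (simp add: algebra_simps)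
qed

lemma L1_L1_swap:
  assumes M: "set_mset M \<subseteq> Zs"
  shows "lin_comb x (\<lambda>c. L1 M (u @ c # t) y v) + L1 (add_mset (rem x) M) (u @ t) y v =
    lin_comb y (\<lambda>d. L1 M u x (t @ d # v)) + L1 (add_mset (rem y) M) u x (t @ v)"
  by (simp add: L1_def lin_comb_fun_add lin_comb_swap[of x y] add_mset_commute[of "rem x" "rem y"])

text \<open>Two descents either share their middle letter or are disjoint. In both cases the two
  results are rewritten on smaller words until they meet. The bracket terms agree by the Jacobi
  identity in the first case, and in the second because insertions at separate places
  commute.\<close>

lemma confluence:
  assumes IH: "\<And>w'. (w', w) \<in> word_less \<Longrightarrow> straight_at w'"
    and M: "set_mset M \<subseteq> Zs"
    and w: "w = u @ a # b # v" "b < a" and w': "w = u' @ a' # b' # v'" "b' < a'"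
    and len: "length u < length u'"
  shows "L M (u @ b # a # v) + L1 M u (bracket (X a) (X b)) v =
    L M (u' @ b' # a' # v') + L1 M u' (bracket (X a') (X b')) v'"
proof -
  have shorter: "straight_at w''" if "length w'' < length w" for w''
    by (rule IH) (use that in \<open>simp add: word_less_iff\<close>)
  from w(1) w'(1) len obtain s where s: "u' = u @ s" "s @ a' # b' # v' = a # b # v" "s \<noteq> []"
    by (auto simp: append_eq_append_conv2)
  show ?thesis
  proof (cases "tl s")
    \<comment> \<open>Overlap: \<open>s\<close> has a single letter, so the descents are
      \<open>a > b\<close> and \<open>b > b'\<close>, and both sides are brought to the order
      \<open>b'\<close>, \<open>b\<close>, \<open>a\<close>.\<close>
    case Nil
    with s have u': "u' = u @ [a]" and a': "a' = b" and v: "v = b' # v'"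
      by (cases s; auto)+
    let ?c = "b'"
    have lenw: "length w = length u + length v' + 3" using w v by simp
    have ac: "?c < a" using w w' a' by auto
    have 1: "L M (u @ b # a # ?c # v') =
        L M (u @ b # ?c # a # v') + L1 M (u @ [b]) (bracket (X a) (X ?c)) v'"
    proof -
      have "straight_at (u @ b # a # ?c # v')"
        by (rule IH) (use w v in \<open>simp add: word_less_iff inversions_swap\<close>)
      then show ?thesis
        using M ac unfolding straight_at_def
        by (metis append.assoc append_Cons append_Nil)
    qed
    have 2: "L M (u @ b # ?c # a # v') =
        L M (u @ ?c # b # a # v') + L1 M u (bracket (X b) (X ?c)) (a # v')"
    proof -
      have "inversions (u @ b # ?c # a # v') < inversions (u @ b # a # ?c # v')"
        using inversions_swap[of ?c a "u @ [b]" v'] ac by simp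
      then have "straight_at (u @ b # ?c # a # v')"
        by (intro IH) (use w v in \<open>simp add: word_less_iff inversions_swap\<close>)
      then show ?thesis
        using M w' a' unfolding straight_at_def by blast
    qed
    have 3: "L M (u @ a # ?c # b # v') =
        L M (u @ ?c # a # b # v') + L1 M u (bracket (X a) (X ?c)) (b # v')"
    proof -
      have "inversions (u @ a # ?c # b # v') < inversions (u @ a # b # ?c # v')"
        using inversions_swap[of ?c b "u @ [a]" v'] w' a' by simp
      then have "straight_at (u @ a # ?c # b # v')"
        by (intro IH) (use w v in \<open>simp add: word_less_iff\<close>)
      then show ?thesis
        using M ac unfolding straight_at_def by blast
    qed
    have 4: "L M (u @ ?c # a # b # v') =
        L M (u @ ?c # b # a # v') + L1 M (u @ [?c]) (bracket (X a) (X b)) v'"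
    proof -
      have "inversions (u @ a # ?c # b # v') < inversions (u @ a # b # ?c # v')"
        using inversions_swap[of ?c b "u @ [a]" v'] w' a' by simp
      then have "straight_at (u @ ?c # a # b # v')"
        by (intro IH) (use w v ac in \<open>simp add: word_less_iff inversions_swap\<close>)
      then show ?thesis
        using M w unfolding straight_at_def
        by (metis append.assoc append_Cons append_Nil)
    qed
    have comm: "L1 M (u @ [d]) x v' = L1 M u x (d # v') + L1 M u (bracket (X d) x) v'" for d x
      by (rule L1_commute[OF shorter M refl]) (simp add: lenw)
    \<comment> \<open>The two ways of rewriting the overlapping descents \<open>a > b > c\<close> agree by the Jacobi identity.\<close>
    have "bracket (X b) (bracket (X a) (X ?c)) =
        bracket (X ?c) (bracket (X a) (X b)) + bracket (X a) (bracket (X b) (X ?c))"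
      using jacobi[of "X a" "X b" "X ?c"]
      by (simp add: bracket_anti[of "X a" "X ?c"] bracket_minus_right neg_eq_iff_add_eq_0 ac_simps)
    then have "L1 M u (bracket (X b) (bracket (X a) (X ?c))) v' =
        L1 M u (bracket (X ?c) (bracket (X a) (X b))) v' +
        L1 M u (bracket (X a) (bracket (X b) (X ?c))) v'"
      using L1_add[OF M] by metis
    then show ?thesis
      using 1 2 3 4 by (simp add: u' a' v comm)
  next
    \<comment> \<open>Disjoint descents, separated by \<open>t\<close>: both sides meet at
      \<open>u @ b # a # t @ b' # a' # v'\<close>.\<close>
    case (Cons s1 t)
    with s have u': "u' = u @ a # b # t" and v: "v = t @ a' # b' # v'"
      by (cases s; auto)+
    let ?x = "bracket (X a) (X b)" and ?y = "bracket (X a') (X b')"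
    have lenw: "length w = length u + length t + length v' + 4" using w v by simp
    have 1: "L M (u @ b # a # t @ a' # b' # v') =
        L M (u @ b # a # t @ b' # a' # v') + L1 M (u @ b # a # t) ?y v'"
    proof -
      have "straight_at (u @ b # a # t @ a' # b' # v')"
        by (rule IH) (use w v in \<open>simp add: word_less_iff inversions_swap\<close>)
      then show ?thesis
        using M w' unfolding straight_at_def by (metis append.assoc append_Cons)
    qed
    have 2: "L M (u @ a # b # t @ b' # a' # v') =
        L M (u @ b # a # t @ b' # a' # v') + L1 M u ?x (t @ b' # a' # v')"
    proof -
      have "inversions (u @ a # b # t @ b' # a' # v') < inversions (u @ a # b # t @ a' # b' # v')"
        using inversions_swap[of b' a' "u @ a # b # t" v'] w' by simp
      then have "straight_at (u @ a # b # t @ b' # a' # v')"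
        by (intro IH) (use w v in \<open>simp add: word_less_iff\<close>)
      then show ?thesis
        using M w unfolding straight_at_def by blast
    qed
    have 3: "L M' (r @ a' # b' # v') = L M' (r @ b' # a' # v') + L1 M' r ?y v'"
      if "set_mset M' \<subseteq> Zs" "length r < length u + length t + 2" for r M'
      using shorter[of "r @ a' # b' # v'"] that w' lenw unfolding straight_at_def by simp
    have 4: "L M' (u @ a # b # r) = L M' (u @ b # a # r) + L1 M' u ?x r"
      if "set_mset M' \<subseteq> Zs" "length r < length t + length v' + 2" for r M'
      using shorter[of "u @ a # b # r"] that w lenw unfolding straight_at_def by simp
    have M2: "set_mset (add_mset (rem x) M) \<subseteq> Zs" for x using M rem_in by simp
    \<comment> \<open>A bracket term is already shorter, so the other descent may be rewritten
      inside it; this yields the terms with both brackets.\<close>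
    have 5: "L1 M u ?x (t @ a' # b' # v') - L1 M u ?x (t @ b' # a' # v') =
        lin_comb ?x (\<lambda>c. L1 M (u @ c # t) ?y v') + L1 (add_mset (rem ?x) M) (u @ t) ?y v'"
      using 3[OF M, of "u @ _ # t"] 3[OF M2, of "u @ t"]
      by (simp add: L1_def[of M u] lin_comb_fun_add)
    have 6: "L1 M (u @ a # b # t) ?y v' - L1 M (u @ b # a # t) ?y v' =
        lin_comb ?y (\<lambda>d. L1 M u ?x (t @ d # v')) + L1 (add_mset (rem ?y) M) u ?x (t @ v')"
      using 4[OF M, of "t @ _ # v'"] 4[OF M2, of "t @ v'"]
      by (simp add: L1_def[of M "u @ a # _"] L1_def[of M "u @ b # _"] lin_comb_fun_add)
    show ?thesis
      using 1 2 5 6 L1_L1_swap[OF M, of ?x u t ?y v'] by (simp add: u' v algebra_simps)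
  qed
qed

text \<open>The given descent is compared with the one rewritten by \<open>L\<close>;
  \<open>confluence\<close> covers both relative positions.\<close>

lemma straight: "straight_at w"
proof (induction w rule: word_induct)
  case (less w)
  show ?case
    unfolding straight_at_def
  proof (intro allI impI)
    fix M u a b v
    assume M: "set_mset M \<subseteq> Zs" and w: "w = u @ a # b # v" "b < a"
    then have "\<not> sorted w" by (auto simp: sorted_append)
    then obtain u' a' b' v' where w': "w = u' @ a' # b' # v'" "b' < a'"
      "\<And>M. L M w = L M (u' @ b' # a' # v') + L1 M u' (bracket (X a') (X b')) v'"
      using L_unsorted by metis
    consider "length u < length u'" | "length u' < length u" | "length u = length u'" by linarith
    then show "L M w = L M (u @ b # a # v) + L1 M u (bracket (X a) (X b)) v"
    proof cases
      case 1
      then show ?thesis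
        using confluence[OF less.IH M w w'(1,2)] w'(3) by simp
    next
      case 2
      then show ?thesis
        using confluence[OF less.IH M w'(1,2) w] w'(3) by simp
    next
      case 3
      then show ?thesis using w w' by simp
    qed
  qed
qed

lemma L_swap:
  "set_mset M \<subseteq> Zs \<Longrightarrow>
    L M (u @ a # b # v) = L M (u @ b # a # v) + L1 M u (bracket (X a) (X b)) v"
  by (rule swap_shorter[OF straight]) auto

end


section \<open>Extension to words over the Lie algebra\<close>

context straightening
begin

text \<open>\<open>E M w xs\<close> is the value on the product of \<open>M\<close>, the letters of \<open>w\<close> and the elements \<open>xs\<close>.\<close>

primrec E :: "'g multiset \<Rightarrow> 'a list \<Rightarrow> 'g list \<Rightarrow> complex" where
  "E M w [] = L M w"
| "E M w (x # xs) = lin_comb x (\<lambda>c. E M (w @ [c]) xs) + E (add_mset (rem x) M) w xs"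

lemma E_add:
  "\<lbrakk>set_mset M \<subseteq> Zs; z \<in> Zs; z' \<in> Zs\<rbrakk> \<Longrightarrow>
    E (add_mset (z + z') M) w xs = E (add_mset z M) w xs + E (add_mset z' M) w xs"
proof (induction xs arbitrary: M w)
  case (Cons x xs)
  have "E (add_mset (z + z') (add_mset (rem x) M)) w xs =
      E (add_mset z (add_mset (rem x) M)) w xs + E (add_mset z' (add_mset (rem x) M)) w xs"
    using Cons rem_in by simp
  then show ?case
    using Cons by (simp add: lin_comb_fun_add add_mset_commute[of "rem x"])
qed (simp add: L_add)

lemma E_scale:
  "\<lbrakk>set_mset M \<subseteq> Zs; z \<in> Zs\<rbrakk> \<Longrightarrow> E (add_mset (r *\<^sub>C z) M) w xs = r * E (add_mset z M) w xs"
proof (induction xs arbitrary: M w)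
  case (Cons x xs)
  have "E (add_mset (r *\<^sub>C z) (add_mset (rem x) M)) w xs =
      r * E (add_mset z (add_mset (rem x) M)) w xs"
    using Cons rem_in by simp
  then show ?case
    using Cons by (simp add: lin_comb_fun_mult distrib_left add_mset_commute[of "rem x"])
qed (simp add: L_scale)

definition E1 :: "'g multiset \<Rightarrow> 'a list \<Rightarrow> 'g \<Rightarrow> 'a list \<Rightarrow> 'g list \<Rightarrow> complex" where
  "E1 M u x v xs = lin_comb x (\<lambda>c. E M (u @ c # v) xs) + E (add_mset (rem x) M) (u @ v) xs"

lemma E1_Nil: "E1 M u x [] xs = E M u (x # xs)"
  by (simp add: E1_def)

lemma E1_add: "set_mset M \<subseteq> Zs \<Longrightarrow> E1 M u (x + y) v xs = E1 M u x v xs + E1 M u y v xs"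
  by (simp add: E1_def lin_comb_add rem_add E_add rem_in)

lemma E1_scale: "set_mset M \<subseteq> Zs \<Longrightarrow> E1 M u (r *\<^sub>C x) v xs = r * E1 M u x v xs"
  by (simp add: E1_def lin_comb_scale rem_scale E_scale rem_in distrib_left)

lemma E1_sum:
  "set_mset M \<subseteq> Zs \<Longrightarrow> E1 M u (\<Sum>i\<in>S. f i) v xs = (\<Sum>i\<in>S. E1 M u (f i) v xs)"
proof (induction S rule: infinite_finite_induct)
  case (infinite A)
  then show ?case using E1_scale[of M u 0 0 v xs] by simp
next
  case empty
  then show ?case using E1_scale[of M u 0 0 v xs] by simp
qed (simp add: E1_add)

text \<open>Expanding a further element only appends letters on the right or enlarges
  \<open>M\<close>, so it commutes with a swap performed to its left.\<close>

lemma E_swap: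
  "set_mset M \<subseteq> Zs \<Longrightarrow>
    E M (u @ a # b # v) xs = E M (u @ b # a # v) xs + E1 M u (bracket (X a) (X b)) v xs"
proof (induction xs arbitrary: M v)
  case Nil
  then show ?case using L_swap[of M u a b v] by (simp add: E1_def L1_def)
next
  case (Cons y ys)
  let ?x = "bracket (X a) (X b)"
  have M': "set_mset (add_mset (rem y) M) \<subseteq> Zs" using Cons.prems rem_in by simp
  have "E M (u @ a # b # v @ [c]) ys =
      E M (u @ b # a # v @ [c]) ys + E1 M u ?x (v @ [c]) ys" for c
    using Cons.IH[OF Cons.prems] .
  moreover have "lin_comb y (\<lambda>c. E1 M u ?x (v @ [c]) ys) + E1 (add_mset (rem y) M) u ?x v ys =
      E1 M u ?x v (y # ys)"
    by (simp add: E1_def lin_comb_fun_add lin_comb_swap[of y ?x] add_mset_commute[of "rem y" "rem ?x"])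
  ultimately show ?case
    using Cons.IH[OF M', of v] by (simp add: lin_comb_fun_add algebra_simps)
qed

lemma E_letter_add:
  "set_mset M \<subseteq> Zs \<Longrightarrow> E M w (us @ (x + y) # xs) = E M w (us @ x # xs) + E M w (us @ y # xs)"
proof (induction us arbitrary: M w)
  case Nil
  then show ?case using E1_add[of M w x y "[]" xs] by (simp add: E1_Nil del: E.simps)
next
  case (Cons z us)
  then have "set_mset (add_mset (rem z) M) \<subseteq> Zs" using rem_in by simp
  with Cons show ?case by (simp add: lin_comb_fun_add)
qed

lemma E_letter_scale:
  "set_mset M \<subseteq> Zs \<Longrightarrow> E M w (us @ (r *\<^sub>C x) # xs) = r * E M w (us @ x # xs)"
proof (induction us arbitrary: M w)
  case Nil
  then show ?case using E1_scale[of M w r x "[]" xs] by (simp add: E1_Nil del: E.simps)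
next
  case (Cons z us)
  then have "set_mset (add_mset (rem z) M) \<subseteq> Zs" using rem_in by simp
  with Cons show ?case by (simp add: lin_comb_fun_mult distrib_left)
qed

text \<open>Both elements are expanded in coordinates. Terms containing a central remainder cancel
  in the difference, and the others give brackets of letters, which are summed over \<open>b\<close>
  and then over \<open>a\<close>.\<close>

lemma E_bracket_head:
  assumes M: "set_mset M \<subseteq> Zs"
  shows "E M w (x # y # xs) = E M w (y # x # xs) + E M w (bracket x y # xs)"
proof -
  have "E M w (x # y # xs) - E M w (y # x # xs) =
      lin_comb x (\<lambda>a. lin_comb y (\<lambda>b. E M (w @ [a, b]) xs - E M (w @ [b, a]) xs))"
    by (simp add: lin_comb_fun_add lin_comb_fun_diff lin_comb_swap[of y x]
        add_mset_commute[of "rem x" "rem y"])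
  also have "\<dots> = lin_comb x (\<lambda>a. lin_comb y (\<lambda>b. E1 M w (bracket (X a) (X b)) [] xs))"
  proof -
    have "E M (w @ [a, b]) xs - E M (w @ [b, a]) xs = E1 M w (bracket (X a) (X b)) [] xs" for a b
      using E_swap[OF M, of w a b "[]" xs] by simp
    then show ?thesis by simp
  qed
  also have "\<dots> = lin_comb x (\<lambda>a. E1 M w (bracket (X a) y) [] xs)"
    by (subst bracket_expand[of _ y]) (simp add: E1_sum[OF M] E1_scale[OF M] lin_comb_def)
  \<comment> \<open>\<open>bracket_expand\<close> expands the second argument, so the bracket is
    reversed before the sum over \<open>a\<close> is taken.\<close>
  also have "\<dots> = - lin_comb x (\<lambda>a. E1 M w (bracket y (X a)) [] xs)"
  proof -
    have "E1 M w (bracket (X a) y) [] xs = - 1 * E1 M w (bracket y (X a)) [] xs" for a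
      using E1_scale[OF M, of w "- 1" "bracket y (X a)" "[]" xs]
      by (simp add: bracket_anti[of "X a" y])
    then show ?thesis
      by (simp only: lin_comb_fun_mult) simp
  qed
  also have "\<dots> = - E1 M w (bracket y x) [] xs"
    by (subst bracket_expand[of _ x]) (simp add: E1_sum[OF M] E1_scale[OF M] lin_comb_def)
  also have "\<dots> = E1 M w (bracket x y) [] xs"
    using E1_scale[OF M, of w "- 1" "bracket y x" "[]" xs] by (simp add: bracket_anti[of x y])
  finally show ?thesis by (simp add: E1_Nil algebra_simps del: E.simps)
qed

lemma E_bracket:
  "set_mset M \<subseteq> Zs \<Longrightarrow>
    E M w (us @ x # y # xs) = E M w (us @ y # x # xs) + E M w (us @ bracket x y # xs)"
proof (induction us arbitrary: M w)
  case Nil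
  then show ?case using E_bracket_head[of M w x y xs] by (simp del: E.simps)
next
  case (Cons z us)
  then have "set_mset (add_mset (rem z) M) \<subseteq> Zs" using rem_in by simp
  with Cons show ?case by (simp add: lin_comb_fun_add del: E.simps(2)) (simp add: lin_comb_fun_add)
qed

definition functional :: "'g nc_poly \<Rightarrow> complex" where
  "functional = lin_ext (E {#} [])"

text \<open>This is the independence half of the Poincare-Birkhoff-Witt theorem: apart from
  linearity in \<open>M\<close>, the values of \<open>F\<close> on ordered words are arbitrary, and
  they still induce a functional on U(g).\<close>

lemma functional_env_ker: "p \<in> env_ker \<Longrightarrow> functional p = 0"
  unfolding functional_def
  by (rule lin_ext_env_ideal[where H = UNIV])
    (rule E_letter_add E_letter_scale E_bracket | simp)+

end


section \<open>Functionals attached to a Whittaker character\<close>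

text \<open>Sorting by swaps stays within one multiset of letters, so invariance is asked for only
  there; in the application the multiset fixes the weight.\<close>

lemma sort_invariantI:
  assumes "\<And>u a b v. \<lbrakk>mset (u @ a # b # v) = mset w; (b :: 'a::linorder) < a\<rbrakk> \<Longrightarrow>
      f (u @ a # b # v) = f (u @ b # a # v)"
  shows "f w = f (sort w)"
proof -
  have "f w' = f (sort w)" if "mset w' = mset w" for w'
    using that
  proof (induction w' rule: word_induct)
    case (less w')
    show ?case
    proof (cases "sorted w'")
      case True
      with less.prems show ?thesis by (metis properties_for_sort)
    next
      case False
      then obtain u a b v where w': "w' = u @ a # b # v" "b < a" using unsorted_descent by metis
      then have "f (u @ b # a # v) = f (sort w)"
        using less.prems
        by (intro less.IH) (auto simp: word_less_iff inversions_swap add_mset_commute)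
      then show ?thesis using assms[of u a b v] w' less.prems by simp
    qed
  qed
  then show ?thesis by blast
qed

text \<open>Here \<open>top\<close> is \<alpha>_\<phi>, \<open>Np\<close> is n and \<open>J\<close>
  is K without R''. A bracket of two letters is a multiple of a single letter, up to a central
  remainder that can occur only in degree at most 0.\<close>

locale whittaker_frame = central_frame X \<xi> Zs
  for X :: "'q::linordered_ab_group_add \<Rightarrow> 'g::lie_algebra" and \<xi> :: "'g \<Rightarrow> 'q \<Rightarrow> complex"
    and Zs :: "'g set" +
  fixes J :: "'q set" and \<pi> :: "'q \<Rightarrow> int" and Np :: "'g set" and \<phi> :: "'g \<Rightarrow> complex" and top :: 'q
  assumes deg_add: "\<pi> (\<alpha> + \<beta>) = \<pi> \<alpha> + \<pi> \<beta>"
    and deg_mono: "\<alpha> \<le> \<beta> \<Longrightarrow> \<pi> \<alpha> \<le> \<pi> \<beta>"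
    and coord_basis: "\<alpha> \<in> J \<Longrightarrow> \<xi> (X \<alpha>) \<gamma> = (if \<gamma> = \<alpha> then 1 else 0)"
    and coord_central: "z \<in> Zs \<Longrightarrow> \<xi> z \<gamma> = 0"
    and coord_bracket: "\<xi> (bracket (X \<alpha>) (X \<beta>)) \<gamma> \<noteq> 0 \<Longrightarrow> \<gamma> = \<alpha> + \<beta>"
    and rem_bracket: "\<pi> (\<alpha> + \<beta>) > 0 \<Longrightarrow> rem (bracket (X \<alpha>) (X \<beta>)) = 0"
    and char_bracket: "\<lbrakk>\<pi> \<alpha> > 0; \<pi> \<beta> > 0\<rbrakk> \<Longrightarrow>
      \<xi> (bracket (X \<alpha>) (X \<beta>)) (\<alpha> + \<beta>) * \<phi> (X (\<alpha> + \<beta>)) = 0"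
    and top_pos: "\<pi> top > 0"
    and top_greatest: "\<lbrakk>\<pi> \<alpha> > 0; \<phi> (X \<alpha>) \<noteq> 0\<rbrakk> \<Longrightarrow> \<alpha> \<le> top"
    and pos_rem: "n \<in> Np \<Longrightarrow> rem n = 0"
    and pos_coord: "\<lbrakk>n \<in> Np; \<xi> n \<gamma> \<noteq> 0\<rbrakk> \<Longrightarrow> \<pi> \<gamma> > 0"
    and pos_char: "n \<in> Np \<Longrightarrow> \<phi> n = lin_comb n (\<lambda>\<gamma>. \<phi> (X \<gamma>))"
begin

abbreviation sc :: "'q \<Rightarrow> 'q \<Rightarrow> complex" where
  "sc \<alpha> \<beta> \<equiv> \<xi> (bracket (X \<alpha>) (X \<beta>)) (\<alpha> + \<beta>)"

lemma lin_comb_bracket: "lin_comb (bracket (X \<alpha>) (X \<beta>)) g = sc \<alpha> \<beta> * g (\<alpha> + \<beta>)"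
  using lin_comb_superset[of "{\<alpha> + \<beta>}" "bracket (X \<alpha>) (X \<beta>)" g] coord_bracket by force

lemma lin_comb_basis: "\<alpha> \<in> J \<Longrightarrow> lin_comb (X \<alpha>) g = g \<alpha>"
  using lin_comb_superset[of "{\<alpha>}" "X \<alpha>" g] by (auto simp: coord_basis)

lemma rem_basis: "\<alpha> \<in> J \<Longrightarrow> rem (X \<alpha>) = 0"
  using rem_superset[of "{\<alpha>}" "X \<alpha>"] by (auto simp: coord_basis)

lemma lin_comb_central: "z \<in> Zs \<Longrightarrow> lin_comb z g = 0"
  by (simp add: lin_comb_def coord_central)

lemma rem_central: "z \<in> Zs \<Longrightarrow> rem z = z"
  by (simp add: rem_def coord_central)

text \<open>The weight for which rewriting a bracket, and replacing a letter \<open>\<alpha>\<close> of positive degree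
  by a nonzero \<open>\<phi> (X \<alpha>)\<close>, never increase the weight of a word.\<close>

definition weight :: "'q list \<Rightarrow> int" where
  "weight w = (\<Sum>\<alpha>\<leftarrow>w. \<pi> top - \<pi> \<alpha>)"

lemma weight_simps [simp]:
  "weight [] = 0" "weight (\<alpha> # w) = \<pi> top - \<pi> \<alpha> + weight w" "weight (u @ v) = weight u + weight v"
  by (simp_all add: weight_def)

lemma pos_greater: "\<lbrakk>\<pi> \<alpha> \<le> 0; \<pi> \<beta> > 0\<rbrakk> \<Longrightarrow> \<alpha> < \<beta>"
  using deg_mono[of \<beta> \<alpha>] by force

text \<open>Monotonicity of \<open>\<pi>\<close> places the letters of degree at most 0 before those
  of positive degree, so ordered words reflect the factorization U(g) = U(b_-) U(n).\<close>

lemma sorted_partition: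
  "sorted w \<Longrightarrow> w = filter (\<lambda>\<alpha>. \<pi> \<alpha> \<le> 0) w @ filter (\<lambda>\<alpha>. \<pi> \<alpha> > 0) w"
proof (induction w)
  case (Cons \<alpha> w)
  show ?case
  proof (cases "\<pi> \<alpha> \<le> 0")
    case False
    then have "\<forall>\<beta>\<in>set w. \<pi> \<beta> > 0" using Cons.prems deg_mono by fastforce
    then have "filter (\<lambda>\<alpha>. \<pi> \<alpha> \<le> 0) w = []" "filter (\<lambda>\<alpha>. \<pi> \<alpha> > 0) w = w"
      by (auto simp: filter_empty_conv)
    then show ?thesis using False by simp
  qed (use Cons in simp)
qed simp

lemma weight_partition:
  "weight w = weight (filter (\<lambda>\<alpha>. \<pi> \<alpha> \<le> 0) w) + weight (filter (\<lambda>\<alpha>. \<pi> \<alpha> > 0) w)"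
  by (induction w) auto

end


locale whittaker_functional = whittaker_frame X \<xi> Zs J \<pi> Np \<phi> top
  for X :: "'q::linordered_ab_group_add \<Rightarrow> 'g::lie_algebra" and \<xi> :: "'g \<Rightarrow> 'q \<Rightarrow> complex"
    and Zs :: "'g set" and J :: "'q set" and \<pi> :: "'q \<Rightarrow> int" and Np :: "'g set"
    and \<phi> :: "'g \<Rightarrow> complex" and top :: 'q +
  fixes \<Lambda> :: "'g multiset \<Rightarrow> complex" and k :: "'q list"
  assumes \<Lambda>_add: "\<lbrakk>set_mset M \<subseteq> Zs; z \<in> Zs; z' \<in> Zs\<rbrakk> \<Longrightarrow>
      \<Lambda> (add_mset (z + z') M) = \<Lambda> (add_mset z M) + \<Lambda> (add_mset z' M)"
    and \<Lambda>_scale: "\<lbrakk>set_mset M \<subseteq> Zs; z \<in> Zs\<rbrakk> \<Longrightarrow>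
      \<Lambda> (add_mset (r *\<^sub>C z) M) = r * \<Lambda> (add_mset z M)"
begin

text \<open>On the generator of M_\<phi>, an ordered word acts as its part in b_- times the value of
  \<open>\<phi>\<close> on its part in n; \<open>base\<close> is the coefficient of \<open>k\<close>
  in the result.\<close>

definition base :: "'q list \<Rightarrow> complex" where
  "base w = (if filter (\<lambda>\<alpha>. \<pi> \<alpha> \<le> 0) w = k
     then \<Prod>\<alpha>\<leftarrow>filter (\<lambda>\<alpha>. \<pi> \<alpha> > 0) w. \<phi> (X \<alpha>) else 0)"

sublocale straightening X \<xi> Zs "\<lambda>M w. \<Lambda> M * base w"
  by unfold_locales (simp_all add: \<Lambda>_add \<Lambda>_scale distrib_right)

lemma L_rem_zero: "set_mset M \<subseteq> Zs \<Longrightarrow> L (add_mset 0 M) w = 0"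
  using L_scale[of M 0 0 w] Z_subspace lie.subspace_0 by auto

lemma E_rem_zero: "set_mset M \<subseteq> Zs \<Longrightarrow> E (add_mset 0 M) w xs = 0"
  using E_scale[of M 0 0 w xs] Z_subspace lie.subspace_0 by auto

lemma L_swap_graded:
  assumes "set_mset M \<subseteq> Zs"
  shows "L M (u @ \<alpha> # \<beta> # v) = L M (u @ \<beta> # \<alpha> # v) + sc \<alpha> \<beta> * L M (u @ (\<alpha> + \<beta>) # v) +
    (if \<pi> (\<alpha> + \<beta>) > 0 then 0 else L (add_mset (rem (bracket (X \<alpha>) (X \<beta>))) M) (u @ v))"
  using L_swap[OF assms, of u \<alpha> \<beta> v] L_rem_zero[OF assms]
  by (simp add: L1_def lin_comb_bracket rem_bracket)

text \<open>While \<open>ns\<close> is being sorted, a bracket term carries a structure constant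
  times \<open>\<phi> (X (\<alpha> + \<beta>))\<close>. This product is zero because
  \<open>\<phi>\<close> is a character.\<close>

lemma L_pos_word:
  assumes b: "sorted b" "\<forall>\<alpha>\<in>set b. \<pi> \<alpha> \<le> 0"
  shows "\<lbrakk>set_mset M \<subseteq> Zs; \<forall>\<alpha>\<in>set ns. \<pi> \<alpha> > 0\<rbrakk> \<Longrightarrow>
    L M (b @ ns) = (\<Prod>\<alpha>\<leftarrow>ns. \<phi> (X \<alpha>)) * L M b"
proof (induction ns arbitrary: M rule: word_induct)
  case (less ns)
  show ?case
  proof (cases "sorted ns")
    case True
    have "\<forall>\<alpha>\<in>set b. \<forall>\<beta>\<in>set ns. \<alpha> \<le> \<beta>"
      using b less.prems pos_greater by (meson less_imp_le)
    then have "sorted (b @ ns)" using b True by (simp add: sorted_append)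
    moreover have "filter (\<lambda>\<alpha>. \<pi> \<alpha> \<le> 0) b = b" "filter (\<lambda>\<alpha>. 0 < \<pi> \<alpha>) ns = ns"
      "filter (\<lambda>\<alpha>. \<pi> \<alpha> \<le> 0) ns = []" "filter (\<lambda>\<alpha>. \<pi> \<alpha> > 0) b = []"
      using b less.prems by (fastforce simp: filter_empty_conv filter_id_conv)+
    ultimately show ?thesis
      using b(1) by (simp only: L_sorted) (simp add: base_def)
  next
    case False
    then obtain u \<alpha> \<beta> v where ns: "ns = u @ \<alpha> # \<beta> # v" "\<beta> < \<alpha>" using unsorted_descent by metis
    have pos: "\<pi> \<alpha> > 0" "\<pi> \<beta> > 0" "\<pi> (\<alpha> + \<beta>) > 0" using less.prems ns deg_add[of \<alpha> \<beta>] by auto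
    have 1: "L M (b @ u @ \<beta> # \<alpha> # v) = (\<Prod>\<alpha>\<leftarrow>u @ \<beta> # \<alpha> # v. \<phi> (X \<alpha>)) * L M b"
      by (rule less.IH) (use ns less.prems in \<open>auto simp: word_less_iff inversions_swap\<close>)
    have 2: "L M (b @ u @ (\<alpha> + \<beta>) # v) = (\<Prod>\<alpha>\<leftarrow>u @ (\<alpha> + \<beta>) # v. \<phi> (X \<alpha>)) * L M b"
      by (rule less.IH) (use ns less.prems pos in \<open>auto simp: word_less_iff\<close>)
    have 3: "sc \<alpha> \<beta> * L M (b @ u @ (\<alpha> + \<beta>) # v) = 0"
      using char_bracket[OF pos(1,2)] by (auto simp: 2)
    show ?thesis
      using L_swap_graded[OF less.prems(1), of "b @ u" \<alpha> \<beta> v] 1 3 pos by (simp add: ns mult_ac)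
  qed
qed

text \<open>The functional respects the relation x w = \<phi>(x) w of M_\<phi>: straightening
  \<open>w\<close> leaves the last letter in place, and it is evaluated once \<open>w\<close> is
  sorted.\<close>

lemma L_append_pos:
  assumes "\<pi> \<nu> > 0"
  shows "set_mset M \<subseteq> Zs \<Longrightarrow> L M (w @ [\<nu>]) = \<phi> (X \<nu>) * L M w"
proof (induction w arbitrary: M rule: word_induct)
  case (less w)
  show ?case
  proof (cases "sorted w")
    case True
    define b ns where "b = filter (\<lambda>\<alpha>. \<pi> \<alpha> \<le> 0) w" and "ns = filter (\<lambda>\<alpha>. \<pi> \<alpha> > 0) w"
    have w: "w = b @ ns" using sorted_partition[OF True] by (simp add: b_def ns_def)
    have b: "sorted b" "\<forall>\<alpha>\<in>set b. \<pi> \<alpha> \<le> 0" "\<forall>\<alpha>\<in>set ns. \<pi> \<alpha> > 0"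
      using True by (auto simp: b_def ns_def sorted_wrt_filter)
    show ?thesis
      using L_pos_word[OF b(1,2) less.prems, of ns] L_pos_word[OF b(1,2) less.prems, of "ns @ [\<nu>]"]
        b(3) assms by (simp add: w mult_ac)
  next
    case False
    then obtain u \<alpha> \<beta> v where w: "w = u @ \<alpha> # \<beta> # v" "\<beta> < \<alpha>" using unsorted_descent by metis
    let ?M = "add_mset (rem (bracket (X \<alpha>) (X \<beta>))) M"
    have 1: "L M ((u @ \<beta> # \<alpha> # v) @ [\<nu>]) = \<phi> (X \<nu>) * L M (u @ \<beta> # \<alpha> # v)"
      by (rule less.IH) (use w less.prems in \<open>auto simp: word_less_iff inversions_swap\<close>)
    have 2: "L M ((u @ (\<alpha> + \<beta>) # v) @ [\<nu>]) = \<phi> (X \<nu>) * L M (u @ (\<alpha> + \<beta>) # v)"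
      by (rule less.IH) (use w less.prems in \<open>auto simp: word_less_iff\<close>)
    have 3: "L ?M ((u @ v) @ [\<nu>]) = \<phi> (X \<nu>) * L ?M (u @ v)"
      by (rule less.IH) (use w less.prems rem_in in \<open>auto simp: word_less_iff\<close>)
    show ?thesis
      using L_swap_graded[OF less.prems, of u \<alpha> \<beta> "v @ [\<nu>]"] L_swap_graded[OF less.prems, of u \<alpha> \<beta> v]
        1 2 3 by (auto simp: w distrib_left)
  qed
qed

lemma weight_pos_part:
  assumes "(\<Prod>\<alpha>\<leftarrow>ns. \<phi> (X \<alpha>)) \<noteq> 0" "\<forall>\<alpha>\<in>set ns. \<pi> \<alpha> > 0"
  shows "weight ns \<ge> 0"
  using assms
proof (induction ns)
  case (Cons \<alpha> ns)
  then have "\<alpha> \<le> top" using top_greatest[of \<alpha>] by auto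
  then show ?case using Cons deg_mono[of \<alpha> top] by auto
qed simp

text \<open>No rewriting step raises the weight, nor does evaluating positive letters at which
  \<open>\<phi>\<close> is nonzero, so a word lighter than \<open>k\<close> never contributes to the
  coefficient of \<open>k\<close>.\<close>

lemma L_low_weight:
  "\<lbrakk>set_mset M \<subseteq> Zs; weight w < weight k\<rbrakk> \<Longrightarrow> L M w = 0"
proof (induction w arbitrary: M rule: word_induct)
  case (less w)
  show ?case
  proof (cases "sorted w")
    case True
    have "base w = 0"
    proof (rule ccontr)
      assume "base w \<noteq> 0"
      then have k: "filter (\<lambda>\<alpha>. \<pi> \<alpha> \<le> 0) w = k"
        and "(\<Prod>\<alpha>\<leftarrow>filter (\<lambda>\<alpha>. \<pi> \<alpha> > 0) w. \<phi> (X \<alpha>)) \<noteq> 0"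
        unfolding base_def by metis+
      then have "weight (filter (\<lambda>\<alpha>. \<pi> \<alpha> > 0) w) \<ge> 0"
        by (intro weight_pos_part) simp_all
      then show False
        using weight_partition[of w] less.prems(2) unfolding k by linarith
    qed
    then show ?thesis using True by (simp add: L_sorted)
  next
    case False
    then obtain u \<alpha> \<beta> v where w: "w = u @ \<alpha> # \<beta> # v" "\<beta> < \<alpha>" using unsorted_descent by metis
    have 1: "L M (u @ \<beta> # \<alpha> # v) = 0"
      by (rule less.IH) (use w less.prems in \<open>auto simp: word_less_iff inversions_swap\<close>)
    have 2: "L M (u @ (\<alpha> + \<beta>) # v) = 0"
      by (rule less.IH) (use w less.prems top_pos deg_add[of \<alpha> \<beta>] in \<open>auto simp: word_less_iff\<close>)
    \<comment> \<open>The central term drops two letters of total weight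
      \<open>2 * \<pi> top - \<pi> (\<alpha> + \<beta>)\<close>, which is positive in the only case
      where a remainder occurs.\<close>
    have 3: "L (add_mset (rem (bracket (X \<alpha>) (X \<beta>))) M) (u @ v) = 0" if "\<not> \<pi> (\<alpha> + \<beta>) > 0"
      by (rule less.IH)
        (use w less.prems top_pos deg_add[of \<alpha> \<beta>] that rem_in in \<open>auto simp: word_less_iff\<close>)
    show ?thesis
      using L_swap_graded[OF less.prems(1), of u \<alpha> \<beta> v] 1 2 3 by (simp add: w)
  qed
qed

text \<open>At or below the weight of \<open>k\<close>, the terms produced by a swap are strictly
  lighter than \<open>k\<close> and vanish; there \<open>L\<close> depends only on the multiset of
  letters, as on a symmetric algebra.\<close>

lemma L_permute:
  assumes M: "set_mset M \<subseteq> Zs" and "weight w \<le> weight k" "mset w = mset w'"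
  shows "L M w = L M w'"
proof -
  have sort: "L M w = L M (sort w)" if "weight w \<le> weight k" for w
  proof (rule sort_invariantI)
    fix u \<alpha> \<beta> v assume w: "mset (u @ \<alpha> # \<beta> # v) = mset w"
    have "weight (u @ \<alpha> # \<beta> # v) = weight w"
      using arg_cong[OF w, of "\<lambda>M. sum_mset (image_mset (\<lambda>\<alpha>. \<pi> top - \<pi> \<alpha>) M)"]
      unfolding weight_def by (metis mset_map sum_mset_sum_list)
    then have "L M (u @ (\<alpha> + \<beta>) # v) = 0"
      "\<not> \<pi> (\<alpha> + \<beta>) > 0 \<Longrightarrow> L (add_mset (rem (bracket (X \<alpha>) (X \<beta>))) M) (u @ v) = 0"
      using that top_pos deg_add[of \<alpha> \<beta>] M rem_in by (auto intro!: L_low_weight)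
    then show "L M (u @ \<alpha> # \<beta> # v) = L M (u @ \<beta> # \<alpha> # v)"
      using L_swap_graded[OF M, of u \<alpha> \<beta> v] by simp
  qed
  have "weight w' = weight w"
    using arg_cong[OF assms(3), of "\<lambda>M. sum_mset (image_mset (\<lambda>\<alpha>. \<pi> top - \<pi> \<alpha>) M)"]
    unfolding weight_def by (metis mset_map sum_mset_sum_list)
  moreover have "sort w = sort w'" using assms(3) by (metis mset_sort properties_for_sort sorted_sort)
  ultimately show ?thesis using sort[of w] sort[of w'] assms(2) by simp
qed

text \<open>The Leibniz rule for the bracket of a letter with a word; the central remainder of each
  bracket is a separate summand.\<close>

lemma L_commute_through:
  assumes M: "set_mset M \<subseteq> Zs"
  shows "L M (u @ \<eta> # w) - L M (u @ w @ [\<eta>]) =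
    (\<Sum>i<length w. sc \<eta> (w ! i) * L M (u @ take i w @ (\<eta> + w ! i) # drop (Suc i) w) +
      (if \<pi> (\<eta> + w ! i) > 0 then 0
       else L (add_mset (rem (bracket (X \<eta>) (X (w ! i)))) M) (u @ take i w @ drop (Suc i) w)))"
proof (induction w arbitrary: u)
  case (Cons \<beta> w)
  show ?case
    using Cons.IH[of "u @ [\<beta>]"] L_swap_graded[OF M, of u \<eta> \<beta> w]
    by (simp only: length_Cons sum.lessThan_Suc_shift nth_Cons_0 nth_Cons_Suc take_0 take_Suc_Cons
        drop_Suc_Cons drop_0 append_Nil append_Cons append_assoc) simp
qed simp

end

text \<open>\<open>\<beta> # k\<close> plays the role of the leading monomial and
  \<open>\<beta>\<close> is its least letter; the functional reads off the coefficient of what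
  remains when one \<open>\<beta>\<close> is removed.\<close>

locale whittaker_leading = whittaker_functional +
  fixes \<beta>
  assumes leading_sorted: "sorted (\<beta> # k)"
begin

lemma deg_eta: "\<pi> (top - \<beta>) = \<pi> top - \<pi> \<beta>"
  using deg_add[of "top - \<beta>" \<beta>] by simp

text \<open>Replacing a letter by its bracket with \<open>top - \<beta>\<close> lowers the weight by
  \<open>\<pi> top - \<pi> \<beta>\<close>, which is the weight of \<open>\<beta>\<close>, whichever
  letter it is. A central remainder requires a bracket of degree at most 0 and then lowers the
  weight by more. All terms thus fall below the weight of \<open>k\<close>.\<close>

lemma L_commutator_low:
  assumes M: "set_mset M \<subseteq> Zs" and w: "weight w < weight (\<beta> # k)"
  shows "L M ((top - \<beta>) # w) - L M (w @ [top - \<beta>]) = 0"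
proof -
  let ?\<eta> = "top - \<beta>"
  have "sc ?\<eta> (w ! i) * L M (take i w @ (?\<eta> + w ! i) # drop (Suc i) w) +
      (if \<pi> (?\<eta> + w ! i) > 0 then 0
       else L (add_mset (rem (bracket (X ?\<eta>) (X (w ! i)))) M) (take i w @ drop (Suc i) w)) = 0"
    if "i < length w" for i
  proof -
    have "weight w = weight (take i w @ w ! i # drop (Suc i) w)"
      using that by (simp only: id_take_nth_drop[symmetric])
    then have "L M (take i w @ (?\<eta> + w ! i) # drop (Suc i) w) = 0"
      "\<not> \<pi> (?\<eta> + w ! i) > 0 \<Longrightarrow>
        L (add_mset (rem (bracket (X ?\<eta>) (X (w ! i)))) M) (take i w @ drop (Suc i) w) = 0"
      using w M rem_in top_pos deg_add[of ?\<eta> "w ! i"] deg_eta by (auto intro!: L_low_weight)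
    then show ?thesis by simp
  qed
  then show ?thesis using L_commute_through[OF M, of "[]" ?\<eta> w] by (simp cong: if_cong)
qed

text \<open>The commutator terms have exactly the weight of \<open>k\<close>, so the new letter can
  be moved to the right end and evaluated by \<open>\<phi>\<close>. Only a new letter equal to
  \<open>top\<close> survives, that is, one coming from an occurrence of \<open>\<beta>\<close>. All
  occurrences contribute the same, and the cardinality counts them.\<close>

lemma L_commutator_top:
  assumes M: "set_mset M \<subseteq> Zs" and weight_w: "weight w = weight (\<beta> # k)"
    and w: "sorted w" "\<forall>\<alpha>\<in>set w. \<pi> \<alpha> \<le> 0" "\<forall>\<alpha>\<in>set w. \<beta> \<le> \<alpha>"
  shows "L M ((top - \<beta>) # w) - L M (w @ [top - \<beta>]) =
    (if w = \<beta> # k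
     then of_nat (card {i. i < length (\<beta> # k) \<and> (\<beta> # k) ! i = \<beta>}) *
       (sc (top - \<beta>) \<beta> * \<phi> (X top)) * \<Lambda> M
     else 0)"
proof -
  let ?\<eta> = "top - \<beta>"
  let ?m = "if w = \<beta> # k then sc ?\<eta> \<beta> * \<phi> (X top) * \<Lambda> M else 0"
  have each: "sc ?\<eta> (w ! i) * L M (take i w @ (?\<eta> + w ! i) # drop (Suc i) w) +
      (if \<pi> (?\<eta> + w ! i) > 0 then 0
       else L (add_mset (rem (bracket (X ?\<eta>) (X (w ! i)))) M) (take i w @ drop (Suc i) w)) =
      (if w ! i = \<beta> then ?m else 0)"
    if i: "i < length w" for i
  proof -
    let ?r = "take i w @ drop (Suc i) w"
    have split: "w = take i w @ w ! i # drop (Suc i) w" using i by (rule id_take_nth_drop)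
    have wt: "weight w = weight (take i w @ w ! i # drop (Suc i) w)" using split by simp
    have "\<beta> \<le> w ! i" using w(3) i by simp
    \<comment> \<open>Minimality of \<open>\<beta>\<close> enters here. It also excludes central
      remainders, since the bracket then has positive degree.\<close>
    then have ge: "top \<le> ?\<eta> + w ! i" by (simp add: algebra_simps)
    then have pos: "\<pi> (?\<eta> + w ! i) > 0" using deg_mono top_pos by (meson less_le_trans)
    have "L M (take i w @ (?\<eta> + w ! i) # drop (Suc i) w) = L M (?r @ [?\<eta> + w ! i])"
      using wt weight_w deg_add[of ?\<eta> "w ! i"] deg_eta by (intro L_permute[OF M]) auto
    also have "\<dots> = \<phi> (X (?\<eta> + w ! i)) * L M ?r"
      by (rule L_append_pos[OF pos M])
    finally have *: "L M (take i w @ (?\<eta> + w ! i) # drop (Suc i) w) =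
        \<phi> (X (?\<eta> + w ! i)) * L M ?r" .
    show ?thesis
    proof (cases "w ! i = \<beta>")
      case False
      then have "\<not> ?\<eta> + w ! i \<le> top" using ge by (auto simp: algebra_simps)
      then have "\<phi> (X (?\<eta> + w ! i)) = 0" using top_greatest[OF pos] by blast
      then show ?thesis using False pos * by simp
    next
      case True
      have sorted: "sorted ?r" using w(1) split by (metis sorted_append sorted_simps(2) list.set_intros(2))
      have "set ?r \<subseteq> set w" by (auto dest: in_set_takeD in_set_dropD)
      then have "\<forall>\<alpha>\<in>set ?r. \<pi> \<alpha> \<le> 0" using w(2) by blast
      then have filters: "filter (\<lambda>\<alpha>. \<pi> \<alpha> \<le> 0) ?r = ?r" "filter (\<lambda>\<alpha>. \<pi> \<alpha> > 0) ?r = []"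
        by (simp_all only: filter_id_conv filter_empty_conv not_less)
      have "base ?r = (if ?r = k then 1 else 0)" unfolding base_def filters by simp
      \<comment> \<open>Sorted words are determined by their multisets, and adding one
        \<open>\<beta>\<close> to both sides is reversible.\<close>
      moreover have "?r = k \<longleftrightarrow> w = \<beta> # k"
      proof
        assume "?r = k"
        moreover have "mset w = add_mset \<beta> (mset ?r)" by (subst split) (simp add: True)
        ultimately have "mset w = mset (\<beta> # k)" by simp
        then show "w = \<beta> # k" using w(1) leading_sorted by (metis properties_for_sort)
      next
        assume eq: "w = \<beta> # k"
        have "mset w = add_mset \<beta> (mset ?r)" by (subst split) (simp add: True)
        then have "mset ?r = mset k" using eq by simp
        then show "?r = k" using sorted leading_sorted by (metis properties_for_sort sorted_simps(2))
      qed
      ultimately show ?thesis using True pos * sorted by (simp add: L_sorted)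
    qed
  qed
  have "L M (?\<eta> # w) - L M (w @ [?\<eta>]) = (\<Sum>i<length w. if w ! i = \<beta> then ?m else 0)"
    using L_commute_through[OF M, of "[]" ?\<eta> w] each by (simp cong: if_cong)
  also have "\<dots> = (\<Sum>i | i < length w \<and> w ! i = \<beta>. ?m)"
    by (rule sum.mono_neutral_cong_right) auto
  also have "\<dots> = of_nat (card {i. i < length w \<and> w ! i = \<beta>}) * ?m" by simp
  finally show ?thesis by (simp add: mult.assoc)
qed

end

context whittaker_functional
begin

lemma E_central_prefix:
  "\<lbrakk>set zs \<subseteq> Zs\<rbrakk> \<Longrightarrow> E M u (zs @ xs) = E (mset zs + M) u xs"
  by (induction zs arbitrary: M) (simp_all add: lin_comb_central rem_central)

lemma E_basis:
  "\<lbrakk>set_mset M \<subseteq> Zs; set w \<subseteq> J\<rbrakk> \<Longrightarrow> E M u (map X w) = L M (u @ w)"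
  by (induction w arbitrary: u) (simp_all add: lin_comb_basis rem_basis E_rem_zero)

lemma functional_basis:
  assumes "q \<in> free_carrier Zs" "set w \<subseteq> J"
  shows "functional (q * mono_word 1 (map X w)) = lin_ext (\<lambda>zs. L (mset zs) w) q"
  unfolding functional_def lin_ext_mult_mono_right
  using assms by (auto intro!: lin_ext_cong simp: E_central_prefix E_basis)

text \<open>Elements of n have no remainder and only coordinates of positive degree, so the
  evaluation of a last letter extends to them by linearity.\<close>

lemma E_append_pos:
  assumes "n \<in> Np"
  shows "set_mset M \<subseteq> Zs \<Longrightarrow> E M u (xs @ [n]) = \<phi> n * E M u xs"
proof (induction xs arbitrary: M u)
  case Nil
  have "lin_comb n (\<lambda>\<gamma>. L M (u @ [\<gamma>])) = lin_comb n (\<lambda>\<gamma>. L M u * \<phi> (X \<gamma>))"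
    unfolding lin_comb_def
    using L_append_pos[OF pos_coord[OF assms] Nil] by (intro sum.cong) auto
  then show ?case
    using Nil by (simp add: pos_rem[OF assms] L_rem_zero lin_comb_fun_mult pos_char[OF assms])
next
  case (Cons x xs)
  then have "set_mset (add_mset (rem x) M) \<subseteq> Zs" using rem_in by simp
  with Cons show ?case by (simp add: lin_comb_fun_mult distrib_left)
qed

lemma functional_append_pos:
  assumes "n \<in> Np"
  shows "functional (p * mono_word 1 [n]) = \<phi> n * functional p"
  unfolding functional_def lin_ext_mult_mono_right
  using E_append_pos[OF assms, of "{#}"] by (simp add: lin_ext_fun_mult)

lemma lin_ext_lin_comb:
  "lin_ext (\<lambda>zs. lin_comb x (g zs)) q = lin_comb x (\<lambda>c. lin_ext (\<lambda>zs. g zs c) q)"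
  unfolding lin_ext_def lin_comb_def sum_distrib_left
  by (subst sum.swap) (simp add: mult.left_commute)

text \<open>By hypothesis \<open>\<Lambda>\<close> kills the product of \<open>q\<close> with every
  central monomial. Straightening adds elements to \<open>M\<close> but leaves those coming from
  \<open>q\<close> untouched, so the vanishing persists.\<close>

lemma functional_vanish:
  assumes q: "q \<in> free_carrier Zs"
    and vanish: "\<And>M. set_mset M \<subseteq> Zs \<Longrightarrow> lin_ext (\<lambda>zs. \<Lambda> (mset zs + M)) q = 0"
  shows "functional (q * p) = 0"
proof -
  have L: "set_mset M \<subseteq> Zs \<Longrightarrow> lin_ext (\<lambda>zs. L (mset zs + M) w) q = 0" for M w
  proof (induction w arbitrary: M rule: word_induct)
    case (less w)
    show ?case
    proof (cases "sorted w")
      case True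
      then show ?thesis
        using lin_ext_fun_mult[of "base w" "\<lambda>zs. \<Lambda> (mset zs + M)" q] vanish[OF less.prems]
        by (simp add: L_sorted mult.commute)
    next
      case False
      then obtain u a b v where w: "w = u @ a # b # v" "b < a"
        "\<And>M. L M w = L M (u @ b # a # v) + L1 M u (bracket (X a) (X b)) v"
        using L_unsorted by metis
      let ?r = "rem (bracket (X a) (X b))"
      have "lin_ext (\<lambda>zs. L (mset zs + M) (u @ b # a # v)) q = 0"
        by (rule less.IH) (use w less.prems in \<open>auto simp: word_less_iff inversions_swap\<close>)
      moreover have "lin_ext (\<lambda>zs. L (mset zs + M) (u @ c # v)) q = 0" for c
        by (rule less.IH) (use w less.prems in \<open>auto simp: word_less_iff\<close>)
      moreover have "lin_ext (\<lambda>zs. L (mset zs + add_mset ?r M) (u @ v)) q = 0"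
        by (rule less.IH) (use w less.prems rem_in in \<open>auto simp: word_less_iff\<close>)
      ultimately show ?thesis
        by (simp add: w(3) L1_def lin_ext_fun_add lin_ext_lin_comb) (simp add: lin_comb_def)
    qed
  qed
  have E: "set_mset M \<subseteq> Zs \<Longrightarrow> lin_ext (\<lambda>zs. E (mset zs + M) u xs) q = 0" for M u xs
  proof (induction xs arbitrary: M u)
    case (Cons x xs)
    have "lin_ext (\<lambda>zs. E (add_mset (rem x) (mset zs + M)) u xs) q = 0"
      using Cons.IH[of "add_mset (rem x) M" u] Cons.prems rem_in by simp
    with Cons show ?case
      by (simp add: lin_ext_fun_add lin_ext_lin_comb) (simp add: lin_comb_def)
  qed (simp add: L)
  have "lin_ext (\<lambda>zs. E {#} [] (zs @ xs)) q = lin_ext (\<lambda>zs. E (mset zs + {#}) [] xs) q" for xs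
    using q by (rule lin_ext_cong) (simp add: E_central_prefix)
  then have "functional (q * mono_word c xs) = 0" for c xs
    using E[of "{#}" "[]" xs] by (simp add: functional_def lin_ext_mult_mono_right)
  then show ?thesis
    by (induction p rule: nc_poly_induct) (simp_all add: distrib_left functional_def lin_ext_add)
qed

end


section \<open>Quotient modules\<close>

text \<open>Each scalar is only asked to act additively, so the same facts serve both quotients that
  follow, by the tensor relators and by I M.\<close>

locale additive_action = abelian_group M
  for M :: "('r, 'm, 'z) module_scheme" (structure) +
  fixes acts :: "'r set"
  assumes smult_closed: "\<lbrakk>r \<in> acts; x \<in> carrier M\<rbrakk> \<Longrightarrow> r \<odot> x \<in> carrier M"
    and smult_add: "\<lbrakk>r \<in> acts; x \<in> carrier M; y \<in> carrier M\<rbrakk> \<Longrightarrow> r \<odot> (x \<oplus> y) = r \<odot> x \<oplus> r \<odot> y"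
begin

lemma smult_zero: "r \<in> acts \<Longrightarrow> r \<odot> \<zero> = \<zero>"
  using smult_add[of r \<zero> \<zero>] smult_closed[of r \<zero>] by (metis add.l_cancel_one zero_closed l_zero)

lemma smult_inv: "\<lbrakk>r \<in> acts; x \<in> carrier M\<rbrakk> \<Longrightarrow> r \<odot> (\<ominus> x) = \<ominus> (r \<odot> x)"
  using smult_add[of r "\<ominus> x" x] smult_zero[of r] smult_closed[of r]
  by (metis a_inv_closed l_neg minus_equality)

lemma additive_subgroup_generate:
  "S \<subseteq> carrier M \<Longrightarrow> additive_subgroup (generate (add_monoid M) S) M"
  by (rule additive_subgroup.intro, rule add.generate_is_subgroup) simp

lemma generate_stable:
  assumes S: "S \<subseteq> carrier M" and r: "r \<in> acts"
    and stable: "\<And>s. s \<in> S \<Longrightarrow> r \<odot> s \<in> generate (add_monoid M) S"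
    and x: "x \<in> generate (add_monoid M) S"
  shows "r \<odot> x \<in> generate (add_monoid M) S"
proof -
  interpret N: additive_subgroup "generate (add_monoid M) S" M
    by (rule additive_subgroup_generate[OF S])
  show ?thesis
    using x
  proof (induction x rule: generate.induct)
    case one
    then show ?case using smult_zero[OF r] by simp
  next
    case (inv h)
    then have "r \<odot> (\<ominus> h) = \<ominus> (r \<odot> h)" using smult_inv r S by blast
    then show ?case using stable[OF inv] by (simp add: a_inv_def[symmetric])
  next
    case (eng x y)
    then have "r \<odot> (x \<oplus> y) = r \<odot> x \<oplus> r \<odot> y"
      using smult_add r N.a_subset by blast
    then show ?case using eng by simp
  qed (use stable in simp)
qed

end

locale quotient_action = additive_action M acts + additive_subgroup N M
  for M :: "('r, 'm, 'z) module_scheme" (structure) and acts and N +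
  assumes stable: "\<lbrakk>r \<in> acts; x \<in> N\<rbrakk> \<Longrightarrow> r \<odot> x \<in> N"
begin

sublocale abelian_subgroup N M
  by (rule abelian_subgroupI3) (unfold_locales)

abbreviation Q where "Q \<equiv> quotient_module M N"

lemma Q_simps: "zero Q = N" "add Q = set_add M" "carrier Q = a_rcosets N"
  by (simp_all add: quotient_module_def)

lemma carrier_Q: "carrier Q = (\<lambda>x. N +> x) ` carrier M"
  by (auto simp: Q_simps A_RCOSETS_def')

lemma coset_eq_iff:
  assumes "x \<in> carrier M" "y \<in> carrier M"
  shows "N +> x = N +> y \<longleftrightarrow> x \<oplus> \<ominus> y \<in> N"
proof -
  have "N +> x = N +> y \<longleftrightarrow> x \<in> N +> y"
    using a_repr_independence'[of x y] a_rcos_self[of x] assms by auto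
  then show ?thesis using a_rcos_module assms by simp
qed

lemma coset_add: "\<lbrakk>x \<in> carrier M; y \<in> carrier M\<rbrakk> \<Longrightarrow> (N +> x) \<oplus>\<^bsub>Q\<^esub> (N +> y) = N +> (x \<oplus> y)"
  by (simp add: Q_simps a_rcos_sum)

lemma coset_zero: "N +> \<zero> = \<zero>\<^bsub>Q\<^esub>"
  by (simp add: Q_simps a_rcos_const)

lemma abelian_group_Q: "abelian_group Q"
proof (rule abelian_groupI)
  fix Y assume "Y \<in> carrier Q"
  then obtain x where x: "x \<in> carrier M" "Y = N +> x" by (auto simp: carrier_Q)
  then have "N +> (\<ominus> x) \<in> carrier Q" "(N +> (\<ominus> x)) \<oplus>\<^bsub>Q\<^esub> Y = \<zero>\<^bsub>Q\<^esub>"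
    using coset_add[of "\<ominus> x" x] by (auto simp: carrier_Q l_neg coset_zero)
  then show "\<exists>Y' \<in> carrier Q. Y' \<oplus>\<^bsub>Q\<^esub> Y = \<zero>\<^bsub>Q\<^esub>" by blast
qed (auto simp: carrier_Q coset_zero[symmetric] coset_add a_ac)

lemma coset_inv: "x \<in> carrier M \<Longrightarrow> N +> (\<ominus> x) = \<ominus>\<^bsub>Q\<^esub> (N +> x)"
  using coset_add[of "\<ominus> x" x] coset_zero
  by (intro abelian_group.minus_equality[OF abelian_group_Q, symmetric]) (auto simp: carrier_Q l_neg)

text \<open>The product with a coset is a union over its representatives; stability of
  \<open>N\<close> makes all members of the union equal.\<close>

lemma coset_smult:
  assumes r: "r \<in> acts" and x: "x \<in> carrier M"
  shows "r \<odot>\<^bsub>Q\<^esub> (N +> x) = N +> (r \<odot> x)"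
proof -
  have eq: "N +> (r \<odot> y) = N +> (r \<odot> x)" if y: "y \<in> N +> x" for y
  proof -
    have yc: "y \<in> carrier M" using a_elemrcos_carrier x y by blast
    have "r \<odot> (y \<oplus> \<ominus> x) \<in> N"
      using stable[OF r] a_rcos_module_imp[OF x y] by blast
    then have "r \<odot> y \<oplus> \<ominus> (r \<odot> x) \<in> N"
      using smult_add smult_inv r x yc by simp
    then show ?thesis using coset_eq_iff smult_closed r x yc by simp
  qed
  have "r \<odot>\<^bsub>Q\<^esub> (N +> x) = (\<Union>y\<in>N +> x. N +> (r \<odot> y))" by (simp add: quotient_module_def)
  also have "\<dots> = (\<Union>y\<in>N +> x. N +> (r \<odot> x))" by (intro SUP_cong refl) (rule eq)
  also have "\<dots> = N +> (r \<odot> x)" using a_rcos_self[OF x] by blast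
  finally show ?thesis .
qed

lemma additive_action_Q: "additive_action Q acts"
  by (intro additive_action.intro additive_action_axioms.intro abelian_group_Q)
    (auto simp: carrier_Q coset_smult coset_add smult_add smult_closed)

text \<open>Membership in a subgroup generated in the quotient is pulled back to \<open>M\<close>.
  This turns V, a quotient of a quotient, into a single quotient of the group of pairs.\<close>

lemma coset_generate_iff:
  assumes S: "S \<subseteq> carrier M" and c: "c \<in> carrier M"
  shows "N +> c \<in> generate (add_monoid Q) ((\<lambda>s. N +> s) ` S) \<longleftrightarrow>
    c \<in> generate (add_monoid M) (N \<union> S)"
    (is "_ \<in> ?GQ \<longleftrightarrow> _ \<in> ?G")
proof -
  interpret Q: abelian_group Q by (rule abelian_group_Q)
  have NS: "N \<union> S \<subseteq> carrier M" using S a_subset by blast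
  interpret G: additive_subgroup ?G M by (rule additive_subgroup_generate[OF NS])
  have GQ: "additive_subgroup ?GQ Q"
    by (rule additive_subgroup.intro, rule Q.add.generate_is_subgroup) (use S in \<open>auto simp: carrier_Q\<close>)
  interpret GQ: additive_subgroup ?GQ Q by (rule GQ)
  have "\<exists>c \<in> ?G. Y = N +> c" if "Y \<in> ?GQ" for Y
    using that
  proof (induction Y rule: generate.induct)
    case one
    show ?case using coset_zero G.zero_closed by (intro bexI[of _ \<zero>]) simp_all
  next
    case (incl h)
    then show ?case by (auto intro: generate.incl)
  next
    case (inv h)
    then obtain s where s: "s \<in> S" "h = N +> s" by blast
    then have "inv\<^bsub>add_monoid Q\<^esub> h = N +> (\<ominus> s)" using coset_inv[of s] S by (auto simp: a_inv_def)
    moreover have "\<ominus> s \<in> ?G" 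
      using G.a_inv_closed[of s] s generate.incl[of s "N \<union> S"] by auto
    ultimately show ?case by blast
  next
    case (eng Y1 Y2)
    then obtain c1 c2 where c: "c1 \<in> ?G" "Y1 = N +> c1" "c2 \<in> ?G" "Y2 = N +> c2" by blast
    then have "Y1 \<otimes>\<^bsub>add_monoid Q\<^esub> Y2 = N +> (c1 \<oplus> c2)" using coset_add[of c1 c2] by simp
    moreover have "c1 \<oplus> c2 \<in> ?G" using c by simp
    ultimately show ?case by blast
  qed
  moreover have "N +> c \<in> ?GQ" if "c \<in> ?G" for c
    using that
  proof (induction c rule: generate.induct)
    case one
    show ?case using coset_zero GQ.zero_closed by simp
  next
    case (incl h)
    then show ?case
    proof
      assume "h \<in> N"
      then show ?thesis using a_rcos_const[of h] GQ.zero_closed by (simp add: Q_simps)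
    next
      assume "h \<in> S"
      then show ?thesis by (auto intro: generate.incl)
    qed
  next
    case (inv h)
    then have h: "h \<in> carrier M" "N +> h \<in> ?GQ"
      using NS a_rcos_const[of h] GQ.zero_closed by (auto intro: generate.incl simp: Q_simps)
    then show ?case using coset_inv[of h] GQ.a_inv_closed[of "N +> h"] by (simp add: a_inv_def)
  next
    case (eng x y)
    then have "x \<in> carrier M" "y \<in> carrier M" using G.a_subset by auto
    then show ?case using coset_add[of x y] eng GQ.a_closed by fastforce
  qed
  moreover have "c \<in> ?G" if "c' \<in> ?G" "N +> c = N +> c'" for c'
  proof -
    have c': "c' \<in> carrier M" using that by simp
    have "c \<oplus> \<ominus> c' \<in> N" using coset_eq_iff[OF c c'] that by simp
    then have "c \<oplus> \<ominus> c' \<in> ?G" by (auto intro: generate.incl)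
    then have "(c \<oplus> \<ominus> c') \<oplus> c' \<in> ?G" using that(1) by (rule G.a_closed)
    moreover have "(c \<oplus> \<ominus> c') \<oplus> c' = c" using c c' by (simp add: a_assoc l_neg)
    ultimately show ?thesis by simp
  qed
  ultimately show ?thesis by blast
qed

end


section \<open>The free abelian group of pairs\<close>

lemma pairs_module_simps:
  "carrier (pairs_module S N) = {c. Poly_Mapping.keys c \<subseteq> carrier S \<times> carrier N}"
  "zero (pairs_module S N) = 0" "add (pairs_module S N) = (+)"
  "smult (pairs_module S N) = (\<lambda>s. frag_extend (\<lambda>(t, n). frag_of (s \<otimes>\<^bsub>S\<^esub> t, n)))"
  by (simp_all add: pairs_module_def)

lemma abelian_group_pairs: "abelian_group (pairs_module S N)"
proof (rule abelian_groupI)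
  fix c assume "c \<in> carrier (pairs_module S N)"
  then show "\<exists>d \<in> carrier (pairs_module S N). d \<oplus>\<^bsub>pairs_module S N\<^esub> c = \<zero>\<^bsub>pairs_module S N\<^esub>"
    by (intro bexI[of _ "- c"]) (simp_all add: pairs_module_simps)
next
  fix c d assume "c \<in> carrier (pairs_module S N)" "d \<in> carrier (pairs_module S N)"
  then show "c \<oplus>\<^bsub>pairs_module S N\<^esub> d \<in> carrier (pairs_module S N)"
    using Poly_Mapping.keys_add[of c d] by (auto simp: pairs_module_simps)
qed (simp_all add: pairs_module_simps add.assoc add.commute)

lemma pairs_inv:
  "c \<in> carrier (pairs_module S N) \<Longrightarrow> \<ominus>\<^bsub>pairs_module S N\<^esub> c = - c"
  by (rule abelian_group.minus_equality[OF abelian_group_pairs]) (simp_all add: pairs_module_simps)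

lemma (in ring) additive_action_pairs: "additive_action (pairs_module R N) (carrier R)"
proof (intro additive_action.intro additive_action_axioms.intro abelian_group_pairs)
  fix s c assume s: "s \<in> carrier R" and c: "c \<in> carrier (pairs_module R N)"
  have "Poly_Mapping.keys (frag_extend (\<lambda>(t, n). frag_of (s \<otimes> t, n)) c) \<subseteq>
      (\<Union>x\<in>Poly_Mapping.keys c. Poly_Mapping.keys ((\<lambda>(t, n). frag_of (s \<otimes> t, n)) x))"
    by (rule keys_frag_extend)
  also have "\<dots> \<subseteq> carrier R \<times> carrier N"
    using c s by (auto simp: pairs_module_simps)
  finally show "s \<odot>\<^bsub>pairs_module R N\<^esub> c \<in> carrier (pairs_module R N)"
    by (simp add: pairs_module_simps)
qed (simp add: pairs_module_simps frag_extend_add)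


section \<open>Cosets in U(g)\<close>

abbreviation cls :: "'g::lie_algebra nc_poly \<Rightarrow> 'g nc_poly set" where
  "cls p \<equiv> env_ker +>\<^bsub>free_algebra UNIV\<^esub> p"

lemma coset_free: "I +>\<^bsub>free_algebra H\<^esub> p = (\<lambda>e. e + p) ` I"
  by (auto simp: a_r_coset_def')

interpretation U: ring "env_algebra (UNIV :: 'g::lie_algebra set)"
  unfolding env_algebra_def by (rule ideal.quotient_is_ring[OF ideal_env_ker])

lemma env_algebra_UNIV:
  "carrier (env_algebra UNIV) = range cls"
  "cls p \<otimes>\<^bsub>env_algebra UNIV\<^esub> cls q = cls (p * q)"
  "cls p \<oplus>\<^bsub>env_algebra UNIV\<^esub> cls q = cls (p + q)"
  "\<one>\<^bsub>env_algebra UNIV\<^esub> = cls 1"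
proof -
  interpret ideal env_ker "free_algebra UNIV" by (rule ideal_env_ker)
  show "carrier (env_algebra UNIV) = range cls"
    "cls p \<otimes>\<^bsub>env_algebra UNIV\<^esub> cls q = cls (p * q)"
    "cls p \<oplus>\<^bsub>env_algebra UNIV\<^esub> cls q = cls (p + q)"
    "\<one>\<^bsub>env_algebra UNIV\<^esub> = cls 1"
    using rcoset_mult_add[of p q] a_rcos_sum[of p q]
    by (auto simp: env_algebra_def FactRing_def A_RCOSETS_def')
qed

lemma cls_eq_iff: "cls p = cls q \<longleftrightarrow> p - q \<in> env_ker"
proof
  interpret env: ideal env_ker "free_algebra UNIV" by (rule ideal_env_ker)
  assume "cls p = cls q"
  then have "p \<in> cls q" using env.a_rcos_self[of p] by simp
  then obtain e where "e \<in> env_ker" "p = e + q" by (auto simp: coset_free)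
  then show "p - q \<in> env_ker" by simp
next
  interpret env: ideal env_ker "free_algebra UNIV" by (rule ideal_env_ker)
  assume "p - q \<in> env_ker"
  then have "p \<in> cls q" by (auto simp: coset_free intro!: image_eqI[of _ _ "p - q"])
  then show "cls p = cls q" using env.a_repr_independence'[of p q] by simp
qed

text \<open>Adding \<open>env_ker\<close> absorbs the smaller ideal, so the coset keeps its
  representative.\<close>

lemma to_env_coset:
  assumes "0 \<in> I" "I \<subseteq> env_ker"
  shows "to_env (I +>\<^bsub>free_algebra H\<^esub> p) = cls p"
proof -
  have "to_env (I +>\<^bsub>free_algebra H\<^esub> p) = {e + (i + p) | e i. e \<in> env_ker \<and> i \<in> I}"
    by (auto simp: to_env_def set_add_def' coset_free)
  also have "\<dots> = cls p"
  proof (intro equalityI subsetI)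
    fix x assume "x \<in> {e + (i + p) | e i. e \<in> env_ker \<and> i \<in> I}"
    then obtain e i where "x = (e + i) + p" "e \<in> env_ker" "i \<in> I" by (auto simp: add.assoc)
    then show "x \<in> cls p" using assms(2) env_kerD(3)[of e i] by (auto simp: coset_free)
  next
    fix x assume "x \<in> cls p"
    then obtain e where "x = e + (0 + p)" "e \<in> env_ker" by (auto simp: coset_free)
    then show "x \<in> {e + (i + p) | e i. e \<in> env_ker \<and> i \<in> I}" using assms(1) by blast
  qed
  finally show ?thesis .
qed


section \<open>Quotients of the Whittaker module\<close>

definition frag_lift :: "('a \<Rightarrow> complex) \<Rightarrow> ('a \<Rightarrow>\<^sub>0 int) \<Rightarrow> complex" where
  "frag_lift t c = (\<Sum>x\<in>Poly_Mapping.keys c. of_int (Poly_Mapping.lookup c x) * t x)"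

lemma frag_lift_add: "frag_lift t (c + d) = frag_lift t c + frag_lift t d"
proof -
  let ?S = "Poly_Mapping.keys c \<union> Poly_Mapping.keys d"
  have super: "frag_lift t e = (\<Sum>x\<in>?S. of_int (Poly_Mapping.lookup e x) * t x)"
    if "Poly_Mapping.keys e \<subseteq> ?S" for e
    unfolding frag_lift_def using that
    by (intro sum.mono_neutral_left) (auto simp: in_keys_iff)
  show ?thesis
    using Poly_Mapping.keys_add[of c d]
    by (simp add: super lookup_add distrib_right sum.distrib)
qed

lemma frag_lift_of [simp]: "frag_lift t (frag_of x) = t x"
  by (simp add: frag_lift_def)

lemma frag_lift_zero [simp]: "frag_lift t 0 = 0"
  by (simp add: frag_lift_def)

lemma frag_lift_minus: "frag_lift t (- c) = - frag_lift t c"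
  using frag_lift_add[of t c "- c"] by (simp add: eq_neg_iff_add_eq_0 add.commute)

lemma frag_lift_diff: "frag_lift t (c - d) = frag_lift t c - frag_lift t d"
  using frag_lift_add[of t c "- d"] by (simp add: frag_lift_minus)

lemma pairs_subgroupD:
  assumes "additive_subgroup K (pairs_module S N)"
  shows "0 \<in> K" "\<lbrakk>c \<in> K; d \<in> K\<rbrakk> \<Longrightarrow> c + d \<in> K" "c \<in> K \<Longrightarrow> - c \<in> K" "\<lbrakk>c \<in> K; d \<in> K\<rbrakk> \<Longrightarrow> c - d \<in> K"
    "K \<subseteq> carrier (pairs_module S N)"
proof -
  interpret additive_subgroup K "pairs_module S N" by fact
  show "0 \<in> K" using zero_closed by (simp add: pairs_module_simps)
  show add: "c + d \<in> K" if "c \<in> K" "d \<in> K" for c d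
    using a_closed[OF that] by (simp add: pairs_module_simps)
  show neg: "- c \<in> K" if "c \<in> K" for c
    using additive_subgroup.a_inv_closed[OF assms that] pairs_inv[of c S N] that
    by simp
  show "c - d \<in> K" if "c \<in> K" "d \<in> K" using add[OF that(1) neg[OF that(2)]] by simp
  show "K \<subseteq> carrier (pairs_module S N)" by (rule a_subset)
qed


locale whittaker_quotient =
  fixes H :: "'g::lie_algebra set" and \<phi> :: "'g \<Rightarrow> complex" and Zs :: "'g set"
    and I :: "'g nc_poly set set"
  assumes H_subspace: "lie.subspace H"
    and H_bracket: "\<lbrakk>x \<in> H; y \<in> H\<rbrakk> \<Longrightarrow> bracket x y \<in> H"
    and character: "lie_character H \<phi>"
    and Z_subspace: "lie.subspace Zs"
    and Z_central: "Zs \<subseteq> lie_center"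
    and ideal_I: "ideal I (sym_algebra Zs)"
begin

abbreviation sym_ker :: "'g nc_poly set" where
  "sym_ker \<equiv> Idl\<^bsub>free_algebra Zs\<^esub> (linear_relators Zs \<union> comm_relators Zs)"

lemma ideal_sym_ker: "ideal sym_ker (free_algebra Zs)"
  by (rule ring.genideal_ideal[OF ring_free_algebra comm_relators_in_free[OF Z_subspace]])

text \<open>For central elements a commutation relator is a Lie relator with zero bracket; this is
  why S(Z'') acts on V through \<open>to_env\<close>.\<close>

lemma sym_ker_subset: "sym_ker \<subseteq> env_ker"
proof (rule genideal_free_mono[OF comm_relators_in_free[OF Z_subspace] _ ideal_env_ker])
  have "mono_word 1 [x, y] - mono_word 1 [y, x] \<in> env_ker" if "x \<in> Zs" for x y :: 'g
  proof -
    have "bracket x y = 0" using that Z_central by (auto intro: lie_center_bracket)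
    then show ?thesis
      using env_kerD(3)[OF env_ker_bracket[of 1 "[]" x y "[]"] env_ker_letter_zero[of 1 "[]" "[]"]]
      by simp
  qed
  moreover have "linear_relators Zs \<subseteq> env_ker"
  proof -
    have "linear_relators Zs \<subseteq> linear_relators UNIV" unfolding linear_relators_def by blast
    then show ?thesis using relators_in_env_ideal[of UNIV] by auto
  qed
  ultimately show "linear_relators Zs \<union> comm_relators Zs \<subseteq> env_ker"
    by (auto simp: comm_relators_def)
qed simp

text \<open>The elements of \<open>I\<close> are cosets, so their union is the preimage of I in the
  free algebra on \<open>Zs\<close>.\<close>

definition lifted_ideal :: "'g nc_poly set" where
  "lifted_ideal = \<Union> I"

lemma ideal_lifted: "ideal lifted_ideal (free_algebra Zs)"
  unfolding lifted_ideal_def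
  by (rule ring.quot_ideal_imp_ring_ideal[OF ring_free_algebra ideal_sym_ker])
    (use ideal_I in \<open>simp add: sym_algebra_def\<close>)

lemma coset_in_I:
  assumes "q \<in> lifted_ideal" shows "sym_ker +>\<^bsub>free_algebra Zs\<^esub> q \<in> I"
proof -
  have "I \<subseteq> carrier (free_algebra Zs Quot sym_ker)"
    using additive_subgroup.a_subset[OF ideal.axioms(1)[OF ideal_I]] by (simp add: sym_algebra_def)
  then show ?thesis
    using ring.canonical_proj_vimage_mem_iff[OF ring_free_algebra ideal_sym_ker, of I q]
      assms free_idealD(2)[OF ideal_lifted] by (auto simp: lifted_ideal_def)
qed

lemma relators_in_lifted: "linear_relators Zs \<union> comm_relators Zs \<subseteq> lifted_ideal"
proof -
  have "sym_ker \<in> I"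
    using additive_subgroup.zero_closed[OF ideal.axioms(1)[OF ideal_I]]
    by (simp add: sym_algebra_def FactRing_def)
  moreover have "linear_relators Zs \<union> comm_relators Zs \<subseteq> sym_ker"
    by (rule ring.genideal_self[OF ring_free_algebra comm_relators_in_free[OF Z_subspace]])
  ultimately show ?thesis by (auto simp: lifted_ideal_def)
qed

lemma carrier_sym_algebra:
  "carrier (sym_algebra Zs) = (\<lambda>q. sym_ker +>\<^bsub>free_algebra Zs\<^esub> q) ` free_carrier Zs"
  by (auto simp: sym_algebra_def FactRing_def A_RCOSETS_def')

lemma to_env_sym: "to_env (sym_ker +>\<^bsub>free_algebra Zs\<^esub> q) = cls q"
  by (rule to_env_coset[OF free_idealD(1)[OF ideal_sym_ker] sym_ker_subset])

lemma to_env_image_I: "to_env ` I = cls ` lifted_ideal"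
proof (intro equalityI subsetI)
  fix Y assume "Y \<in> to_env ` I"
  then obtain X where X: "X \<in> I" "Y = to_env X" by blast
  then have "X \<in> carrier (sym_algebra Zs)"
    using additive_subgroup.a_subset[OF ideal.axioms(1)[OF ideal_I]] by blast
  then obtain q where q: "X = sym_ker +>\<^bsub>free_algebra Zs\<^esub> q" by (auto simp: carrier_sym_algebra)
  have "q \<in> X" using free_idealD(1)[OF ideal_sym_ker] by (force simp: q coset_free)
  then show "Y \<in> cls ` lifted_ideal" using X q to_env_sym by (auto simp: lifted_ideal_def)
next
  fix Y assume "Y \<in> cls ` lifted_ideal"
  then obtain q where "q \<in> lifted_ideal" "Y = cls q" by blast
  then show "Y \<in> to_env ` I" using to_env_sym coset_in_I by (metis imageI)
qed


section \<open>The character as a module over U(n)\<close>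

lemma char_add: "\<lbrakk>x \<in> H; y \<in> H\<rbrakk> \<Longrightarrow> \<phi> (x + y) = \<phi> x + \<phi> y"
  and char_scale: "x \<in> H \<Longrightarrow> \<phi> (c *\<^sub>C x) = c * \<phi> x"
  and char_bracket: "\<lbrakk>x \<in> H; y \<in> H\<rbrakk> \<Longrightarrow> \<phi> (bracket x y) = 0"
  using character by (auto simp: lie_character_def)

text \<open>The algebra homomorphism from U(n) to the complex numbers that extends
  \<open>\<phi>\<close>, written on representatives.\<close>

definition ev :: "'g nc_poly \<Rightarrow> complex" where
  "ev = lin_ext (\<lambda>xs. \<Prod>x\<leftarrow>xs. \<phi> x)"

lemma word_act_ev: "word_act \<phi> p a = ev p * a"
proof -
  have "foldr (\<lambda>x b. \<phi> x * b) xs a = (\<Prod>x\<leftarrow>xs. \<phi> x) * a" for xs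
    by (induction xs) (simp_all add: mult.assoc)
  then show ?thesis by (simp add: word_act_def ev_def lin_ext_def sum_distrib_right mult.assoc)
qed

lemma ev_env_ideal: "p \<in> env_ideal H \<Longrightarrow> ev p = 0"
  unfolding ev_def
  by (rule lin_ext_env_ideal[OF H_subspace H_bracket])
    (auto simp: char_add char_scale char_bracket algebra_simps)

abbreviation EH where "EH \<equiv> env_algebra H"
abbreviation EU where "EU \<equiv> env_algebra (UNIV :: 'g set)"
abbreviation clsH where "clsH r \<equiv> env_ideal H +>\<^bsub>free_algebra H\<^esub> r"

lemma carrier_EH: "carrier EH = clsH ` free_carrier H"
  by (auto simp: env_algebra_def FactRing_def A_RCOSETS_def')

lemma ideal_EH: "ideal (env_ideal H) (free_algebra H)"
  by (rule ideal_env_ideal[OF H_subspace H_bracket])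

lemma to_env_clsH: "to_env (clsH r) = cls r"
  by (rule to_env_coset[OF free_idealD(1)[OF ideal_EH] env_ideal_subset[OF H_subspace H_bracket]])

lemma char_module_simps:
  "carrier (char_module \<phi>) = UNIV" "add (char_module \<phi>) = (+)"
  "clsH r \<odot>\<^bsub>char_module \<phi>\<^esub> a = ev r * a"
proof -
  have "(\<lambda>p. word_act \<phi> p a) ` clsH r = {ev r * a}"
    using free_idealD(1)[OF ideal_EH] ev_env_ideal
    by (auto simp: coset_free word_act_ev image_image ev_def lin_ext_add)
  then show "clsH r \<odot>\<^bsub>char_module \<phi>\<^esub> a = ev r * a" by (simp add: char_module_def)
qed (simp_all add: char_module_def)


section \<open>The tensor product and its quotient by I M, by generators and relators\<close>

abbreviation P where "P \<equiv> pairs_module EU (char_module \<phi>)"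
abbreviation Rel where "Rel \<equiv> tensor_relators EH EU to_env (char_module \<phi>)"
abbreviation K where "K \<equiv> tensor_kernel EH EU to_env (char_module \<phi>)"

lemma Rel_eq:
  "Rel = {frag_of (cls (s + t), n) - frag_of (cls s, n) - frag_of (cls t, n) | s t n. True} \<union>
    {frag_of (cls s, m + n) - frag_of (cls s, m) - frag_of (cls s, n) | s m n. True} \<union>
    {frag_of (cls (s * r), n) - frag_of (cls s, ev r * n) | s r n. r \<in> free_carrier H}"
proof -
  have "Rel = {frag_of (cls s \<oplus>\<^bsub>EU\<^esub> cls t, n) - frag_of (cls s, n) - frag_of (cls t, n) | s t n. True} \<union>
    {frag_of (cls s, m + n) - frag_of (cls s, m) - frag_of (cls s, n) | s m n. True} \<union>
    {frag_of (cls s \<otimes>\<^bsub>EU\<^esub> to_env (clsH r), n) - frag_of (cls s, clsH r \<odot>\<^bsub>char_module \<phi>\<^esub> n) | s r n.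
      r \<in> free_carrier H}"
    unfolding tensor_relators_def env_algebra_UNIV(1) carrier_EH char_module_simps(1,2)
    by (intro arg_cong2[of _ _ _ _ "(\<union>)"]) blast+
  then show ?thesis
    by (simp only: to_env_clsH env_algebra_UNIV(2,3) char_module_simps(3))
qed

lemma P_action: "additive_action P (carrier EU)"
  by (rule U.additive_action_pairs)

lemma P_frag: "frag_of (cls s, a) \<in> carrier P"
  by (simp add: pairs_module_simps env_algebra_UNIV char_module_simps)

lemma P_smult: "cls r \<odot>\<^bsub>P\<^esub> c = frag_extend (\<lambda>(t, n). frag_of (cls r \<otimes>\<^bsub>EU\<^esub> t, n)) c"
  by (simp add: pairs_module_simps)

lemma P_smult_frag [simp]: "cls r \<odot>\<^bsub>P\<^esub> frag_of (cls s, a) = frag_of (cls (r * s), a)"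
  by (simp add: P_smult env_algebra_UNIV)

lemma P_induct [consumes 1, case_names zero frag diff]:
  assumes "c \<in> carrier P" "Q 0" "\<And>s a. Q (frag_of (cls s, a))" "\<And>c d. \<lbrakk>Q c; Q d\<rbrakk> \<Longrightarrow> Q (c - d)"
  shows "Q c"
proof (rule frag_induction[of c "range cls \<times> UNIV" Q])
  show "Poly_Mapping.keys c \<subseteq> range cls \<times> UNIV"
    using assms(1) by (simp add: pairs_module_simps env_algebra_UNIV char_module_simps)
qed (use assms in auto)

lemma P_smult_diff: "cls r \<odot>\<^bsub>P\<^esub> (c - d) = cls r \<odot>\<^bsub>P\<^esub> c - cls r \<odot>\<^bsub>P\<^esub> d"
  by (simp add: P_smult frag_extend_diff)

lemma P_smult_mult: "c \<in> carrier P \<Longrightarrow> cls r \<odot>\<^bsub>P\<^esub> (cls s \<odot>\<^bsub>P\<^esub> c) = cls (r * s) \<odot>\<^bsub>P\<^esub> c"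
  by (induction c rule: P_induct)
    (simp_all add: P_smult_diff mult.assoc, simp add: P_smult)

lemma Rel_in_P: "Rel \<subseteq> carrier P"
proof -
  have "c - d \<in> carrier P" if "c \<in> carrier P" "d \<in> carrier P" for c d
    using that keys_diff[of c d] by (auto simp: pairs_module_simps)
  then show ?thesis unfolding Rel_eq using P_frag by blast
qed

lemma K_subgroup: "additive_subgroup K P"
  unfolding tensor_kernel_def
  by (rule additive_action.additive_subgroup_generate[OF P_action Rel_in_P])

lemma K_incl: "c \<in> Rel \<Longrightarrow> c \<in> K"
  unfolding tensor_kernel_def by (rule generate.incl)

lemma K_action: "quotient_action P (carrier EU) K"
proof (intro quotient_action.intro quotient_action_axioms.intro P_action K_subgroup)
  fix u c assume u: "u \<in> carrier EU" and c: "c \<in> K"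
  then obtain r where r: "u = cls r" by (auto simp: env_algebra_UNIV)
  have "cls r \<odot>\<^bsub>P\<^esub> s \<in> Rel" if "s \<in> Rel" for s
    using that unfolding Rel_eq
    by (auto simp: P_smult_diff distrib_left mult.assoc[symmetric]; blast)
  then show "u \<odot>\<^bsub>P\<^esub> c \<in> K"
    using additive_action.generate_stable[OF P_action Rel_in_P, of u c] u c K_incl
    unfolding tensor_kernel_def r by blast
qed

definition M where "M = whittaker_module H \<phi>"
definition IM where "IM = set_times_module (to_env ` I) M"
definition V where "V = quotient_module M IM"
definition w' where "w' = IM +>\<^bsub>M\<^esub> whittaker_generator H \<phi>"

lemma M_eq: "M = quotient_module P K"
  by (simp add: M_def whittaker_module_def tensor_module_def)

lemma M_action: "additive_action M (carrier EU)"
  unfolding M_eq by (rule quotient_action.additive_action_Q[OF K_action])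

abbreviation cM where "cM c \<equiv> K +>\<^bsub>P\<^esub> c"

text \<open>Generators of I M, before the tensor relators are divided out.\<close>

definition S where "S = (\<lambda>(q, c). cls q \<odot>\<^bsub>P\<^esub> c) ` (lifted_ideal \<times> carrier P)"

lemma cls_in_EU: "cls p \<in> carrier EU"
  by (simp add: env_algebra_UNIV)

lemma S_in_P: "S \<subseteq> carrier P"
  unfolding S_def using additive_action.smult_closed[OF P_action cls_in_EU] by auto

lemma carrier_M: "carrier M = cM ` carrier P"
  unfolding M_eq by (rule quotient_action.carrier_Q[OF K_action])

lemma M_smult: "c \<in> carrier P \<Longrightarrow> cls r \<odot>\<^bsub>M\<^esub> cM c = cM (cls r \<odot>\<^bsub>P\<^esub> c)"
  unfolding M_eq by (rule quotient_action.coset_smult[OF K_action cls_in_EU])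

lemma IM_eq: "IM = generate (add_monoid M) (cM ` S)"
proof -
  have "{r \<odot>\<^bsub>M\<^esub> m | r m. r \<in> to_env ` I \<and> m \<in> carrier M} =
      (\<lambda>(q, c). cls q \<odot>\<^bsub>M\<^esub> cM c) ` (lifted_ideal \<times> carrier P)"
    unfolding to_env_image_I carrier_M by (auto simp: image_iff Bex_def)
  also have "\<dots> = (\<lambda>(q, c). cM (cls q \<odot>\<^bsub>P\<^esub> c)) ` (lifted_ideal \<times> carrier P)"
    by (rule image_cong) (auto simp: M_smult)
  also have "\<dots> = cM ` S" unfolding S_def image_image by (rule image_cong) auto
  finally show ?thesis by (simp add: IM_def set_times_module_def)
qed

text \<open>An element of I is central in U(g), so \<open>r\<close> moves past it onto the other
  factor; hence I M is a submodule.\<close>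

lemma S_stable:
  assumes "s \<in> S" shows "cls r \<odot>\<^bsub>P\<^esub> s \<in> S"
proof -
  obtain q c where s: "s = cls q \<odot>\<^bsub>P\<^esub> c" "q \<in> lifted_ideal" "c \<in> carrier P"
    using assms by (auto simp: S_def)
  have "cls (r * q) = cls (q * r)"
    using env_ker_central[OF _ Z_central, of q r] s(2) free_idealD(2)[OF ideal_lifted]
    by (auto simp: cls_eq_iff)
  then have "cls r \<odot>\<^bsub>P\<^esub> s = cls q \<odot>\<^bsub>P\<^esub> (cls r \<odot>\<^bsub>P\<^esub> c)"
    using s by (simp add: P_smult_mult)
  then show ?thesis
    unfolding S_def using s additive_action.smult_closed[OF P_action cls_in_EU, of c r]
    by (auto intro!: image_eqI[of _ _ "(q, cls r \<odot>\<^bsub>P\<^esub> c)"])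
qed

lemma cM_S_in_M: "cM ` S \<subseteq> carrier M"
  using S_in_P by (auto simp: carrier_M)

lemma IM_action: "quotient_action M (carrier EU) IM"
proof (intro quotient_action.intro quotient_action_axioms.intro M_action)
  show "additive_subgroup IM M"
    unfolding IM_eq by (rule additive_action.additive_subgroup_generate[OF M_action cM_S_in_M])
  fix u c assume u: "u \<in> carrier EU" and c: "c \<in> IM"
  then obtain r where r: "u = cls r" by (auto simp: env_algebra_UNIV)
  have "cls r \<odot>\<^bsub>M\<^esub> m \<in> cM ` S" if "m \<in> cM ` S" for m
    using that S_stable M_smult S_in_P by auto
  then show "u \<odot>\<^bsub>M\<^esub> c \<in> IM"
    using additive_action.generate_stable[OF M_action cM_S_in_M, of u c] u c
    unfolding IM_eq r by (blast intro: generate.incl)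
qed

text \<open>The kernel of the composed projection \<open>\<Theta>\<close> from pairs to V, as
  \<open>\<Theta>_eq_iff\<close> shows.\<close>

definition K2 where "K2 = generate (add_monoid P) (K \<union> S)"

lemma KS_in_P: "K \<union> S \<subseteq> carrier P"
  using S_in_P additive_subgroup.a_subset[OF K_subgroup] by blast

lemma K2_subgroup: "additive_subgroup K2 P"
  unfolding K2_def by (rule additive_action.additive_subgroup_generate[OF P_action KS_in_P])

lemmas K2D = pairs_subgroupD[OF K2_subgroup]

lemma K2_incl: "c \<in> K \<Longrightarrow> c \<in> K2" "c \<in> S \<Longrightarrow> c \<in> K2"
  unfolding K2_def by (auto intro: generate.incl)

lemma K2_stable:
  assumes "c \<in> K2" shows "cls r \<odot>\<^bsub>P\<^esub> c \<in> K2"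
  unfolding K2_def
proof (rule additive_action.generate_stable[OF P_action KS_in_P cls_in_EU])
  fix s assume "s \<in> K \<union> S"
  then have "cls r \<odot>\<^bsub>P\<^esub> s \<in> K \<union> S"
    using S_stable quotient_action.stable[OF K_action cls_in_EU] by blast
  then show "cls r \<odot>\<^bsub>P\<^esub> s \<in> generate (add_monoid P) (K \<union> S)" by (rule generate.incl)
qed (use assms K2_def in simp)

definition \<Theta> where "\<Theta> c = IM +>\<^bsub>M\<^esub> cM c"

lemma carrier_V: "carrier V = \<Theta> ` carrier P"
  unfolding V_def \<Theta>_def[abs_def] quotient_action.carrier_Q[OF IM_action] carrier_M
  by (rule image_image)

lemma \<Theta>_smult: "c \<in> carrier P \<Longrightarrow> cls r \<odot>\<^bsub>V\<^esub> \<Theta> c = \<Theta> (cls r \<odot>\<^bsub>P\<^esub> c)"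
  unfolding V_def \<Theta>_def
  using quotient_action.coset_smult[OF IM_action cls_in_EU, of "cM c" r] M_smult[of c r]
  by (simp add: carrier_M)

lemma \<Theta>_eq_iff:
  assumes c: "c \<in> carrier P" and d: "d \<in> carrier P"
  shows "\<Theta> c = \<Theta> d \<longleftrightarrow> c - d \<in> K2"
proof -
  have cd: "c \<oplus>\<^bsub>P\<^esub> \<ominus>\<^bsub>P\<^esub> d = c - d"
    unfolding pairs_inv[OF d] by (simp add: pairs_module_simps)
  have d': "\<ominus>\<^bsub>P\<^esub> d \<in> carrier P"
    using d by (rule abelian_group.a_inv_closed[OF abelian_group_pairs])
  have cd': "c - d \<in> carrier P"
    using abelian_monoid.a_closed[OF abelian_group.axioms(1)[OF abelian_group_pairs] c d'] cd by metis
  have "\<Theta> c = \<Theta> d \<longleftrightarrow> cM c \<oplus>\<^bsub>M\<^esub> \<ominus>\<^bsub>M\<^esub> cM d \<in> IM"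
    unfolding \<Theta>_def
    by (rule quotient_action.coset_eq_iff[OF IM_action]) (use c d in \<open>auto simp: carrier_M\<close>)
  also have "cM c \<oplus>\<^bsub>M\<^esub> \<ominus>\<^bsub>M\<^esub> cM d = cM (c - d)"
    unfolding M_eq quotient_action.coset_inv[OF K_action d, symmetric]
      quotient_action.coset_add[OF K_action c d'] cd ..
  also have "cM (c - d) \<in> IM \<longleftrightarrow> c - d \<in> K2"
    unfolding IM_eq K2_def M_eq
    by (rule quotient_action.coset_generate_iff[OF K_action S_in_P cd'])
  finally show ?thesis .
qed

definition fr :: "'g nc_poly \<Rightarrow> ('g nc_poly set \<times> complex) \<Rightarrow>\<^sub>0 int" where
  "fr p = frag_of (cls p, 1)"

definition \<Psi> :: "'g nc_poly \<Rightarrow> 'g whittaker_elem set" where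
  "\<Psi> p = cls p \<odot>\<^bsub>V\<^esub> w'"

lemma \<Psi>_eq: "\<Psi> p = \<Theta> (fr p)"
proof -
  have "w' = \<Theta> (frag_of (cls 1, 1))"
    by (simp add: w'_def \<Theta>_def whittaker_generator_def pure_tensor_def env_algebra_UNIV)
  then show ?thesis using \<Theta>_smult[OF P_frag] by (simp add: \<Psi>_def fr_def)
qed

lemma fr_in_P: "fr p \<in> carrier P"
  unfolding fr_def by (rule P_frag)

lemma smult_\<Psi>: "cls r \<odot>\<^bsub>V\<^esub> \<Psi> p = \<Psi> (r * p)"
  using \<Theta>_smult[OF fr_in_P] by (simp add: \<Psi>_eq fr_def)

text \<open>The left ideal of polynomials that annihilate w'. By \<open>\<Psi>_eq_iff\<close>,
  equality in V is congruence modulo it, so computations in V become computations in the free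
  algebra.\<close>

definition ann :: "'g nc_poly set" where
  "ann = {p. fr p \<in> K2}"

lemma fr_add: "fr (p + q) - fr p - fr q \<in> K"
  unfolding fr_def by (rule K_incl) (unfold Rel_eq, blast)

lemma fr_ev: "r \<in> free_carrier H \<Longrightarrow> frag_of (cls (s * r), n) - frag_of (cls s, ev r * n) \<in> K"
  by (rule K_incl) (unfold Rel_eq, blast)

lemmas KD = pairs_subgroupD[OF K_subgroup]

lemma fr_zero: "fr 0 \<in> K"
  using KD(3)[OF fr_add[of 0 0]] by simp

lemma fr_diff: "fr p - fr q - fr (p - q) \<in> K"
  using fr_add[of "p - q" q] by (simp add: algebra_simps)

lemma \<Psi>_eq_iff: "\<Psi> p = \<Psi> q \<longleftrightarrow> p - q \<in> ann"
proof -
  have *: "fr p - fr q - fr (p - q) \<in> K2" using fr_diff K2_incl by blast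
  have "\<Psi> p = \<Psi> q \<longleftrightarrow> fr p - fr q \<in> K2"
    unfolding \<Psi>_eq using \<Theta>_eq_iff fr_in_P by blast
  also have "\<dots> \<longleftrightarrow> fr (p - q) \<in> K2"
    using K2D(4)[OF _ *, of "fr p - fr q"] K2D(2)[OF *, of "fr (p - q)"] by auto
  finally show ?thesis by (simp add: ann_def)
qed

lemma ann_zero: "0 \<in> ann"
  using fr_zero K2_incl by (auto simp: ann_def)

lemma ann_diff: "\<lbrakk>p \<in> ann; q \<in> ann\<rbrakk> \<Longrightarrow> p - q \<in> ann"
  using K2D(4)[OF K2D(4)[of "fr p" "fr q"] K2_incl(1)[OF fr_diff[of p q]]] by (simp add: ann_def)

lemma ann_uminus: "p \<in> ann \<Longrightarrow> - p \<in> ann"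
  using ann_diff[OF ann_zero, of p] by simp

lemma ann_add: "\<lbrakk>p \<in> ann; q \<in> ann\<rbrakk> \<Longrightarrow> p + q \<in> ann"
  using ann_diff[OF _ ann_uminus, of p q] by simp

lemma ann_mult: "p \<in> ann \<Longrightarrow> r * p \<in> ann"
  using K2_stable[of "fr p" r] by (simp add: ann_def fr_def)

lemma ann_env_ker: "p \<in> env_ker \<Longrightarrow> p \<in> ann"
  using cls_eq_iff[of p 0] fr_zero K2_incl by (auto simp: ann_def fr_def)

lemma ev_mono: "ev (mono_word c xs) = c * (\<Prod>x\<leftarrow>xs. \<phi> x)"
  by (simp add: ev_def lin_ext_mono)

lemma ann_char: "n \<in> H \<Longrightarrow> mono_word 1 [n] - mono_word (\<phi> n) [] \<in> ann"
proof -
  assume n: "n \<in> H"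
  have "fr (mono_word 1 [n]) - frag_of (cls 1, \<phi> n) \<in> K"
    "fr (mono_word (\<phi> n) []) - frag_of (cls 1, \<phi> n) \<in> K"
    using fr_ev[of "mono_word 1 [n]" 1 1] fr_ev[of "mono_word (\<phi> n) []" 1 1] n
    by (simp_all add: mono_word_in_free ev_mono fr_def)
  then have "fr (mono_word 1 [n]) - fr (mono_word (\<phi> n) []) \<in> K"
    using KD(4) by fastforce
  from KD(4)[OF this fr_diff[of "mono_word 1 [n]" "mono_word (\<phi> n) []"]] have "fr (mono_word 1 [n] - mono_word (\<phi> n) []) \<in> K" by simp
  then show ?thesis using K2_incl by (simp add: ann_def)
qed

lemma ann_lifted: "q \<in> lifted_ideal \<Longrightarrow> q * p \<in> ann"
  using P_smult_frag[of q p 1] fr_in_P[of p] K2_incl(2)[of "fr (q * p)"]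
  unfolding ann_def S_def fr_def by (force intro: image_eqI[of _ _ "(q, frag_of (cls p, 1))"])

text \<open>The vector w' generates V: the complex number in a pair crosses the tensor sign as a
  constant of U(n).\<close>

lemma \<Psi>_surj:
  assumes "v \<in> carrier V" obtains p where "v = \<Psi> p"
proof -
  obtain c where c: "c \<in> carrier P" "v = \<Theta> c" using assms by (auto simp: carrier_V)
  from c(1) have "\<exists>p. c - fr p \<in> K"
  proof (induction c rule: P_induct)
    case zero
    show ?case using KD(3)[OF fr_zero] by (intro exI[of _ 0]) simp
  next
    case (frag s a)
    have "fr (s * mono_word a []) - frag_of (cls s, a) \<in> K"
      using fr_ev[of "mono_word a []" s 1] by (simp add: mono_word_in_free ev_mono fr_def)
    from KD(3)[OF this] show ?case by auto
  next
    case (diff c d)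
    then obtain p q where "c - fr p \<in> K" "d - fr q \<in> K" by blast
    from KD(2)[OF KD(4)[OF this] fr_diff[of p q]] show ?case
      by (intro exI[of _ "p - q"]) (simp add: algebra_simps)
  qed
  then obtain p where "c - fr p \<in> K2" using K2_incl by blast
  then show ?thesis using that c \<Theta>_eq_iff fr_in_P \<Psi>_eq by metis
qed

lemma sym_action:
  assumes "q \<in> free_carrier Zs"
  shows "\<exists>p \<in> carrier (sym_algebra Zs). \<Psi> q = to_env p \<odot>\<^bsub>V\<^esub> w'"
  using assms by (auto simp: carrier_sym_algebra to_env_sym \<Psi>_def)

text \<open>The hypotheses let \<open>f\<close> induce a functional on V: sending the pair of s and
  a to a f(s) is well defined on cosets and kills the tensor relators and the generators of I
  M.\<close>

lemma ann_functional:
  assumes add: "\<And>p q. f (p + q) = f p + f q"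
    and env: "\<And>p. p \<in> env_ker \<Longrightarrow> f p = 0"
    and scale: "\<And>p c. f (p * mono_word c []) = c * f p"
    and char: "\<And>p n. n \<in> H \<Longrightarrow> f (p * mono_word 1 [n]) = \<phi> n * f p"
    and vanish: "\<And>p q. q \<in> lifted_ideal \<Longrightarrow> f (q * p) = 0"
    and p: "p \<in> ann"
  shows "f p = 0"
proof -
  have f0: "f 0 = 0" using add[of 0 0] by simp
  have f_word: "f (p * mono_word c xs) = c * (\<Prod>x\<leftarrow>xs. \<phi> x) * f p" if "set xs \<subseteq> H" for p c xs
    using that
  proof (induction xs rule: rev_induct)
    case (snoc n xs)
    have "p * mono_word c (xs @ [n]) = (p * mono_word c xs) * mono_word 1 [n]"
      by (simp add: mult.assoc mono_word_mult)
    then show ?case using snoc char[of n "p * mono_word c xs"] by simp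
  qed (simp add: scale)
  have f_ev: "f (s * r) = ev r * f s" if "r \<in> free_carrier H" for s r
    using that
    by (induction r rule: free_algebra_induct)
      (simp_all add: f0 f_word ev_mono distrib_left distrib_right add, simp_all add: ev_def lin_ext_add distrib_right)
  \<comment> \<open>The choice of a representative is immaterial, since \<open>f\<close> is additive
    and kills \<open>env_ker\<close>.\<close>
  define t where "t = (\<lambda>(X, a). a * f (SOME p. p \<in> X))"
  have t: "t (cls s, a) = a * f s" for s a
  proof -
    have "s \<in> cls s" using env_kerD(1) by (force simp: coset_free)
    then have "(SOME p. p \<in> cls s) \<in> cls s" by (rule someI)
    then obtain e where "e \<in> env_ker" "(SOME p. p \<in> cls s) = e + s" by (auto simp: coset_free)
    then show ?thesis by (simp add: t_def add env)
  qed
  have T_Rel: "frag_lift t c = 0" if "c \<in> Rel" for c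
    using that unfolding Rel_eq
    by (elim UnE CollectE exE conjE)
      (simp_all add: frag_lift_diff t add f_ev distrib_left distrib_right mult_ac)
  have T_K: "frag_lift t c = 0" if "c \<in> K" for c
    using that unfolding tensor_kernel_def
  proof (induction c rule: generate.induct)
    case (inv h)
    then have "\<ominus>\<^bsub>P\<^esub> h = - h" using Rel_in_P by (intro pairs_inv) blast
    then show ?case using T_Rel[OF inv] by (simp add: a_inv_def[symmetric] frag_lift_minus)
  qed (simp_all add: T_Rel pairs_module_simps frag_lift_add)
  have T_S: "frag_lift t c = 0" if "c \<in> S" for c
  proof -
    obtain q d where c: "c = cls q \<odot>\<^bsub>P\<^esub> d" "q \<in> lifted_ideal" "d \<in> carrier P"
      using \<open>c \<in> S\<close> by (auto simp: S_def)
    from c(3) have "frag_lift t (cls q \<odot>\<^bsub>P\<^esub> d) = 0"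
      by (induction d rule: P_induct)
        (simp_all add: P_smult_diff frag_lift_diff t vanish[OF c(2)], simp add: P_smult)
    then show ?thesis using c by simp
  qed
  have "frag_lift t c = 0" if "c \<in> K2" for c
    using that unfolding K2_def
  proof (induction c rule: generate.induct)
    case (inv h)
    then have "\<ominus>\<^bsub>P\<^esub> h = - h" using KS_in_P by (intro pairs_inv) blast
    then show ?case using inv T_K T_S by (auto simp: a_inv_def[symmetric] frag_lift_minus)
  qed (use T_K T_S in \<open>auto simp: pairs_module_simps frag_lift_add\<close>)
  from this[of "fr p"] show ?thesis using p by (simp add: ann_def fr_def t)
qed

end


section \<open>Leading terms of Whittaker vectors\<close>

interpretation nc: vector_space "\<lambda>c (p :: 'g nc_poly). mono_word c [] * p"
  by unfold_locales
    (simp_all add: distrib_left distrib_right mono_word_add mono_word_one mono_word_mult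
      flip: mult.assoc)

interpretation nc_complex: vector_space_pair "\<lambda>c (p :: 'g nc_poly). mono_word c [] * p"
  "(*) :: complex \<Rightarrow> complex \<Rightarrow> complex"
  by unfold_locales (simp_all add: algebra_simps)

text \<open>A basis of \<open>W\<close> together with \<open>q\<close> is independent, so a linear
  map can be prescribed to be 1 at \<open>q\<close> and 0 on that basis.\<close>

lemma separating_functional:
  assumes "nc.subspace W" "q \<notin> W"
  obtains h :: "'g nc_poly \<Rightarrow> complex" where
    "\<And>p p'. h (p + p') = h p + h p'" "\<And>c p. h (mono_word c [] * p) = c * h p"
    "\<And>p. p \<in> W \<Longrightarrow> h p = 0" "h q \<noteq> 0"
proof -
  obtain B where B: "B \<subseteq> W" "nc.independent B" "W \<subseteq> nc.span B"
    using nc.maximal_independent_subset by metis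
  then have W: "nc.span B = W" using assms(1) nc.span_minimal by blast
  then have "nc.independent (insert q B)"
    using assms(2) B(2) nc.independent_insertI by metis
  then obtain g where g: "Vector_Spaces.linear (\<lambda>c p. mono_word c [] * p) (*) g"
    "\<forall>x\<in>insert q B. g x = (if x = q then 1 else 0)"
    using nc_complex.linear_independent_extend[of "insert q B" "\<lambda>x. if x = q then 1 else 0"]
    by blast
  interpret g: Vector_Spaces.linear "\<lambda>c p. mono_word c [] * p" "(*)" g by (rule g(1))
  have "g p = 0" if "p \<in> W" for p
  proof (rule nc_complex.linear_eq_0_on_span[OF g(1), of B])
    show "g b = 0" if "b \<in> B" for b using g(2) that B(1) assms(2) by auto
  qed (use that W in simp)
  moreover have "g q \<noteq> 0" using g(2) by simp
  ultimately show ?thesis using that[of g] g.add g.scale by blast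
qed

lemma lin_ext_linear:
  assumes "\<And>p p'. h (p + p') = h p + h p'" "\<And>c p. h (mono_word c [] * p) = c * h p"
  shows "lin_ext (\<lambda>w. h (mono_word 1 w)) p = h p"
proof (induction p rule: nc_poly_induct)
  case zero
  show ?case using assms(1)[of 0 0] by simp
next
  case (mono c w)
  show ?case using assms(2)[of c "mono_word 1 w"] by (simp add: lin_ext_mono mono_word_mult)
qed (simp add: lin_ext_add assms(1))

context whittaker_quotient
begin

lemmas lifted = free_idealD[OF ideal_lifted]

lemma lifted_move:
  "\<lbrakk>set u \<subseteq> Zs; z \<in> Zs; set v \<subseteq> Zs\<rbrakk> \<Longrightarrow>
    mono_word 1 (u @ z # v) - mono_word 1 (z # u @ v) \<in> lifted_ideal"
proof (induction u)
  case Nil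
  show ?case using lifted(1) by simp
next
  case (Cons a u)
  have "mono_word 1 [a] * (mono_word 1 (u @ z # v) - mono_word 1 (z # u @ v)) \<in> lifted_ideal"
    using Cons by (intro lifted(6) mono_word_in_free) auto
  moreover have "mono_word 1 [a, z] - mono_word 1 [z, a] \<in> lifted_ideal"
  proof -
    have "mono_word 1 [a, z] - mono_word 1 [z, a] \<in> comm_relators Zs"
      using Cons.prems by (auto simp: comm_relators_def)
    then show ?thesis using relators_in_lifted by blast
  qed
  then have "(mono_word 1 [a, z] - mono_word 1 [z, a]) * mono_word 1 (u @ v) \<in> lifted_ideal"
    using Cons.prems by (intro lifted(7) mono_word_in_free) auto
  ultimately show ?case
    using lifted(3) by (fastforce simp: left_diff_distrib right_diff_distrib mono_word_mult)
qed

text \<open>Modulo \<open>lifted_ideal\<close> words in \<open>Zs\<close> commute. A functional that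
  kills this ideal therefore depends only on the multiset of a word, which is the form required of
  \<open>\<Lambda>\<close>.\<close>

lemma lifted_permute:
  "\<lbrakk>mset zs = mset zs'; set zs \<subseteq> Zs\<rbrakk> \<Longrightarrow> mono_word 1 zs - mono_word 1 zs' \<in> lifted_ideal"
proof (induction zs arbitrary: zs')
  case Nil
  then show ?case using lifted(1) by simp
next
  case (Cons z zs)
  then have "z \<in> set zs'" by (metis list.set_intros(1) set_mset_mset)
  then obtain u v where zs': "zs' = u @ z # v" by (meson split_list)
  have m: "mset zs = mset (u @ v)" using Cons.prems(1) zs' by simp
  have "set zs' = set (z # zs)" using Cons.prems(1) by (metis set_mset_mset)
  then have sub: "set u \<subseteq> Zs" "z \<in> Zs" "set v \<subseteq> Zs" using Cons.prems(2) zs' by auto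
  have "mono_word 1 [z] * (mono_word 1 zs - mono_word 1 (u @ v)) \<in> lifted_ideal"
    using Cons.IH[OF m] Cons.prems(2) sub by (intro lifted(6) mono_word_in_free) auto
  from lifted(5)[OF this lifted_move[OF sub]] show ?case
    by (simp add: right_diff_distrib mono_word_mult zs')
qed

end


locale whittaker_setting =
  whittaker_frame X \<xi> Zs J \<pi> Np \<phi> top + mod: whittaker_quotient Np \<phi> Zs I
  for X :: "'q::linordered_ab_group_add \<Rightarrow> 'g::lie_algebra" and \<xi> :: "'g \<Rightarrow> 'q \<Rightarrow> complex"
    and Zs :: "'g set" and J :: "'q set" and \<pi> :: "'q \<Rightarrow> int" and Np :: "'g set"
    and \<phi> :: "'g \<Rightarrow> complex" and top :: 'q and I :: "'g nc_poly set set" +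
  assumes X_outside: "\<alpha> \<notin> J \<Longrightarrow> X \<alpha> = 0"
    and X_pos: "\<pi> \<alpha> > 0 \<Longrightarrow> X \<alpha> \<in> Np"
    and nondegenerate: "\<lbrakk>\<beta> \<in> J; \<pi> \<beta> \<le> 0\<rbrakk> \<Longrightarrow> sc (top - \<beta>) \<beta> * \<phi> (X top) \<noteq> 0"
begin

abbreviation xword :: "'q list \<Rightarrow> 'g nc_poly" where
  "xword w \<equiv> mono_word 1 (map X w)"

definition standard :: "'q list set" where
  "standard = {w. sorted w \<and> set w \<subseteq> J \<and> (\<forall>\<alpha>\<in>set w. \<pi> \<alpha> \<le> 0)}"

definition spanned :: "'g nc_poly \<Rightarrow> bool" where
  "spanned p \<longleftrightarrow> (\<exists>T q. finite T \<and> T \<subseteq> standard \<and> (\<forall>k. q k \<in> free_carrier Zs) \<and>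
     p - (\<Sum>k\<in>T. q k * xword k) \<in> mod.ann)"

lemma spanned_ann: "p \<in> mod.ann \<Longrightarrow> spanned p"
  unfolding spanned_def by (rule exI[of _ "{}"]) (auto intro!: exI[of _ "\<lambda>_. 0"])

lemma spanned_add:
  assumes "spanned p" "spanned p'" shows "spanned (p + p')"
proof -
  obtain T q where 1: "finite T" "T \<subseteq> standard" "\<And>k. q k \<in> free_carrier Zs"
    "p - (\<Sum>k\<in>T. q k * xword k) \<in> mod.ann" using assms(1) by (auto simp: spanned_def)
  obtain T' q' where 2: "finite T'" "T' \<subseteq> standard" "\<And>k. q' k \<in> free_carrier Zs"
    "p' - (\<Sum>k\<in>T'. q' k * xword k) \<in> mod.ann" using assms(2) by (auto simp: spanned_def)
  let ?q = "\<lambda>k. (if k \<in> T then q k else 0) + (if k \<in> T' then q' k else 0)"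
  have "(\<Sum>k\<in>T. q k * xword k) = (\<Sum>k\<in>T \<union> T'. (if k \<in> T then q k else 0) * xword k)"
    using 1 2 by (intro sum.mono_neutral_cong_left) auto
  moreover have "(\<Sum>k\<in>T'. q' k * xword k) = (\<Sum>k\<in>T \<union> T'. (if k \<in> T' then q' k else 0) * xword k)"
    using 1 2 by (intro sum.mono_neutral_cong_left) auto
  ultimately have "(\<Sum>k\<in>T \<union> T'. ?q k * xword k) = (\<Sum>k\<in>T. q k * xword k) + (\<Sum>k\<in>T'. q' k * xword k)"
    by (simp only: distrib_right sum.distrib)
  then have "p + p' - (\<Sum>k\<in>T \<union> T'. ?q k * xword k) \<in> mod.ann"
    using mod.ann_add[OF 1(4) 2(4)] by (simp only: add_diff_add)
  moreover have "\<forall>k. ?q k \<in> free_carrier Zs" using 1 2 by (simp add: add_in_free)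
  ultimately show ?thesis
    unfolding spanned_def using 1 2
    by (intro exI[of _ "T \<union> T'"] exI[of _ ?q]) simp
qed

lemma spanned_cong: "\<lbrakk>spanned p'; p - p' \<in> mod.ann\<rbrakk> \<Longrightarrow> spanned p"
  using spanned_add[of p' "p - p'"] spanned_ann by simp

lemma spanned_mult:
  assumes "r \<in> free_carrier Zs" "spanned p" shows "spanned (r * p)"
proof -
  obtain T q where 1: "finite T" "T \<subseteq> standard" "\<And>k. q k \<in> free_carrier Zs"
    "p - (\<Sum>k\<in>T. q k * xword k) \<in> mod.ann" using assms(2) by (auto simp: spanned_def)
  have "r * p - (\<Sum>k\<in>T. (r * q k) * xword k) \<in> mod.ann"
    using mod.ann_mult[OF 1(4), of r] by (simp add: right_diff_distrib sum_distrib_left mult.assoc)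
  then show ?thesis
    unfolding spanned_def using 1 assms(1)
    by (intro exI[of _ T] exI[of _ "\<lambda>k. r * q k"]) (simp add: mult_in_free)
qed

lemma spanned_sum: "(\<And>i. i \<in> T \<Longrightarrow> spanned (f i)) \<Longrightarrow> spanned (\<Sum>i\<in>T. f i)"
  by (induction T rule: infinite_finite_induct)
    (auto intro: spanned_add spanned_ann mod.ann_zero)

lemma env_ker_letter_sum:
  "mono_word 1 (u @ (\<Sum>i\<in>T. f i) # v) - (\<Sum>i\<in>T. mono_word 1 (u @ f i # v)) \<in> env_ker"
proof (induction T rule: infinite_finite_induct)
  case (insert i T)
  from env_kerD(3)[OF env_ker_letter_add[of 1 u "f i" "\<Sum>i\<in>T. f i" v] insert.IH]
  show ?case using insert by (simp add: algebra_simps)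
qed (simp_all add: env_ker_letter_zero)

text \<open>The coordinates become letters, and the central remainder moves to the front, where it
  acts as a coefficient from S(Zs).\<close>

lemma env_ker_expand:
  "mono_word 1 (u @ x # v) -
    ((\<Sum>c | \<xi> x c \<noteq> 0. mono_word (\<xi> x c) [] * mono_word 1 (u @ X c # v)) +
     mono_word 1 [rem x] * mono_word 1 (u @ v)) \<in> env_ker"
proof -
  let ?s = "\<Sum>c | \<xi> x c \<noteq> 0. \<xi> x c *\<^sub>C X c"
  have x: "x = rem x + ?s" by (simp add: rem_def)
  have 1: "mono_word 1 (u @ x # v) - mono_word 1 (u @ rem x # v) - mono_word 1 (u @ ?s # v) \<in> env_ker"
    using env_ker_letter_add[of 1 u "rem x" ?s v] x by simp
  have 2: "mono_word 1 (u @ ?s # v) - (\<Sum>c | \<xi> x c \<noteq> 0. mono_word 1 (u @ (\<xi> x c *\<^sub>C X c) # v)) \<in> env_ker"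
    by (rule env_ker_letter_sum)
  have "(\<Sum>c\<in>T. mono_word 1 (u @ (\<xi> x c *\<^sub>C X c) # v)) -
      (\<Sum>c\<in>T. mono_word (\<xi> x c) [] * mono_word 1 (u @ X c # v)) \<in> env_ker" for T
  proof (induction T rule: infinite_finite_induct)
    case (insert c T)
    from env_kerD(3)[OF env_ker_letter_scale[of 1 u "\<xi> x c" "X c" v] insert.IH]
    show ?case using insert by (simp add: mono_word_mult algebra_simps)
  qed (simp_all add: env_kerD)
  note 3 = this[of "{c. \<xi> x c \<noteq> 0}"]
  have "(mono_word 1 u * mono_word 1 [rem x] - mono_word 1 [rem x] * mono_word 1 u) * mono_word 1 v
      \<in> env_ker"
    by (intro env_kerD(7) env_ker_center) (use rem_in Z_central in auto)
  then have 4: "mono_word 1 (u @ rem x # v) - mono_word 1 [rem x] * mono_word 1 (u @ v) \<in> env_ker"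
    by (simp add: left_diff_distrib mono_word_mult)
  from env_kerD(3)[OF env_kerD(3)[OF env_kerD(3)[OF 1 2] 3] 4]
  show ?thesis by (simp add: algebra_simps)
qed

lemma spanned_expand:
  assumes "\<And>c. spanned (mono_word 1 (u @ X c # v))" "spanned (mono_word 1 (u @ v))"
  shows "spanned (mono_word 1 (u @ x # v))"
  by (rule spanned_cong[OF _ mod.ann_env_ker[OF env_ker_expand]])
    (intro spanned_add spanned_sum spanned_mult assms mono_word_in_free, auto simp: rem_in)

text \<open>The spanning half of the Poincare-Birkhoff-Witt theorem, on V. A word that is not
  standard has a descent, has a zero letter, or else ends in a letter of positive degree, which acts
  on w' by \<open>\<phi>\<close>.\<close>

lemma spanned_xword: "spanned (xword w)"
proof (induction w rule: word_induct)
  case (less w)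
  consider (unsorted) "\<not> sorted w" | (outside) "\<not> set w \<subseteq> J"
    | (pos) u \<nu> where "w = u @ [\<nu>]" "\<pi> \<nu> > 0"
    | (standard) "sorted w" "set w \<subseteq> J" "w = [] \<or> \<not> \<pi> (last w) > 0"
    by (metis append_butlast_last_id)
  then show ?case
  proof cases
    case unsorted
    then obtain u a b v where w: "w = u @ a # b # v" "b < a" using unsorted_descent by metis
    have "spanned (mono_word 1 (map X u @ bracket (X a) (X b) # map X v))"
    proof (rule spanned_expand)
      show "spanned (mono_word 1 (map X u @ X c # map X v))" for c
        using less[of "u @ c # v"] w by (simp add: word_less_iff)
      show "spanned (mono_word 1 (map X u @ map X v))"
        using less[of "u @ v"] w by (simp add: word_less_iff)
    qed
    moreover have "spanned (xword (u @ b # a # v))"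
      by (rule less) (use w in \<open>simp add: word_less_iff inversions_swap\<close>)
    ultimately have "spanned (xword (u @ b # a # v) +
        mono_word 1 (map X u @ bracket (X a) (X b) # map X v))"
      by (intro spanned_add)
    then show ?thesis
      by (rule spanned_cong)
        (use mod.ann_env_ker[OF env_ker_bracket[of 1 "map X u" "X a" "X b" "map X v"]] w in
          \<open>simp add: algebra_simps\<close>)
  next
    case outside
    then obtain \<alpha> u v where "w = u @ \<alpha> # v" "X \<alpha> = 0"
      using X_outside by (meson split_list subsetI)
    then show ?thesis
      using env_ker_letter_zero[of 1 "map X u" "map X v"] by (auto intro!: spanned_ann mod.ann_env_ker)
  next
    case pos
    have "spanned (mono_word (\<phi> (X \<nu>)) [] * xword u)"
      by (intro spanned_mult mono_word_in_free less) (use pos in \<open>auto simp: word_less_iff\<close>)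
    moreover have "xword w - mono_word (\<phi> (X \<nu>)) [] * xword u \<in> mod.ann"
      using mod.ann_mult[OF mod.ann_char[OF X_pos[OF pos(2)]], of "xword u"]
      by (simp add: pos right_diff_distrib mono_word_mult)
    ultimately show ?thesis by (rule spanned_cong)
  next
    case standard
    have "\<pi> \<alpha> \<le> 0" if "\<alpha> \<in> set w" for \<alpha>
    proof -
      obtain u \<beta> where w: "w = u @ [\<beta>]" using \<open>\<alpha> \<in> set w\<close> by (cases w rule: rev_cases) auto
      then have "\<alpha> \<le> \<beta>" using standard(1) that by (auto simp: sorted_append)
      then show ?thesis using standard(3) deg_mono[of \<alpha> \<beta>] w by simp
    qed
    then have "w \<in> standard" using standard by (simp add: standard_def)
    then show ?thesis
      unfolding spanned_def
      by (intro exI[of _ "{w}"] exI[of _ "\<lambda>_. 1"]) (simp add: mod.ann_zero)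
  qed
qed

lemma spanned_all: "spanned p"
proof (induction p rule: nc_poly_induct)
  case (mono c xs)
  \<comment> \<open>Elements are expanded from the right, so that everything behind the current one
    is already a word of letters.\<close>
  have "spanned (mono_word 1 (xs @ map X w))" for w
  proof (induction xs arbitrary: w rule: rev_induct)
    case Nil
    show ?case using spanned_xword by simp
  next
    case (snoc x xs)
    have "spanned (mono_word 1 (xs @ X c # map X w))" for c
      using snoc[of "c # w"] by simp
    then show ?case using spanned_expand[of xs "map X w" x] snoc by simp
  qed
  from spanned_mult[OF mono_word_in_free[of "[]" Zs c] this[of "[]"]]
  show ?case by (simp add: mono_word_mult)
qed (auto intro: spanned_add spanned_ann mod.ann_zero)

lemma weight_pos: "\<lbrakk>\<forall>\<alpha>\<in>set w. \<pi> \<alpha> \<le> 0; w \<noteq> []\<rbrakk> \<Longrightarrow> weight w > 0"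
proof (induction w)
  case (Cons \<alpha> w)
  then show ?case using top_pos by (cases "w = []") auto
qed simp

definition whittaker :: "'g nc_poly \<Rightarrow> bool" where
  "whittaker p \<longleftrightarrow> (\<forall>n\<in>Np. (mono_word 1 [n] - mono_word (\<phi> n) []) * p \<in> mod.ann)"

lemma whittaker_cong: "\<lbrakk>whittaker p; p - p' \<in> mod.ann\<rbrakk> \<Longrightarrow> whittaker p'"
  unfolding whittaker_def
proof (intro ballI)
  fix n assume *: "\<forall>n\<in>Np. (mono_word 1 [n] - mono_word (\<phi> n) []) * p \<in> mod.ann"
    "p - p' \<in> mod.ann" "n \<in> Np"
  let ?d = "mono_word 1 [n] - mono_word (\<phi> n) []"
  have "?d * p - ?d * (p - p') \<in> mod.ann" 
    using mod.ann_diff[OF _ mod.ann_mult[OF *(2)]] *(1,3) by blast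
  then show "?d * p' \<in> mod.ann" by (simp add: right_diff_distrib)
qed

text \<open>If the leading coefficient \<open>q k1\<close> were outside \<open>lifted_ideal\<close>,
  a functional \<open>h\<close> separating it from that ideal would induce one on V. Its value on
  (x_\<eta> - \<phi>(x_\<eta>)) v is a nonzero multiple of \<open>h (q k1)\<close>, although this
  vector is zero.\<close>

lemma leading_coefficient:
  assumes T: "finite T" "T \<subseteq> standard" "\<not> T \<subseteq> {[]}"
    and q: "\<And>k. q k \<in> free_carrier Zs"
    and wh: "whittaker (\<Sum>k\<in>T. q k * xword k)"
  shows "\<exists>k\<in>T. k \<noteq> [] \<and> q k \<in> mod.lifted_ideal"
proof -
  define T' where "T' = T - {[]}"
  have T': "finite T'" "T' \<noteq> {}" using T by (auto simp: T'_def)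
  define n where "n = Max (weight ` T')"
  define Top where "Top = {k \<in> T'. weight k = n}"
  have "n \<in> weight ` T'" using T' by (auto simp: n_def)
  then obtain k' where k': "k' \<in> Top" by (auto simp: Top_def)
  then have "k' \<noteq> []" by (auto simp: Top_def T'_def)
  then have ne: "(\<Union>k\<in>Top. set k) \<noteq> {}" using k' by auto
  have fin: "finite (\<Union>k\<in>Top. set k)" using T' by (simp add: Top_def)
  \<comment> \<open>The minimum runs over all monomials of top weight at once, so that
    \<open>\<beta>\<close> bounds the letters of each of them from below.\<close>
  define \<beta> where "\<beta> = Min (\<Union>k\<in>Top. set k)"
  have \<beta>_min: "\<beta> \<le> \<alpha>" if "k \<in> Top" "\<alpha> \<in> set k" for k \<alpha>
    unfolding \<beta>_def using fin that by (intro Min_le) auto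
  obtain k1 where k1: "k1 \<in> Top" "\<beta> \<in> set k1" using Min_in[OF fin ne] by (auto simp: \<beta>_def)
  then obtain \<gamma> k0 where k0: "k1 = \<gamma> # k0" by (cases k1) auto
  have k1T: "k1 \<in> T" "k1 \<in> standard" using k1 T by (auto simp: Top_def T'_def)
  \<comment> \<open>\<open>k1\<close> is sorted, so its least letter is its head.\<close>
  have "\<gamma> = \<beta>"
  proof (rule antisym)
    show "\<gamma> \<le> \<beta>" using k1T k1(2) by (auto simp: standard_def k0)
    show "\<beta> \<le> \<gamma>" using \<beta>_min[OF k1(1)] k0 by simp
  qed
  with k0 have k1_eq: "k1 = \<beta> # k0" by simp
  have n_eq: "weight (\<beta> # k0) = n" using k1 k1_eq by (simp add: Top_def)
  have "q k1 \<in> mod.lifted_ideal"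
  proof (rule ccontr)
    assume not_in: "q k1 \<notin> mod.lifted_ideal"
    have "nc.subspace mod.lifted_ideal"
      by (rule nc.subspaceI)
        (simp_all add: mod.lifted(1) mod.lifted(3) mod.lifted(6)[OF mono_word_in_free])
    then obtain h where h: "\<And>p p'. h (p + p') = h p + h p'" "\<And>c p. h (mono_word c [] * p) = c * h p"
      "\<And>p. p \<in> mod.lifted_ideal \<Longrightarrow> h p = 0" "h (q k1) \<noteq> 0"
      using separating_functional[OF _ not_in] by metis
    have h_eq: "h p = h p'" if "p - p' \<in> mod.lifted_ideal" for p p'
      using h(1)[of "p - p'" p'] h(3)[OF that] by simp
    \<comment> \<open>The multiset is arranged as a word in some order; for entries in
      \<open>Zs\<close> the order does not matter, because \<open>h\<close> kills
      \<open>lifted_ideal\<close>.\<close>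
    define \<Lambda> where "\<Lambda> M = h (mono_word 1 (SOME zs. mset zs = M))" for M
    have \<Lambda>: "\<Lambda> (mset zs) = h (mono_word 1 zs)" if "set zs \<subseteq> Zs" for zs
    proof -
      have "mset (SOME zs'. mset zs' = mset zs) = mset zs" by (rule someI[of _ zs]) simp
      then show ?thesis unfolding \<Lambda>_def using that
        by (metis h_eq mod.lifted_permute set_mset_mset)
    qed
    have word_linear: "mono_word 1 ((z + z') # zs) - (mono_word 1 (z # zs) + mono_word 1 (z' # zs)) \<in> mod.lifted_ideal"
      "mono_word 1 ((r *\<^sub>C z) # zs) - mono_word r [] * mono_word 1 (z # zs) \<in> mod.lifted_ideal"
      if "set zs \<subseteq> Zs" "z \<in> Zs" "z' \<in> Zs" for z z' zs r
    proof -
      have "mono_word 1 [z + z'] - mono_word 1 [z] - mono_word 1 [z'] \<in> linear_relators Zs"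
        "mono_word 1 [r *\<^sub>C z] - mono_word r [z] \<in> linear_relators Zs"
        using that by (auto simp: linear_relators_def)
      then have "(mono_word 1 [z + z'] - mono_word 1 [z] - mono_word 1 [z']) * mono_word 1 zs \<in> mod.lifted_ideal"
        "(mono_word 1 [r *\<^sub>C z] - mono_word r [z]) * mono_word 1 zs \<in> mod.lifted_ideal"
        using mod.relators_in_lifted that by (auto intro!: mod.lifted(7) mono_word_in_free)
      then show "mono_word 1 ((z + z') # zs) - (mono_word 1 (z # zs) + mono_word 1 (z' # zs)) \<in> mod.lifted_ideal"
        "mono_word 1 ((r *\<^sub>C z) # zs) - mono_word r [] * mono_word 1 (z # zs) \<in> mod.lifted_ideal"
        by (simp_all add: left_diff_distrib distrib_right mono_word_mult diff_diff_add)
    qed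
    interpret lead: whittaker_leading X \<xi> Zs J \<pi> Np \<phi> top \<Lambda> k0 \<beta>
    proof unfold_locales
      fix M z z' r assume M: "set_mset M \<subseteq> Zs" and z: "z \<in> Zs" "z' \<in> Zs"
      obtain zs where zs: "M = mset zs" by (metis ex_mset)
      have sub: "set zs \<subseteq> Zs" using M zs by simp
      have "z + z' \<in> Zs" using z Z_subspace lie.subspace_add by blast
      then show "\<Lambda> (add_mset (z + z') M) = \<Lambda> (add_mset z M) + \<Lambda> (add_mset z' M)"
        using h_eq[OF word_linear(1)[OF sub z]] \<Lambda>[of "_ # zs"] sub z h(1) by (simp add: zs)
    next
      fix M z r assume M: "set_mset M \<subseteq> Zs" and z: "z \<in> Zs"
      obtain zs where zs: "M = mset zs" by (metis ex_mset)
      have sub: "set zs \<subseteq> Zs" using M zs by simp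
      have "r *\<^sub>C z \<in> Zs" using z Z_subspace lie.subspace_scale by blast
      then show "\<Lambda> (add_mset (r *\<^sub>C z) M) = r * \<Lambda> (add_mset z M)"
        using h_eq[OF word_linear(2)[OF sub z z]] \<Lambda>[of "_ # zs"] sub z h(2) by (simp add: zs)
    next
      show "sorted (\<beta> # k0)" using k1T(2) by (simp add: standard_def k1_eq)
    qed
    have vanish: "lead.functional (r * p) = 0" if r: "r \<in> mod.lifted_ideal" for r p
    proof (rule lead.functional_vanish)
      show rZ: "r \<in> free_carrier Zs" using r mod.lifted(2) by blast
      fix M assume M: "set_mset M \<subseteq> Zs"
      obtain ms where ms: "M = mset ms" by (metis ex_mset)
      have sub: "set ms \<subseteq> Zs" using M ms by simp
      have "lin_ext (\<lambda>zs. \<Lambda> (mset zs + M)) r = lin_ext (\<lambda>zs. h (mono_word 1 (zs @ ms))) r"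
        by (rule lin_ext_cong[OF rZ]) (use \<Lambda>[of "_ @ ms"] sub in \<open>simp add: ms\<close>)
      also have "\<dots> = lin_ext (\<lambda>zs. h (mono_word 1 zs)) (r * mono_word 1 ms)"
        by (simp add: lin_ext_mult_mono_right)
      also have "\<dots> = h (r * mono_word 1 ms)" by (rule lin_ext_linear) (rule h)+
      also have "\<dots> = 0" by (intro h(3) mod.lifted(7) r mono_word_in_free sub)
      finally show "lin_ext (\<lambda>zs. \<Lambda> (mset zs + M)) r = 0" .
    qed
    have functional_ann: "lead.functional p = 0" if "p \<in> mod.ann" for p
    proof (rule mod.ann_functional[OF _ _ _ _ _ that])
      show "lead.functional (p + p') = lead.functional p + lead.functional p'" for p p'
        by (simp add: lead.functional_def lin_ext_add)
      show "lead.functional (p * mono_word c []) = c * lead.functional p" for p c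
        by (simp add: lead.functional_def lin_ext_mult_mono_right)
    qed (use lead.functional_env_ker lead.functional_append_pos vanish in auto)
    define \<eta> where "\<eta> = top - \<beta>"
    have "\<beta> \<in> J" "\<pi> \<beta> \<le> 0" using k1T(2) by (auto simp: standard_def k1_eq)
    then have nondeg: "sc \<eta> \<beta> * \<phi> (X top) \<noteq> 0" unfolding \<eta>_def by (rule nondegenerate)
    have \<eta>_pos: "\<pi> \<eta> > 0" using lead.deg_eta \<open>\<pi> \<beta> \<le> 0\<close> top_pos by (simp add: \<eta>_def)
    \<comment> \<open>Otherwise \<open>X \<eta> = 0\<close>, and the structure constant in
      \<open>nondeg\<close> would vanish.\<close>
    have \<eta>J: "\<eta> \<in> J"
    proof (rule ccontr)
      assume "\<eta> \<notin> J"
      then have "sc \<eta> \<beta> = \<xi> 0 (\<eta> + \<beta>)" by (simp add: X_outside)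
      then show False using nondeg coord_scale[of 0 0] by simp
    qed
    have \<eta>N: "X \<eta> \<in> Np" by (rule X_pos[OF \<eta>_pos])
    let ?m = "of_nat (card {i. i < length (\<beta> # k0) \<and> (\<beta> # k0) ! i = \<beta>}) * (sc \<eta> \<beta> * \<phi> (X top)) :: complex"
    let ?d = "mono_word 1 [X \<eta>] - mono_word (\<phi> (X \<eta>)) []"
    have each: "lead.functional (?d * (q k * xword k)) = (if k = k1 then ?m * h (q k1) else 0)"
      if k: "k \<in> T" for k
    proof -
      have std: "sorted k" "set k \<subseteq> J" "\<forall>\<alpha>\<in>set k. \<pi> \<alpha> \<le> 0" using k T(2) by (auto simp: standard_def)
      \<comment> \<open>The coefficient is central, so the letter \<open>\<eta>\<close> passes it
        and joins the word \<open>k\<close>.\<close>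
      have "(mono_word 1 [X \<eta>] * q k - q k * mono_word 1 [X \<eta>]) * xword k \<in> env_ker"
        by (rule env_kerD(7)[OF env_ker_central[OF q Z_central]])
      then have "lead.functional (mono_word 1 [X \<eta>] * (q k * xword k)) =
          lead.functional (q k * xword (\<eta> # k))"
        using lead.functional_env_ker
        by (fastforce simp: left_diff_distrib mult.assoc mono_word_mult lead.functional_def lin_ext_diff)
      also have "\<dots> = lin_ext (\<lambda>zs. lead.L (mset zs) (\<eta> # k)) (q k)"
        by (rule lead.functional_basis[OF q]) (use std \<eta>J in simp)
      finally have 1: "lead.functional (mono_word 1 [X \<eta>] * (q k * xword k)) =
          lin_ext (\<lambda>zs. lead.L (mset zs) (\<eta> # k)) (q k)" .
      \<comment> \<open>The scalar \<open>\<phi> (X \<eta>)\<close> is traded for the letter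
        \<open>\<eta>\<close> at the right end, so that the difference becomes a commutator.\<close>
      have "lead.functional (mono_word (\<phi> (X \<eta>)) [] * (q k * xword k)) =
          \<phi> (X \<eta>) * lead.functional (q k * xword k)"
        unfolding const_central by (simp add: lead.functional_def lin_ext_mult_mono_right)
      also have "\<dots> = lead.functional (q k * xword k * mono_word 1 [X \<eta>])"
        by (rule lead.functional_append_pos[OF \<eta>N, symmetric])
      also have "\<dots> = lead.functional (q k * xword (k @ [\<eta>]))"
        by (simp add: mult.assoc mono_word_mult)
      also have "\<dots> = lin_ext (\<lambda>zs. lead.L (mset zs) (k @ [\<eta>])) (q k)"
        by (rule lead.functional_basis[OF q]) (use std \<eta>J in simp)
      finally have "lead.functional (?d * (q k * xword k)) =
          lin_ext (\<lambda>zs. lead.L (mset zs) (\<eta> # k) - lead.L (mset zs) (k @ [\<eta>])) (q k)"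
        using 1 by (simp add: left_diff_distrib lead.functional_def lin_ext_diff lin_ext_fun_diff)
      also have "\<dots> = lin_ext (\<lambda>zs. if k = k1 then ?m * h (mono_word 1 zs) else 0) (q k)"
      proof (rule lin_ext_cong[OF q])
        fix zs assume zs: "set zs \<subseteq> Zs"
        then have M: "set_mset (mset zs) \<subseteq> Zs" by simp
        show "lead.L (mset zs) (\<eta> # k) - lead.L (mset zs) (k @ [\<eta>]) =
            (if k = k1 then ?m * h (mono_word 1 zs) else 0)"
        proof (cases "k \<in> Top")
          case True
          then have "weight k = weight (\<beta> # k0)" "\<forall>\<alpha>\<in>set k. \<beta> \<le> \<alpha>"
            using n_eq \<beta>_min by (auto simp: Top_def)
          from lead.L_commutator_top[OF M this(1) std(1,3) this(2)]
          show ?thesis by (simp add: \<Lambda>[OF zs] k1_eq \<eta>_def)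
        next
          case False
          have "weight k < weight (\<beta> # k0)"
          \<comment> \<open>The constant term is not counted in \<open>n\<close>; it is lighter
            because nonempty standard words have positive weight.\<close>
          proof (cases "k = []")
            case True
            then show ?thesis
              using weight_pos[of "\<beta> # k0"] k1T(2) by (simp add: standard_def k1_eq)
          next
            case False
            then have "k \<in> T'" using k by (simp add: T'_def)
            then have "weight k \<le> n" using T' by (simp add: n_def)
            then show ?thesis using \<open>k \<notin> Top\<close> \<open>k \<in> T'\<close> n_eq by (simp add: Top_def)
          qed
          from lead.L_commutator_low[OF M this] False k1(1)
          show ?thesis by (auto simp: \<eta>_def)
        qed
      qed
      also have "\<dots> = (if k = k1 then ?m * h (q k1) else 0)"
        using lin_ext_fun_mult[of ?m "\<lambda>zs. h (mono_word 1 zs)" "q k1"] lin_ext_linear[of h "q k1"] h(1,2)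
        by (simp add: lin_ext_def)
      finally show ?thesis .
    qed
    have "?d * (\<Sum>k\<in>T. q k * xword k) \<in> mod.ann" using wh \<eta>N by (simp add: whittaker_def)
    then have "lead.functional (?d * (\<Sum>k\<in>T. q k * xword k)) = 0" by (rule functional_ann)
    moreover have "lead.functional (?d * (\<Sum>k\<in>T. q k * xword k)) =
        (\<Sum>k\<in>T. lead.functional (?d * (q k * xword k)))"
      by (simp only: sum_distrib_left lead.functional_def lin_ext_sum)
    ultimately have "(\<Sum>k\<in>T. if k = k1 then ?m * h (q k1) else 0) = 0" using each by simp
    then have "?m * h (q k1) = 0" using T(1) k1T(1) by simp
    \<comment> \<open>Position 0 holds \<open>\<beta>\<close>, so the multiplicity is
      nonzero.\<close>
    moreover have "card {i. i < length (\<beta> # k0) \<and> (\<beta> # k0) ! i = \<beta>} \<noteq> 0"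
    proof -
      have "finite {i. i < length (\<beta> # k0) \<and> (\<beta> # k0) ! i = \<beta>}" by simp
      moreover have "0 \<in> {i. i < length (\<beta> # k0) \<and> (\<beta> # k0) ! i = \<beta>}" by simp
      ultimately show ?thesis by (metis card_0_eq empty_iff)
    qed
    ultimately show False using nondeg h(4) unfolding mult_eq_0_iff of_nat_eq_0_iff by blast
  qed
  then show ?thesis using k1T k1_eq by blast
qed

lemma whittaker_central:
  assumes "finite T" "T \<subseteq> standard" "\<And>k. q k \<in> free_carrier Zs"
    and "whittaker (\<Sum>k\<in>T. q k * xword k)"
  shows "\<exists>r \<in> free_carrier Zs. (\<Sum>k\<in>T. q k * xword k) - r \<in> mod.ann"
  using assms
proof (induction "card T" arbitrary: T)
  case 0
  then show ?case by (auto intro!: bexI[of _ 0] mod.ann_zero)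
next
  case (Suc m)
  show ?case
  proof (cases "T \<subseteq> {[]}")
    case True
    then have "T = {[]}" using Suc.hyps(2) by (metis card.empty nat.distinct(1) subset_singletonD)
    then have "(\<Sum>k\<in>T. q k * xword k) = q []" by (simp add: mono_word_one)
    then show ?thesis using Suc.prems(3)[of "[]"] mod.ann_zero by (metis cancel_comm_monoid_add_class.diff_cancel)
  next
    case False
    then obtain k where k: "k \<in> T" "q k \<in> mod.lifted_ideal"
      using leading_coefficient[OF Suc.prems(1,2) False Suc.prems(3,4)] by blast
    have split: "(\<Sum>k\<in>T. q k * xword k) = q k * xword k + (\<Sum>k\<in>T - {k}. q k * xword k)"
      using Suc.prems(1) k(1) by (rule sum.remove)
    have ann: "(\<Sum>k\<in>T. q k * xword k) - (\<Sum>k\<in>T - {k}. q k * xword k) \<in> mod.ann"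
      using mod.ann_lifted[OF k(2), of "xword k"] by (simp add: split)
    have "\<exists>r \<in> free_carrier Zs. (\<Sum>k\<in>T - {k}. q k * xword k) - r \<in> mod.ann"
      using Suc.hyps(2) Suc.prems k(1) whittaker_cong[OF Suc.prems(4) ann]
      by (intro Suc.hyps(1)) auto
    then obtain r where r: "r \<in> free_carrier Zs" "(\<Sum>k\<in>T - {k}. q k * xword k) - r \<in> mod.ann" by blast
    then show ?thesis using mod.ann_add[OF ann r(2)] by (intro bexI[of _ r]) (simp_all add: algebra_simps)
  qed
qed

lemma whittaker_vector_central:
  assumes "whittaker_vector Np \<phi> mod.V v"
  shows "\<exists>p \<in> carrier (sym_algebra Zs). v = to_env p \<odot>\<^bsub>mod.V\<^esub> mod.w'"
proof -
  have "v \<in> carrier mod.V" using assms by (simp add: whittaker_vector_def)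
  then obtain p where p: "v = mod.\<Psi> p" by (rule mod.\<Psi>_surj)
  have wh: "whittaker p"
    unfolding whittaker_def
  proof
    fix n assume "n \<in> Np"
    then have "cls (mono_word 1 [n]) \<odot>\<^bsub>mod.V\<^esub> mod.\<Psi> p = cls (mono_word (\<phi> n) []) \<odot>\<^bsub>mod.V\<^esub> mod.\<Psi> p"
      using assms by (simp add: whittaker_vector_def env_incl_def env_const_def p)
    then show "(mono_word 1 [n] - mono_word (\<phi> n) []) * p \<in> mod.ann"
      by (simp add: mod.smult_\<Psi> mod.\<Psi>_eq_iff left_diff_distrib)
  qed
  obtain T q where T: "finite T" "T \<subseteq> standard" "\<And>k. q k \<in> free_carrier Zs"
    "p - (\<Sum>k\<in>T. q k * xword k) \<in> mod.ann"
    using spanned_all[of p] by (auto simp: spanned_def)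
  obtain r where r: "r \<in> free_carrier Zs" "(\<Sum>k\<in>T. q k * xword k) - r \<in> mod.ann"
    using whittaker_central[OF T(1-3) whittaker_cong[OF wh T(4)]] by blast
  have "p - r \<in> mod.ann" using mod.ann_add[OF T(4) r(2)] by simp
  then have "v = mod.\<Psi> r" using p mod.\<Psi>_eq_iff by simp
  then show ?thesis using mod.sym_action[OF r(1)] by simp
qed

end


section \<open>Good gradings\<close>

lemma subspace_center: "lie.subspace (lie_center :: 'g::lie_algebra set)"
  by (rule lie.subspaceI) (auto simp: lie_center_def bracket_add_left bracket_scale_left)

section \<open>Homogeneous components\<close>

locale graded_lie =
  fixes gr :: "'q::linordered_ab_group_add \<Rightarrow> 'g::lie_algebra set"
  assumes grading: "lie_grading gr"
begin

lemma subspace_gr: "lie.subspace (gr \<alpha>)"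
  using grading by (simp add: lie_grading_def)

lemma bracket_gr: "\<lbrakk>x \<in> gr \<alpha>; y \<in> gr \<beta>\<rbrakk> \<Longrightarrow> bracket x y \<in> gr (\<alpha> + \<beta>)"
  using grading by (simp add: lie_grading_def)

lemma zero_gr: "0 \<in> gr \<alpha>"
  using subspace_gr by (rule lie.subspace_0)

definition decomposes :: "'g \<Rightarrow> ('q \<Rightarrow> 'g) \<Rightarrow> bool" where
  "decomposes x f \<longleftrightarrow> (\<forall>\<alpha>. f \<alpha> \<in> gr \<alpha>) \<and> finite {\<alpha>. f \<alpha> \<noteq> 0} \<and> x = (\<Sum>\<alpha> | f \<alpha> \<noteq> 0. f \<alpha>)"

definition component :: "'g \<Rightarrow> 'q \<Rightarrow> 'g" where
  "component x = (THE f. decomposes x f)"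

lemma decomposes_unique: "\<exists>!f. decomposes x f"
  using grading by (simp add: lie_grading_def decomposes_def)

lemma decomposes_component: "decomposes x (component x)"
  using theI'[OF decomposes_unique[of x]] by (simp add: component_def)

lemma component_eqI: "decomposes x f \<Longrightarrow> component x = f"
  using decomposes_unique decomposes_component by blast

lemma component_gr: "component x \<alpha> \<in> gr \<alpha>"
  and component_finite: "finite {\<alpha>. component x \<alpha> \<noteq> 0}"
  and component_sum: "x = (\<Sum>\<alpha> | component x \<alpha> \<noteq> 0. component x \<alpha>)"
  using decomposes_component[of x] by (simp_all add: decomposes_def)

lemma component_sum_superset:
  "\<lbrakk>finite S; {\<alpha>. component x \<alpha> \<noteq> 0} \<subseteq> S\<rbrakk> \<Longrightarrow> x = (\<Sum>\<alpha>\<in>S. component x \<alpha>)"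
  by (subst component_sum) (rule sum.mono_neutral_left, auto)

lemma component_sumI:
  assumes "finite S" "\<And>\<alpha>. f \<alpha> \<in> gr \<alpha>" "\<And>\<alpha>. \<alpha> \<notin> S \<Longrightarrow> f \<alpha> = 0" "x = (\<Sum>\<alpha>\<in>S. f \<alpha>)"
  shows "component x = f"
proof (rule component_eqI)
  have sub: "{\<alpha>. f \<alpha> \<noteq> 0} \<subseteq> S" using assms(3) by blast
  have "(\<Sum>\<alpha>\<in>S. f \<alpha>) = (\<Sum>\<alpha> | f \<alpha> \<noteq> 0. f \<alpha>)"
    by (rule sum.mono_neutral_right[OF assms(1) sub]) simp
  then show "decomposes x f"
    using assms finite_subset[OF sub] by (simp add: decomposes_def)
qed

lemma component_add: "component (x + y) = (\<lambda>\<alpha>. component x \<alpha> + component y \<alpha>)"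
proof (rule component_sumI)
  let ?S = "{\<alpha>. component x \<alpha> \<noteq> 0} \<union> {\<alpha>. component y \<alpha> \<noteq> 0}"
  show S: "finite ?S" using component_finite by simp
  show "x + y = (\<Sum>\<alpha>\<in>?S. component x \<alpha> + component y \<alpha>)"
    using component_sum_superset[OF S, of x] component_sum_superset[OF S, of y]
    by (simp add: sum.distrib)
  show "component x \<alpha> + component y \<alpha> \<in> gr \<alpha>" for \<alpha>
    using lie.subspace_add[OF subspace_gr] component_gr by blast
qed auto

lemma component_scale: "component (c *\<^sub>C x) = (\<lambda>\<alpha>. c *\<^sub>C component x \<alpha>)"
proof (rule component_sumI)
  show "c *\<^sub>C x = (\<Sum>\<alpha> | component x \<alpha> \<noteq> 0. c *\<^sub>C component x \<alpha>)"
    by (subst component_sum) (rule lie.scale_sum_right)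
  show "c *\<^sub>C component x \<alpha> \<in> gr \<alpha>" for \<alpha>
    using lie.subspace_scale[OF subspace_gr] component_gr by blast
qed (use component_finite in auto)

lemma component_homogeneous: "x \<in> gr \<delta> \<Longrightarrow> component x = (\<lambda>\<alpha>. if \<alpha> = \<delta> then x else 0)"
  by (rule component_sumI[of "{\<delta>}"]) (auto intro: zero_gr)

lemma component_zero: "component 0 = (\<lambda>_. 0)"
  using component_homogeneous[OF zero_gr] by fastforce

text \<open>For \<open>y\<close> of degree \<beta>, the brackets of the components of
  \<open>z\<close> with \<open>y\<close> lie in distinct degrees and add up to [z, y] = 0, so each
  of them vanishes.\<close>

lemma component_central:
  assumes "z \<in> lie_center" shows "component z \<alpha> \<in> lie_center"
proof -
  have hom: "bracket (component z \<alpha>) y = 0" if y: "y \<in> gr \<beta>" for y \<beta>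
  proof -
    let ?S = "(\<lambda>\<gamma>. \<gamma> + \<beta>) ` {\<gamma>. component z \<gamma> \<noteq> 0}"
    have "component 0 = (\<lambda>\<gamma>. bracket (component z (\<gamma> - \<beta>)) y)"
    proof (rule component_sumI[of ?S])
      show "finite ?S" using component_finite by simp
      show "bracket (component z (\<gamma> - \<beta>)) y \<in> gr \<gamma>" for \<gamma>
        using bracket_gr[OF component_gr y, of z "\<gamma> - \<beta>"] by simp
      show "bracket (component z (\<gamma> - \<beta>)) y = 0" if "\<gamma> \<notin> ?S" for \<gamma>
      proof -
        have "component z (\<gamma> - \<beta>) = 0"
        proof (rule ccontr)
          assume "component z (\<gamma> - \<beta>) \<noteq> 0"
          then have "(\<gamma> - \<beta>) + \<beta> \<in> ?S" by (intro imageI) simp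
          then show False using that by simp
        qed
        then show ?thesis by simp
      qed
      have "0 = bracket z y" using assms by (simp add: lie_center_def)
      also have "\<dots> = (\<Sum>\<gamma> | component z \<gamma> \<noteq> 0. bracket (component z \<gamma>) y)"
        by (subst component_sum) (rule bracket_sum_left)
      also have "\<dots> = (\<Sum>\<gamma>\<in>?S. bracket (component z (\<gamma> - \<beta>)) y)"
        by (subst sum.reindex) (auto intro: inj_onI)
      finally show "0 = (\<Sum>\<gamma>\<in>?S. bracket (component z (\<gamma> - \<beta>)) y)" .
    qed
    then show ?thesis using component_zero by (metis add_diff_cancel)
  qed
  have "bracket (component z \<alpha>) x = 0" for x
    by (subst component_sum[of x]) (simp add: bracket_sum_right hom[OF component_gr])
  then show ?thesis by (simp add: lie_center_def)
qed

lemma span_component: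
  "lie.span (\<Union>\<alpha>\<in>{\<alpha>. Q \<alpha>}. gr \<alpha>) = {x. \<forall>\<alpha>. component x \<alpha> \<noteq> 0 \<longrightarrow> Q \<alpha>}"
proof (rule equalityI[OF _ subsetI])
  show "lie.span (\<Union>\<alpha>\<in>{\<alpha>. Q \<alpha>}. gr \<alpha>) \<subseteq> {x. \<forall>\<alpha>. component x \<alpha> \<noteq> 0 \<longrightarrow> Q \<alpha>}"
  proof (rule lie.span_minimal)
    show "lie.subspace {x. \<forall>\<alpha>. component x \<alpha> \<noteq> 0 \<longrightarrow> Q \<alpha>}"
      by (rule lie.subspaceI)
        (auto simp: component_zero component_add component_scale, metis add_0)
    show "(\<Union>\<alpha>\<in>{\<alpha>. Q \<alpha>}. gr \<alpha>) \<subseteq> {x. \<forall>\<alpha>. component x \<alpha> \<noteq> 0 \<longrightarrow> Q \<alpha>}"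
      using component_homogeneous by (auto split: if_splits)
  qed
next
  fix x assume "x \<in> {x. \<forall>\<alpha>. component x \<alpha> \<noteq> 0 \<longrightarrow> Q \<alpha>}"
  then have "(\<Sum>\<alpha> | component x \<alpha> \<noteq> 0. component x \<alpha>) \<in> lie.span (\<Union>\<alpha>\<in>{\<alpha>. Q \<alpha>}. gr \<alpha>)"
    by (intro lie.span_sum lie.span_base) (use component_gr in auto)
  then show "x \<in> lie.span (\<Union>\<alpha>\<in>{\<alpha>. Q \<alpha>}. gr \<alpha>)" using component_sum[of x] by simp
qed

end

section \<open>Coordinates on a Q-good Lie algebra\<close>

locale good_grading = graded_lie gr
  for gr :: "'q::linordered_ab_group_add \<Rightarrow> 'g::lie_algebra set" +
  fixes \<pi> :: "'q \<Rightarrow> int" and x :: "'q \<Rightarrow> 'g" and \<phi> :: "'g \<Rightarrow> complex" and top :: 'q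
  assumes deg_add: "\<pi> (\<alpha> + \<beta>) = \<pi> \<alpha> + \<pi> \<beta>"
    and deg_mono: "\<alpha> \<le> \<beta> \<Longrightarrow> \<pi> \<alpha> \<le> \<pi> \<beta>"
    and good: "Q_good gr \<pi>"
    and x: "\<alpha> \<in> supp gr - central_nonpos gr \<pi> \<Longrightarrow>
      x \<alpha> \<in> gr \<alpha> \<and> x \<alpha> \<noteq> 0 \<and> x \<alpha> \<notin> center_nonpos gr \<pi>"
    and char: "lie_character (pos_part gr \<pi>) \<phi>"
    and top: "maximal_in {\<alpha> \<in> supp_pos gr \<pi>. \<phi> (x \<alpha>) \<noteq> 0} top"
    and nonsing: "\<beta> \<in> supp_nonpos gr \<pi> - central_nonpos gr \<pi> \<Longrightarrow>
      \<exists>y\<in>gr (top - \<beta>). \<phi> (bracket y (x \<beta>)) \<noteq> 0"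
begin

definition J where "J = supp gr - central_nonpos gr \<pi>"
text \<open>The value 0 outside \<open>J\<close> lets words range over all of \<open>'q\<close>, so that \<open>\<alpha> + \<beta>\<close> is always
  a letter.\<close>

definition X where "X \<alpha> = (if \<alpha> \<in> J then x \<alpha> else 0)"
text \<open>The subspace modulo which \<open>gr \<alpha>\<close> has dimension at most 1; it lets
  the two cases of Q-goodness be treated together.\<close>

definition negligible where "negligible \<alpha> = (if \<pi> \<alpha> > 0 then {0} else lie_center)"
definition coord where
  "coord y \<alpha> = (if \<alpha> \<in> J then THE c. component y \<alpha> - c *\<^sub>C x \<alpha> \<in> negligible \<alpha> else 0)"

lemma subspace_negligible: "lie.subspace (negligible \<alpha>)"
  by (simp add: negligible_def subspace_center lie.subspace_single_0)

lemma mem_pos_part: "y \<in> pos_part gr \<pi> \<longleftrightarrow> (\<forall>\<alpha>. component y \<alpha> \<noteq> 0 \<longrightarrow> \<pi> \<alpha> > 0)"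
  unfolding pos_part_def span_component by simp

lemma mem_nonpos_part: "y \<in> nonpos_part gr \<pi> \<longleftrightarrow> (\<forall>\<alpha>. component y \<alpha> \<noteq> 0 \<longrightarrow> \<pi> \<alpha> \<le> 0)"
  unfolding nonpos_part_def span_component by simp

lemma gr_pos_part: "\<lbrakk>y \<in> gr \<alpha>; \<pi> \<alpha> > 0\<rbrakk> \<Longrightarrow> y \<in> pos_part gr \<pi>"
  by (simp add: mem_pos_part component_homogeneous)

lemma gr_nonpos_part: "\<lbrakk>y \<in> gr \<alpha>; \<pi> \<alpha> \<le> 0\<rbrakk> \<Longrightarrow> y \<in> nonpos_part gr \<pi>"
  by (simp add: mem_nonpos_part component_homogeneous)

lemma x_not_negligible: "\<alpha> \<in> J \<Longrightarrow> x \<alpha> \<in> gr \<alpha>" "\<alpha> \<in> J \<Longrightarrow> x \<alpha> \<notin> negligible \<alpha>"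
  using x[of \<alpha>] gr_nonpos_part[of "x \<alpha>" \<alpha>] by (auto simp: J_def negligible_def center_nonpos_def)

text \<open>Because \<open>x \<alpha>\<close> is not negligible, the quotient of
  \<open>gr \<alpha>\<close> has dimension exactly 1 and is spanned by its class.\<close>

lemma coord_exists:
  assumes \<alpha>: "\<alpha> \<in> J" and y: "y \<in> gr \<alpha>"
  shows "\<exists>c. y - c *\<^sub>C x \<alpha> \<in> negligible \<alpha>"
proof -
  note N = subspace_negligible[of \<alpha>]
  have "dim_mod_le (negligible \<alpha>) (gr \<alpha>) 1"
    using good by (simp add: Q_good_def negligible_def)
  then obtain B where B: "finite_basis_mod (negligible \<alpha>) (gr \<alpha>) B" "card B \<le> 1"
    by (auto simp: dim_mod_le_def)
  have span: "\<exists>c. u - (\<Sum>b\<in>B. c b *\<^sub>C b) \<in> negligible \<alpha>" if "u \<in> gr \<alpha>" for u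
    using B(1) that by (simp add: finite_basis_mod_def)
  obtain d where d: "x \<alpha> - (\<Sum>b\<in>B. d b *\<^sub>C b) \<in> negligible \<alpha>"
    using span x_not_negligible(1)[OF \<alpha>] by blast
  obtain c where c: "y - (\<Sum>b\<in>B. c b *\<^sub>C b) \<in> negligible \<alpha>" using span y by blast
  have "finite B" using B(1) by (simp add: finite_basis_mod_def)
  moreover have "B \<noteq> {}" using d x_not_negligible(2)[OF \<alpha>] by auto
  ultimately have "card B = 1" using B(2) by (metis card_0_eq le_Suc_eq le_zero_eq One_nat_def)
  then obtain b where b: "B = {b}" by (rule card_1_singletonE)
  have "d b \<noteq> 0" using d x_not_negligible(2)[OF \<alpha>] by (auto simp: b)
  \<comment> \<open>Modulo \<open>negligible \<alpha>\<close>, both \<open>y\<close> and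
    \<open>x \<alpha>\<close> are multiples of \<open>b\<close>; eliminating \<open>b\<close> gives
    the coefficient \<open>c b / d b\<close>.\<close>
  have "(y - c b *\<^sub>C b) - (c b / d b) *\<^sub>C (x \<alpha> - d b *\<^sub>C b) \<in> negligible \<alpha>"
    by (rule lie.subspace_diff[OF N _ lie.subspace_scale[OF N]]) (use c d in \<open>simp_all add: b\<close>)
  also have "(y - c b *\<^sub>C b) - (c b / d b) *\<^sub>C (x \<alpha> - d b *\<^sub>C b) = y - (c b / d b) *\<^sub>C x \<alpha>"
    using \<open>d b \<noteq> 0\<close> by (simp add: lie.scale_right_diff_distrib)
  finally show ?thesis by blast
qed

lemma coord_unique:
  assumes \<alpha>: "\<alpha> \<in> J" and "y - c *\<^sub>C x \<alpha> \<in> negligible \<alpha>" "y - d *\<^sub>C x \<alpha> \<in> negligible \<alpha>"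
  shows "c = d"
proof (rule ccontr)
  assume "c \<noteq> d"
  note N = subspace_negligible[of \<alpha>]
  have "(y - d *\<^sub>C x \<alpha>) - (y - c *\<^sub>C x \<alpha>) \<in> negligible \<alpha>"
    using assms lie.subspace_diff[OF N] by blast
  then have "(c - d) *\<^sub>C x \<alpha> \<in> negligible \<alpha>" by (simp add: lie.scale_left_diff_distrib)
  then have "inverse (c - d) *\<^sub>C (c - d) *\<^sub>C x \<alpha> \<in> negligible \<alpha>"
    by (rule lie.subspace_scale[OF N])
  then show False using \<open>c \<noteq> d\<close> x_not_negligible(2)[OF \<alpha>] by simp
qed

lemma coord_eqI: "\<lbrakk>\<alpha> \<in> J; component y \<alpha> - c *\<^sub>C x \<alpha> \<in> negligible \<alpha>\<rbrakk> \<Longrightarrow> coord y \<alpha> = c"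
  using coord_unique by (auto simp: coord_def intro!: the_equality)

lemma coord_mem: "\<alpha> \<in> J \<Longrightarrow> component y \<alpha> - coord y \<alpha> *\<^sub>C x \<alpha> \<in> negligible \<alpha>"
  using coord_exists[OF _ component_gr] coord_eqI by metis

lemma coord_outside: "\<alpha> \<notin> J \<Longrightarrow> coord y \<alpha> = 0"
  by (simp add: coord_def)

lemma coord_zero: "component y \<alpha> = 0 \<Longrightarrow> coord y \<alpha> = 0"
  using coord_eqI[of \<alpha> y 0] lie.subspace_0[OF subspace_negligible] coord_outside by fastforce

lemma coord_add: "coord (y + z) \<alpha> = coord y \<alpha> + coord z \<alpha>"
proof (cases "\<alpha> \<in> J")
  case True
  show ?thesis
    using lie.subspace_add[OF subspace_negligible coord_mem[OF True, of y] coord_mem[OF True, of z]]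
    by (intro coord_eqI[OF True]) (simp add: component_add lie.scale_left_distrib algebra_simps)
qed (simp add: coord_outside)

lemma coord_scale: "coord (c *\<^sub>C y) \<alpha> = c * coord y \<alpha>"
proof (cases "\<alpha> \<in> J")
  case True
  show ?thesis
    using lie.subspace_scale[OF subspace_negligible coord_mem[OF True, of y], of c]
    by (intro coord_eqI[OF True]) (simp add: component_scale lie.scale_right_diff_distrib)
qed (simp add: coord_outside)

lemma coord_support_finite: "finite {\<alpha>. coord y \<alpha> \<noteq> 0}"
  by (rule finite_subset[OF _ component_finite[of y]]) (use coord_zero in blast)

abbreviation Zs where "Zs \<equiv> center_nonpos gr \<pi>"

lemma subspace_Z: "lie.subspace Zs"
  unfolding center_nonpos_def nonpos_part_def
  by (intro lie.subspace_inter subspace_center lie.subspace_span)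

text \<open>In \<open>J\<close> the defining property of \<open>coord\<close> applies. Outside
  \<open>J\<close> the component itself is the remainder: it is zero in positive degree and central
  in degree at most 0, hence in Z''.\<close>

lemma remainder_component:
  "component y \<alpha> - coord y \<alpha> *\<^sub>C X \<alpha> \<in> Zs" "\<pi> \<alpha> > 0 \<Longrightarrow> component y \<alpha> - coord y \<alpha> *\<^sub>C X \<alpha> = 0"
proof -
  have "component y \<alpha> - coord y \<alpha> *\<^sub>C X \<alpha> \<in> gr \<alpha>"
    using component_gr x_not_negligible(1) zero_gr
    by (auto simp: X_def intro!: lie.subspace_diff[OF subspace_gr] lie.subspace_scale[OF subspace_gr])
  note gr = gr_nonpos_part[OF this]
  have out: "component y \<alpha> = 0" if "\<alpha> \<notin> J" "\<pi> \<alpha> > 0"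
    using that component_gr[of y \<alpha>] by (auto simp: J_def supp_def central_nonpos_def supp_nonpos_def)
  show pos: "component y \<alpha> - coord y \<alpha> *\<^sub>C X \<alpha> = 0" if "\<pi> \<alpha> > 0"
    using coord_mem[of \<alpha> y] out that by (cases "\<alpha> \<in> J") (auto simp: X_def negligible_def)
  have out': "component y \<alpha> \<in> lie_center" if "\<alpha> \<notin> J"
    using that component_gr[of y \<alpha>] lie.subspace_0[OF subspace_center]
    by (auto simp: J_def supp_def central_nonpos_def)
  show "component y \<alpha> - coord y \<alpha> *\<^sub>C X \<alpha> \<in> Zs"
  proof (cases "\<pi> \<alpha> > 0")
    case True
    then show ?thesis using pos lie.subspace_0[OF subspace_Z] by simp
  next
    case False
    then show ?thesis
      using coord_mem[of \<alpha> y] out' gr by (cases "\<alpha> \<in> J") (auto simp: X_def negligible_def center_nonpos_def)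
  qed
qed

lemma remainder_eq:
  assumes "finite S" "{\<alpha>. component y \<alpha> \<noteq> 0} \<subseteq> S"
  shows "y - (\<Sum>\<alpha> | coord y \<alpha> \<noteq> 0. coord y \<alpha> *\<^sub>C X \<alpha>) = (\<Sum>\<alpha>\<in>S. component y \<alpha> - coord y \<alpha> *\<^sub>C X \<alpha>)"
proof -
  have "(\<Sum>\<alpha> | coord y \<alpha> \<noteq> 0. coord y \<alpha> *\<^sub>C X \<alpha>) = (\<Sum>\<alpha>\<in>S. coord y \<alpha> *\<^sub>C X \<alpha>)"
    by (rule sum.mono_neutral_left) (use assms coord_zero in auto)
  moreover have "y = (\<Sum>\<alpha>\<in>S. component y \<alpha>)" by (rule component_sum_superset[OF assms])
  ultimately show ?thesis by (metis sum_subtractf)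
qed

sublocale frame: central_frame X coord Zs
proof
  show "y - (\<Sum>c | coord y c \<noteq> 0. coord y c *\<^sub>C X c) \<in> Zs" for y
    unfolding remainder_eq[OF component_finite order_refl]
    by (rule lie.subspace_sum[OF subspace_Z]) (rule remainder_component(1))
qed (use subspace_Z coord_add coord_scale coord_support_finite in \<open>auto simp: center_nonpos_def\<close>)

lemma rem_pos:
  assumes "y \<in> pos_part gr \<pi>" shows "frame.rem y = 0"
  unfolding frame.rem_def remainder_eq[OF component_finite order_refl]
  using assms remainder_component(2) by (intro sum.neutral) (simp add: mem_pos_part)

text \<open>Linearity of \<open>\<phi>\<close> is given only on n, so the summands have to lie
  there.\<close>

lemma char_linear:
  assumes "\<And>i. i \<in> S \<Longrightarrow> f i \<in> pos_part gr \<pi>"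
  shows "\<phi> (\<Sum>i\<in>S. r i *\<^sub>C f i) = (\<Sum>i\<in>S. r i * \<phi> (f i))"
proof -
  have sp: "lie.subspace (pos_part gr \<pi>)" by (simp add: pos_part_def lie.subspace_span)
  have zero: "\<phi> 0 = 0"
    using char lie.subspace_0[OF sp] unfolding lie_character_def by (metis lie.scale_zero_left mult_zero_left)
  show ?thesis
    using assms
  proof (induction S rule: infinite_finite_induct)
    case (insert i S)
    have "(\<Sum>i\<in>S. r i *\<^sub>C f i) \<in> pos_part gr \<pi>" "r i *\<^sub>C f i \<in> pos_part gr \<pi>"
      using insert by (auto intro!: lie.subspace_sum[OF sp] lie.subspace_scale[OF sp])
    then show ?case using insert char by (simp add: lie_character_def)
  qed (simp_all add: zero)
qed

lemma X_gr: "X \<alpha> \<in> gr \<alpha>"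
  using x_not_negligible(1) zero_gr by (simp add: X_def)

lemma char_pos:
  assumes "y \<in> pos_part gr \<pi>" shows "\<phi> y = frame.lin_comb y (\<lambda>\<gamma>. \<phi> (X \<gamma>))"
proof -
  have "y = (\<Sum>\<gamma> | coord y \<gamma> \<noteq> 0. coord y \<gamma> *\<^sub>C X \<gamma>)"
    using rem_pos[OF assms] by (simp add: frame.rem_def)
  moreover have "X \<gamma> \<in> pos_part gr \<pi>" if "coord y \<gamma> \<noteq> 0" for \<gamma>
  proof (rule gr_pos_part[OF X_gr])
    show "\<pi> \<gamma> > 0" using that coord_zero[of y \<gamma>] assms by (auto simp: mem_pos_part)
  qed
  ultimately show ?thesis
    using char_linear[of "{\<gamma>. coord y \<gamma> \<noteq> 0}" X "coord y"] by (simp add: frame.lin_comb_def)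
qed

lemma coord_bracket: "coord (bracket (X \<alpha>) (X \<beta>)) \<gamma> \<noteq> 0 \<Longrightarrow> \<gamma> = \<alpha> + \<beta>"
  using coord_zero component_homogeneous[OF bracket_gr[OF X_gr X_gr]] by metis

lemma lin_comb_bracket: "frame.lin_comb (bracket (X \<alpha>) (X \<beta>)) g = coord (bracket (X \<alpha>) (X \<beta>)) (\<alpha> + \<beta>) * g (\<alpha> + \<beta>)"
  using frame.lin_comb_superset[of "{\<alpha> + \<beta>}" "bracket (X \<alpha>) (X \<beta>)" g] coord_bracket by force

text \<open>The order on Q is total, so a maximal element is greatest. Letters outside
  \<open>J\<close> are 0, and \<open>\<phi>\<close> vanishes at 0.\<close>

lemma top_facts: "\<pi> top > 0" "\<lbrakk>\<pi> \<alpha> > 0; \<phi> (X \<alpha>) \<noteq> 0\<rbrakk> \<Longrightarrow> \<alpha> \<le> top"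
proof -
  show "\<pi> top > 0" using top by (simp add: maximal_in_def supp_pos_def)
  assume \<alpha>: "\<pi> \<alpha> > 0" "\<phi> (X \<alpha>) \<noteq> 0"
  have "\<phi> 0 = 0" using char_linear[of "{}"] by simp
  with \<alpha> have "\<alpha> \<in> J" "X \<alpha> = x \<alpha>" by (auto simp: X_def split: if_splits)
  then have "\<alpha> \<in> {\<alpha> \<in> supp_pos gr \<pi>. \<phi> (x \<alpha>) \<noteq> 0}" using \<alpha> by (auto simp: J_def supp_pos_def)
  then show "\<alpha> \<le> top" using top by (auto simp: maximal_in_def not_less)
qed

sublocale whittaker_frame X coord Zs J \<pi> "pos_part gr \<pi>" \<phi> top
proof
  show "\<pi> (\<alpha> + \<beta>) = \<pi> \<alpha> + \<pi> \<beta>" for \<alpha> \<beta> by (rule deg_add)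
  show "\<alpha> \<le> \<beta> \<Longrightarrow> \<pi> \<alpha> \<le> \<pi> \<beta>" for \<alpha> \<beta> by (rule deg_mono)
  show "coord (X \<alpha>) \<gamma> = (if \<gamma> = \<alpha> then 1 else 0)" if \<alpha>: "\<alpha> \<in> J" for \<alpha> \<gamma>
  proof (cases "\<gamma> = \<alpha>")
    case True
    have "component (X \<alpha>) \<alpha> - 1 *\<^sub>C x \<alpha> \<in> negligible \<alpha>"
      using component_homogeneous[OF X_gr, of \<alpha>] \<alpha> lie.subspace_0[OF subspace_negligible]
      by (simp add: X_def)
    then show ?thesis using coord_eqI[OF \<alpha>] True by simp
  next
    case False
    then show ?thesis using component_homogeneous[OF X_gr, of \<alpha>] by (simp add: coord_zero)
  qed
  \<comment> \<open>An element of Z'' has no component of positive degree, and its other components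
    are central, hence negligible.\<close>
  show "coord z \<gamma> = 0" if z: "z \<in> Zs" for z \<gamma>
  proof (cases "\<pi> \<gamma> > 0")
    case True
    then show ?thesis using z by (intro coord_zero) (force simp: center_nonpos_def mem_nonpos_part)
  next
    case False
    then show ?thesis
      using component_central[of z \<gamma>] z coord_eqI[of \<gamma> z 0] coord_outside
      by (cases "\<gamma> \<in> J") (auto simp: center_nonpos_def negligible_def)
  qed
  show "coord (bracket (X \<alpha>) (X \<beta>)) \<gamma> \<noteq> 0 \<Longrightarrow> \<gamma> = \<alpha> + \<beta>" for \<alpha> \<beta> \<gamma> by (rule coord_bracket)
  show "frame.rem (bracket (X \<alpha>) (X \<beta>)) = 0" if "\<pi> (\<alpha> + \<beta>) > 0" for \<alpha> \<beta>
    by (rule rem_pos) (rule gr_pos_part[OF bracket_gr[OF X_gr X_gr] that])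
  show "coord (bracket (X \<alpha>) (X \<beta>)) (\<alpha> + \<beta>) * \<phi> (X (\<alpha> + \<beta>)) = 0"
    if "\<pi> \<alpha> > 0" "\<pi> \<beta> > 0" for \<alpha> \<beta>
  proof -
    have "\<phi> (bracket (X \<alpha>) (X \<beta>)) = 0"
      using char gr_pos_part[OF X_gr] that by (simp add: lie_character_def)
    moreover have "bracket (X \<alpha>) (X \<beta>) \<in> pos_part gr \<pi>"
      using gr_pos_part[OF bracket_gr[OF X_gr X_gr]] that by (simp add: deg_add)
    ultimately show ?thesis using char_pos lin_comb_bracket by metis
  qed
  show "\<pi> top > 0" by (rule top_facts)
  show "\<alpha> \<le> top" if "\<pi> \<alpha> > 0" "\<phi> (X \<alpha>) \<noteq> 0" for \<alpha> using that by (rule top_facts)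
  show "frame.rem n = 0" if "n \<in> pos_part gr \<pi>" for n using that by (rule rem_pos)
  show "\<pi> \<gamma> > 0" if "n \<in> pos_part gr \<pi>" "coord n \<gamma> \<noteq> 0" for n \<gamma>
    using that coord_zero by (auto simp: mem_pos_part)
  show "\<phi> n = frame.lin_comb n (\<lambda>\<gamma>. \<phi> (X \<gamma>))" if "n \<in> pos_part gr \<pi>" for n
    using that by (rule char_pos)
qed

text \<open>In positive degree \<open>X (top - \<beta>)\<close> spans its component, so the
  \<open>y\<close> supplied by nonsingularity is a multiple of it. The bracket has degree
  \<open>top\<close>, where \<open>\<phi>\<close> is the coordinate times
  \<open>\<phi> (X top)\<close>.\<close>

lemma nondegenerate:
  assumes \<beta>: "\<beta> \<in> J" "\<pi> \<beta> \<le> 0"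
  shows "coord (bracket (X (top - \<beta>)) (X \<beta>)) (top - \<beta> + \<beta>) * \<phi> (X top) \<noteq> 0"
proof -
  let ?\<eta> = "top - \<beta>"
  obtain y where y: "y \<in> gr ?\<eta>" "\<phi> (bracket y (x \<beta>)) \<noteq> 0"
    using nonsing[of \<beta>] \<beta> by (auto simp: J_def supp_nonpos_def)
  have deg: "\<pi> ?\<eta> > 0" using deg_add[of ?\<eta> \<beta>] top_facts(1) \<beta>(2) by simp
  have "y = component y ?\<eta>" using component_homogeneous[OF y(1)] by simp
  then have "y = coord y ?\<eta> *\<^sub>C X ?\<eta>" using remainder_component(2)[OF deg, of y] by simp
  then have "bracket y (x \<beta>) = coord y ?\<eta> *\<^sub>C bracket (X ?\<eta>) (X \<beta>)"
    using \<beta> by (metis X_def bracket_scale_left)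
  moreover have pos: "bracket (X ?\<eta>) (X \<beta>) \<in> pos_part gr \<pi>"
    using gr_pos_part[OF bracket_gr[OF X_gr X_gr]] top_facts(1) by simp
  ultimately have "\<phi> (bracket (X ?\<eta>) (X \<beta>)) \<noteq> 0"
    using y(2) char by (auto simp: lie_character_def)
  then show ?thesis using char_pos[OF pos] lin_comb_bracket[of ?\<eta> \<beta>] by simp
qed

lemma bracket_pos_part:
  assumes "y \<in> pos_part gr \<pi>" "z \<in> pos_part gr \<pi>" shows "bracket y z \<in> pos_part gr \<pi>"
proof -
  have "bracket (component y \<alpha>) (component z \<beta>) \<in> pos_part gr \<pi>"
    if "component y \<alpha> \<noteq> 0" "component z \<beta> \<noteq> 0" for \<alpha> \<beta>
  proof (rule gr_pos_part[OF bracket_gr[OF component_gr component_gr]])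
    show "\<pi> (\<alpha> + \<beta>) > 0" using assms that by (simp add: mem_pos_part deg_add add_pos_pos)
  qed
  then have "(\<Sum>\<alpha> | component y \<alpha> \<noteq> 0. \<Sum>\<beta> | component z \<beta> \<noteq> 0.
      bracket (component y \<alpha>) (component z \<beta>)) \<in> pos_part gr \<pi>"
    unfolding pos_part_def by (intro lie.span_sum) auto
  moreover have "bracket y z = (\<Sum>\<alpha> | component y \<alpha> \<noteq> 0. \<Sum>\<beta> | component z \<beta> \<noteq> 0.
      bracket (component y \<alpha>) (component z \<beta>))"
  proof -
    have z: "bracket u z = (\<Sum>\<beta> | component z \<beta> \<noteq> 0. bracket u (component z \<beta>))" for u
      by (rule trans[OF arg_cong[OF component_sum[of z], of "bracket u"] bracket_sum_right])
    show ?thesis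
      unfolding z[symmetric]
      by (rule trans[OF arg_cong[OF component_sum[of y], of "\<lambda>u. bracket u z"] bracket_sum_left])
  qed
  ultimately show ?thesis by simp
qed

end

theorem lemma3p2p1:
  fixes gr :: "'q::linordered_ab_group_add \<Rightarrow> 'g::lie_algebra set"
    and \<pi> :: "'q \<Rightarrow> int"
    and x :: "'q \<Rightarrow> 'g"
    and \<phi> :: "'g \<Rightarrow> complex"
    and A :: "'g nc_poly set ring"
    and I :: "'g nc_poly set set"
    and M :: "('g nc_poly set, 'g whittaker_elem) module"
    and V :: "('g nc_poly set, 'g whittaker_elem set) module"
    and w' :: "'g whittaker_elem set"
  assumes "free_abelian TYPE('q)"
    and "\<And>\<alpha> \<beta>. \<pi> (\<alpha> + \<beta>) = \<pi> \<alpha> + \<pi> \<beta>"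
    and "\<And>\<alpha> \<beta>. \<alpha> \<le> \<beta> \<Longrightarrow> \<pi> \<alpha> \<le> \<pi> \<beta>"
    and "lie_grading gr"
    and "Q_good gr \<pi>"
    and "\<And>\<alpha>. \<alpha> \<in> supp gr - central_nonpos gr \<pi> \<Longrightarrow>
           x \<alpha> \<in> gr \<alpha> \<and> x \<alpha> \<noteq> 0 \<and> x \<alpha> \<notin> center_nonpos gr \<pi>"
    and "lie_character (pos_part gr \<pi>) \<phi>"
    and "nonsingular gr \<pi> x \<phi>"
    and "A = sym_algebra (center_nonpos gr \<pi>)"
    and "ideal I A"
    and "M = whittaker_module (pos_part gr \<pi>) \<phi>"
    and "V = quotient_module M (set_times_module (to_env ` I) M)"
    and "w' = set_times_module (to_env ` I) M +>\<^bsub>M\<^esub> whittaker_generator (pos_part gr \<pi>) \<phi>"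
  shows "\<forall>v. whittaker_vector (pos_part gr \<pi>) \<phi> V v \<longrightarrow>
           (\<exists>p \<in> carrier A. v = to_env p \<odot>\<^bsub>V\<^esub> w')"
proof -
  obtain top where top: "maximal_in {\<alpha> \<in> supp_pos gr \<pi>. \<phi> (x \<alpha>) \<noteq> 0} top"
    "\<forall>\<beta> \<in> supp_nonpos gr \<pi> - central_nonpos gr \<pi>. \<exists>y\<in>gr (top - \<beta>). \<phi> (bracket y (x \<beta>)) \<noteq> 0"
    using assms(8) unfolding nonsingular_def by blast
  interpret good_grading gr \<pi> x \<phi> top
  proof unfold_locales
    show "\<And>\<alpha>. \<alpha> \<in> supp gr - central_nonpos gr \<pi> \<Longrightarrow>
        x \<alpha> \<in> gr \<alpha> \<and> x \<alpha> \<noteq> 0 \<and> x \<alpha> \<notin> center_nonpos gr \<pi>" by (rule assms(6))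
    show "\<And>\<alpha> \<beta>. \<alpha> \<le> \<beta> \<Longrightarrow> \<pi> \<alpha> \<le> \<pi> \<beta>" by (rule assms(3))
  qed (simp_all add: assms(2,4,5,7) top)
  interpret W: whittaker_setting X coord Zs J \<pi> "pos_part gr \<pi>" \<phi> top I
  proof (intro whittaker_setting.intro whittaker_setting_axioms.intro whittaker_quotient.intro)
    show "whittaker_frame X coord Zs J \<pi> (pos_part gr \<pi>) \<phi> top" by unfold_locales
    show "lie.subspace (pos_part gr \<pi>)" by (simp add: pos_part_def lie.subspace_span)
    show "ideal I (sym_algebra Zs)" using assms(9,10) by simp
    show "X \<alpha> = 0" if "\<alpha> \<notin> J" for \<alpha> using that by (simp add: X_def)
    show "X \<alpha> \<in> pos_part gr \<pi>" if "\<pi> \<alpha> > 0" for \<alpha> using gr_pos_part[OF X_gr that] .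
  qed (use char bracket_pos_part nondegenerate subspace_Z in \<open>auto simp: center_nonpos_def\<close>)
  \<comment> \<open>The module and the generator of the statement unfold to those of the
    locale.\<close>
  show ?thesis
    using W.whittaker_vector_central
    unfolding assms(9,11-13) W.mod.V_def W.mod.w'_def W.mod.IM_def W.mod.M_def by blast
qed

end
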